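(* Let $\mathcal{G}=(\Gamma,G)$ be a locally finite nonsingular graph of countable groups with $\Gamma^1\neq\emptyset$, and let $v\in\Gamma^0$. The action of $\pi_1(\mathcal{G},v)$ on $v\partial X_{\mathcal{G}}$ is not minimal if and only if there exists an edge $e\in\Gamma^1$ such that $\alpha_{\overline e}$ is surjective, and one of the following holds: (a) $e$ is a loop, i.e. $r(e)=s(e)$, and $\mathcal{G}$ is treelike at $e$; (b) $e$ lies on a minimal cycle $\eta$ of length greater than one, $\alpha_{\overline f}$ is surjective for each edge $f$ that lies on $\eta$, and $\mathcal{G}$ is treelike at $\eta$; or (c) $e$ does not lie on any minimal cycle of $\Gamma$, $\mathcal{G}$ is treelike at $e$, and there exists $\xi\in r(e)\partial W_{\mathcal{G}}$ such that $e$ does not lie on $\xi$.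
   Context: Graphs. A graph $\Gamma=(\Gamma^0,\Gamma^1,r,s)$ consists of countable sets $\Gamma^0$ (vertices) and $\Gamma^1$ (edges), maps $r,s:\Gamma^1\to\Gamma^0$ (range, source), and a map $e\mapsto\overline e$ on $\Gamma^1$ with $\overline e\neq e$, $\overline{\overline e}=e$, $s(e)=r(\overline e)$. A path of length $n\ge1$ is $e_1\cdots e_n$ with $s(e_i)=r(e_{i+1})$; range $r(e_1)$, source $s(e_n)$; vertices are paths of length $0$. It is reduced if $e_{i+1}\ne\overline{e_i}$ for all $i$. $x\Gamma^*y$ is the set of reduced paths with range $x$ and source $y$. A minimal cycle is a reduced path $e_1\cdots e_n$ with range equal to source and with the vertices $r(e_i)$ pairwise distinct. A tree is a connected graph in which any two vertices are joined by a unique reduced path; in a tree, an edge $f$ points towards a vertex $x$ if the unique reduced path with range $x$ and source $r(f)$ does not contain $f$ (i.e. $r(f)$ is closer to $x$ than $s(f)$). Graphs of groups. A graph of groups $\mathcal{G}=(\Gamma,G)$ consists of a connected graph $\Gamma$, groups $G_x$ ($x\in\Gamma^0$) and $G_e=G_{\overline e}$ ($e\in\Gamma^1$), and monomorphisms $\alpha_e:G_e\to G_{r(e)}$. It is locally finite if $|r^{-1}(x)|<\infty$ for all $x$ and $[G_{r(e)}:\alpha_e(G_e)]<\infty$ for all $e$; nonsingular if $[G_{r(e)}:\alpha_e(G_e)]>1$ whenever $r^{-1}(r(e))=\{e\}$; a graph of countable groups if every $G_x$ is countable. For each $e$ fix a transversal $\Sigma_e\ni1$ for $G_{r(e)}/\alpha_e(G_e)$.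 Words. A $\mathcal{G}$-word is a sequence $g_1$, or $g_1e_1\cdots g_ne_n$, or $g_1e_1\cdots g_ne_ng_{n+1}$ with $s(e_i)=r(e_{i+1})$, $g_j\in G_{r(e_j)}$, $g_{n+1}\in G_{s(e_n)}$ (and $g_1$ in some vertex group if $n=0$); range $r(e_1)$, source $s(e_n)$, length $n$. It is reduced if (for $n>0$) $g_j\in\Sigma_{e_j}$ for $1\le j\le n$ and $g_{i+1}\ne1$ whenever $e_i=\overline{e_{i+1}}$ ($g_{n+1}$ arbitrary). A $\mathcal{G}$-path is a reduced $\mathcal{G}$-word $1_x$ or $g_1e_1\cdots g_ne_n$. $\pi_1(\mathcal{G},v)$ is the group of $\mathcal{G}$-words with range and source $v$ modulo the relations of the vertex groups and the relations $e\overline e=1_{r(e)}$, $e\,\alpha_{\overline e}(g)=\alpha_e(g)\,e$ ($g\in G_e$), under concatenation; each class contains a unique reduced $\mathcal{G}$-word. Boundary. An infinite reduced $\mathcal{G}$-path is a sequence $g_1e_1g_2e_2\cdots$ all of whose initial segments $g_1e_1\cdots g_ne_n$ are $\mathcal{G}$-paths; its range is $r(e_1)$. $x\partial W_{\mathcal{G}}$ is the set of those with range $x$, and $v\partial X_{\mathcal{G}}=v\partial W_{\mathcal{G}}$, with topology having base the sets $Z(\mu)$ of extensions of $\mathcal{G}$-paths $\mu$ with range $v$. $\pi_1(\mathcal{G},v)$ acts on $v\partial X_{\mathcal{G}}$ by concatenation followed by reduction. An edge $e$ lies on $h_1f_1h_2f_2\cdots$ if $e=f_i$ for some $i$. An action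 is minimal if every orbit is dense. Upstream graphs. If $e\in\Gamma^1$ with $s(e)\ne r(e)$, $E_{s,e}$ is the subgraph of $\Gamma$ whose vertices are $s(e)$ and all $x$ for which there is a reduced path $e_1\cdots e_n\in s(e)\Gamma^*x$ with $e_1\ne\overline e$, and whose edges are the edges appearing on these paths together with their reversals. If $s(e)=r(e)$, $E_{s,e}$ is defined the same way with the condition $e_1\notin\{e,\overline e\}$. If $\eta=f_1\cdots f_m$ is a minimal cycle with $m\ge2$, $E_{s,\eta,f_j}$ is defined the same way using reduced paths $e_1\cdots e_n\in s(f_j)\Gamma^*x$ with $e_1\notin\{f_{j+1},\overline{f_j}\}$ (indices mod $m$), together with the vertex $s(f_j)$. Treelike. $\mathcal{G}$ is treelike at the edge $e$ if $E_{s,e}$ is a tree and $\alpha_{\overline f}$ is onto for each edge $f$ of $E_{s,e}$ that points towards $s(e)$. $\mathcal{G}$ is treelike at a minimal cycle $\eta=e_1\cdots e_n$ of length greater than one if for each $1\le i\le n$ the graph $E_{s,\eta,e_i}$ is a tree and $\alpha_{\overline f}$ is onto for each edge $f$ of $E_{s,\eta,e_i}$ that points towards $s(e_i)$. *)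

theory Defs
  imports
    "HOL-Analysis.Abstract_Topology"
    "HOL-Library.Countable_Set"
    "HOL-Algebra.Group_Action"
    "HOL-Algebra.Left_Coset"
begin

section \<open>Graphs with edge reversal\<close>

record ('v, 'e) sgraph =
  verts :: "'v set"
  edges :: "'e set"
  rng :: "'e \<Rightarrow> 'v"
  src :: "'e \<Rightarrow> 'v"
  opp :: "'e \<Rightarrow> 'e"

locale serre_graph =
  fixes \<Gamma> :: "('v, 'e, 'z) sgraph_scheme"
  assumes countable_verts: "countable (verts \<Gamma>)"
    and countable_edges: "countable (edges \<Gamma>)"
    and rng_closed: "e \<in> edges \<Gamma> \<Longrightarrow> rng \<Gamma> e \<in> verts \<Gamma>"
    and src_closed: "e \<in> edges \<Gamma> \<Longrightarrow> src \<Gamma> e \<in> verts \<Gamma>"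
    and opp_closed: "e \<in> edges \<Gamma> \<Longrightarrow> opp \<Gamma> e \<in> edges \<Gamma>"
    and opp_neq: "e \<in> edges \<Gamma> \<Longrightarrow> opp \<Gamma> e \<noteq> e"
    and opp_opp: "e \<in> edges \<Gamma> \<Longrightarrow> opp \<Gamma> (opp \<Gamma> e) = e"
    and src_eq_rng_opp: "e \<in> edges \<Gamma> \<Longrightarrow> src \<Gamma> e = rng \<Gamma> (opp \<Gamma> e)"

text \<open>Paths \<open>e\<^sub>1 \<dots> e\<^sub>n\<close> are read from the range \<open>x = r(e\<^sub>1)\<close> to the source
  \<open>y = s(e\<^sub>n)\<close>; the empty list stands for the vertex \<open>x = y\<close>.\<close>

fun gpath :: "('v, 'e, 'z) sgraph_scheme \<Rightarrow> 'v \<Rightarrow> 'e list \<Rightarrow> 'v \<Rightarrow> bool" where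
  "gpath \<Gamma> x [] y \<longleftrightarrow> x \<in> verts \<Gamma> \<and> x = y"
| "gpath \<Gamma> x (e # p) y \<longleftrightarrow> e \<in> edges \<Gamma> \<and> rng \<Gamma> e = x \<and> gpath \<Gamma> (src \<Gamma> e) p y"

definition reduced_path :: "('v, 'e, 'z) sgraph_scheme \<Rightarrow> 'e list \<Rightarrow> bool" where
  "reduced_path \<Gamma> p \<longleftrightarrow> (\<forall>i. Suc i < length p \<longrightarrow> p ! Suc i \<noteq> opp \<Gamma> (p ! i))"

definition rpaths :: "('v, 'e, 'z) sgraph_scheme \<Rightarrow> 'v \<Rightarrow> 'v \<Rightarrow> 'e list set" where
  "rpaths \<Gamma> x y = {p. gpath \<Gamma> x p y \<and> reduced_path \<Gamma> p}"

definition minimal_cycle :: "('v, 'e, 'z) sgraph_scheme \<Rightarrow> 'e list \<Rightarrow> bool" where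
  "minimal_cycle \<Gamma> \<eta> \<longleftrightarrow>
     \<eta> \<noteq> [] \<and> (\<exists>x. \<eta> \<in> rpaths \<Gamma> x x) \<and> distinct (map (rng \<Gamma>) \<eta>)"

definition connected_sgraph :: "('v, 'e, 'z) sgraph_scheme \<Rightarrow> bool" where
  "connected_sgraph \<Gamma> \<longleftrightarrow> (\<forall>x\<in>verts \<Gamma>. \<forall>y\<in>verts \<Gamma>. \<exists>p. gpath \<Gamma> x p y)"

text \<open>The case \<open>x = y\<close> is included, so a tree has no loops.\<close>

definition is_tree :: "('v, 'e, 'z) sgraph_scheme \<Rightarrow> bool" where
  "is_tree T \<longleftrightarrow>
     connected_sgraph T \<and> (\<forall>x\<in>verts T. \<forall>y\<in>verts T. \<exists>!p. p \<in> rpaths T x y)"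

text \<open>In a tree, \<open>f\<close> points towards \<open>x\<close> iff \<open>r(f)\<close> is closer to \<open>x\<close> than \<open>s(f)\<close>, i.e. iff the
  reduced path from \<open>x\<close> to \<open>r(f)\<close> does not traverse \<open>f\<close> in either direction.  Excluding both
  \<open>f\<close> and its reversal is essential: if \<open>s(f)\<close> is the closer end, then that path ends with the
  reversal of \<open>f\<close>, whereas \<open>f\<close> itself never occurs on it.\<close>

definition points_towards :: "('v, 'e, 'z) sgraph_scheme \<Rightarrow> 'e \<Rightarrow> 'v \<Rightarrow> bool" where
  "points_towards T f x \<longleftrightarrow>
     (let p = (THE p. p \<in> rpaths T x (rng T f)) in f \<notin> set p \<and> opp T f \<notin> set p)"


section \<open>Graphs of groups\<close>

text \<open>All vertex groups are carried by one type, and so are all edge groups; carriers of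
  different groups may overlap.\<close>

record ('v, 'e, 'g, 'h) gog = "('v, 'e) sgraph" +
  vgrp :: "'v \<Rightarrow> 'g monoid"
  egrp :: "'e \<Rightarrow> 'h monoid"
  emb :: "'e \<Rightarrow> 'h \<Rightarrow> 'g"

locale graph_of_groups = serre_graph \<G> for \<G> :: "('v, 'e, 'g, 'h, 'z) gog_scheme" +
  assumes connected: "connected_sgraph \<G>"
    and vgrp_group: "x \<in> verts \<G> \<Longrightarrow> group (vgrp \<G> x)"
    and egrp_group: "e \<in> edges \<G> \<Longrightarrow> group (egrp \<G> e)"
    and egrp_opp: "e \<in> edges \<G> \<Longrightarrow> egrp \<G> (opp \<G> e) = egrp \<G> e"
    and emb_mon: "e \<in> edges \<G> \<Longrightarrow> emb \<G> e \<in> mon (egrp \<G> e) (vgrp \<G> (rng \<G> e))"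

definition emb_image :: "('v, 'e, 'g, 'h, 'z) gog_scheme \<Rightarrow> 'e \<Rightarrow> 'g set" where
  "emb_image \<G> e = emb \<G> e ` carrier (egrp \<G> e)"

definition emb_surj :: "('v, 'e, 'g, 'h, 'z) gog_scheme \<Rightarrow> 'e \<Rightarrow> bool" where
  "emb_surj \<G> e \<longleftrightarrow> emb_image \<G> e = carrier (vgrp \<G> (rng \<G> e))"

definition emb_cosets :: "('v, 'e, 'g, 'h, 'z) gog_scheme \<Rightarrow> 'e \<Rightarrow> 'g set set" where
  "emb_cosets \<G> e = lcosets\<^bsub>vgrp \<G> (rng \<G> e)\<^esub> (emb_image \<G> e)"

definition locally_finite_gog :: "('v, 'e, 'g, 'h, 'z) gog_scheme \<Rightarrow> bool" where
  "locally_finite_gog \<G> \<longleftrightarrow>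
     (\<forall>x\<in>verts \<G>. finite {e \<in> edges \<G>. rng \<G> e = x}) \<and>
     (\<forall>e\<in>edges \<G>. finite (emb_cosets \<G> e))"

text \<open>An infinite index also counts as greater than one, although \<^const>\<open>card\<close> is then \<open>0\<close>.\<close>

definition nonsingular_gog :: "('v, 'e, 'g, 'h, 'z) gog_scheme \<Rightarrow> bool" where
  "nonsingular_gog \<G> \<longleftrightarrow>
     (\<forall>e\<in>edges \<G>. {f \<in> edges \<G>. rng \<G> f = rng \<G> e} = {e} \<longrightarrow>
        infinite (emb_cosets \<G> e) \<or> card (emb_cosets \<G> e) > 1)"

definition countable_groups_gog :: "('v, 'e, 'g, 'h, 'z) gog_scheme \<Rightarrow> bool" where
  "countable_groups_gog \<G> \<longleftrightarrow> (\<forall>x\<in>verts \<G>. countable (carrier (vgrp \<G> x)))"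

definition is_transversal :: "('v, 'e, 'g, 'h, 'z) gog_scheme \<Rightarrow> 'e \<Rightarrow> 'g set \<Rightarrow> bool" where
  "is_transversal \<G> e A \<longleftrightarrow>
     A \<subseteq> carrier (vgrp \<G> (rng \<G> e)) \<and> \<one>\<^bsub>vgrp \<G> (rng \<G> e)\<^esub> \<in> A \<and>
     (\<forall>C\<in>emb_cosets \<G> e. \<exists>!g. g \<in> A \<and> g \<in> C)"


section \<open>Words and the fundamental group\<close>

text \<open>The triple \<open>(x, [(g\<^sub>1, e\<^sub>1), \<dots>, (g\<^sub>n, e\<^sub>n)], g)\<close> is the word
  \<open>g\<^sub>1 e\<^sub>1 \<dots> g\<^sub>n e\<^sub>n g\<close> with range \<open>x\<close>.  A word \<open>g\<^sub>1 e\<^sub>1 \<dots> g\<^sub>n e\<^sub>n\<close> without a final group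
  element is represented with \<open>g = 1\<close>.  The component \<open>x\<close> matters only for \<open>n = 0\<close>, since
  vertex groups may overlap.\<close>

type_synonym ('v, 'e, 'g) gword = "'v \<times> ('g \<times> 'e) list \<times> 'g"

fun gchain ::
  "('v, 'e, 'g, 'h, 'z) gog_scheme \<Rightarrow> 'v \<Rightarrow> ('g \<times> 'e) list \<Rightarrow> 'v \<Rightarrow> bool" where
  "gchain \<G> x [] y \<longleftrightarrow> x \<in> verts \<G> \<and> x = y"
| "gchain \<G> x ((g, e) # p) y \<longleftrightarrow>
     e \<in> edges \<G> \<and> rng \<G> e = x \<and> g \<in> carrier (vgrp \<G> x) \<and> gchain \<G> (src \<G> e) p y"

definition gwords ::
  "('v, 'e, 'g, 'h, 'z) gog_scheme \<Rightarrow> 'v \<Rightarrow> 'v \<Rightarrow> ('v, 'e, 'g) gword set" where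
  "gwords \<G> x y = {(x, p, g) | p g. gchain \<G> x p y \<and> g \<in> carrier (vgrp \<G> y)}"

text \<open>Concatenation of composable words; the two group elements that become adjacent are
  multiplied, which accounts for the relations of the vertex groups.\<close>

fun wconcat ::
  "('v, 'e, 'g, 'h, 'z) gog_scheme \<Rightarrow> ('v, 'e, 'g) gword \<Rightarrow> ('v, 'e, 'g) gword \<Rightarrow> ('v, 'e, 'g) gword"
where
  "wconcat \<G> (x, p, g) (y, [], h) = (x, p, g \<otimes>\<^bsub>vgrp \<G> y\<^esub> h)"
| "wconcat \<G> (x, p, g) (y, (h, e) # q, k) = (x, p @ (g \<otimes>\<^bsub>vgrp \<G> y\<^esub> h, e) # q, k)"

inductive weq ::
  "('v, 'e, 'g, 'h, 'z) gog_scheme \<Rightarrow> ('v, 'e, 'g) gword \<Rightarrow> ('v, 'e, 'g) gword \<Rightarrow> bool"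
  for \<G> where
  backtrack: "e \<in> edges \<G> \<Longrightarrow>
    weq \<G>
      (rng \<G> e, [(\<one>\<^bsub>vgrp \<G> (rng \<G> e)\<^esub>, e), (\<one>\<^bsub>vgrp \<G> (src \<G> e)\<^esub>, opp \<G> e)], \<one>\<^bsub>vgrp \<G> (rng \<G> e)\<^esub>)
      (rng \<G> e, [], \<one>\<^bsub>vgrp \<G> (rng \<G> e)\<^esub>)"
| slide: "e \<in> edges \<G> \<Longrightarrow> g \<in> carrier (egrp \<G> e) \<Longrightarrow>
    weq \<G>
      (rng \<G> e, [(\<one>\<^bsub>vgrp \<G> (rng \<G> e)\<^esub>, e)], emb \<G> (opp \<G> e) g)
      (rng \<G> e, [(emb \<G> e g, e)], \<one>\<^bsub>vgrp \<G> (src \<G> e)\<^esub>)"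
| refl: "w \<in> gwords \<G> x y \<Longrightarrow> weq \<G> w w"
| sym: "weq \<G> w w' \<Longrightarrow> weq \<G> w' w"
| trans: "weq \<G> w w' \<Longrightarrow> weq \<G> w' w'' \<Longrightarrow> weq \<G> w w''"
| cong: "weq \<G> w w' \<Longrightarrow> w \<in> gwords \<G> x y \<Longrightarrow> w' \<in> gwords \<G> x y \<Longrightarrow>
    u \<in> gwords \<G> z x \<Longrightarrow> t \<in> gwords \<G> y z' \<Longrightarrow>
    weq \<G> (wconcat \<G> u (wconcat \<G> w t)) (wconcat \<G> u (wconcat \<G> w' t))"

definition weq_rel ::
  "('v, 'e, 'g, 'h, 'z) gog_scheme \<Rightarrow> 'v \<Rightarrow> (('v, 'e, 'g) gword \<times> ('v, 'e, 'g) gword) set" where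
  "weq_rel \<G> v = {(w, w'). w \<in> gwords \<G> v v \<and> w' \<in> gwords \<G> v v \<and> weq \<G> w w'}"

definition pi1 ::
  "('v, 'e, 'g, 'h, 'z) gog_scheme \<Rightarrow> 'v \<Rightarrow> ('v, 'e, 'g) gword set monoid" where
  "pi1 \<G> v =
     \<lparr>carrier = gwords \<G> v v // weq_rel \<G> v,
      mult = (\<lambda>A B. \<Union>a\<in>A. \<Union>b\<in>B. weq_rel \<G> v `` {wconcat \<G> a b}),
      one = weq_rel \<G> v `` {(v, [], \<one>\<^bsub>vgrp \<G> v\<^esub>)}\<rparr>"


section \<open>Reduced words and the boundary\<close>

text \<open>In the following, \<open>S e\<close> is the chosen transversal for the edge \<open>e\<close>.\<close>

definition reduced_gword ::
  "('v, 'e, 'g, 'h, 'z) gog_scheme \<Rightarrow> ('e \<Rightarrow> 'g set) \<Rightarrow> ('v, 'e, 'g) gword \<Rightarrow> bool" where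
  "reduced_gword \<G> S = (\<lambda>(x, p, g).
     (\<forall>i<length p. fst (p ! i) \<in> S (snd (p ! i))) \<and>
     (\<forall>i. Suc i < length p \<and> snd (p ! i) = opp \<G> (snd (p ! Suc i)) \<longrightarrow>
        fst (p ! Suc i) \<noteq> \<one>\<^bsub>vgrp \<G> (rng \<G> (snd (p ! Suc i)))\<^esub>))"

definition reduced_form ::
  "('v, 'e, 'g, 'h, 'z) gog_scheme \<Rightarrow> ('e \<Rightarrow> 'g set) \<Rightarrow> ('v, 'e, 'g) gword \<Rightarrow> ('v, 'e, 'g) gword"
where
  "reduced_form \<G> S w = (THE w'. weq \<G> w w' \<and> reduced_gword \<G> S w')"

definition chain_src :: "('v, 'e, 'g, 'h, 'z) gog_scheme \<Rightarrow> 'v \<Rightarrow> ('g \<times> 'e) list \<Rightarrow> 'v" where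
  "chain_src \<G> x p = (if p = [] then x else src \<G> (snd (last p)))"

definition word_of_chain ::
  "('v, 'e, 'g, 'h, 'z) gog_scheme \<Rightarrow> 'v \<Rightarrow> ('g \<times> 'e) list \<Rightarrow> ('v, 'e, 'g) gword" where
  "word_of_chain \<G> x p = (x, p, \<one>\<^bsub>vgrp \<G> (chain_src \<G> x p)\<^esub>)"

text \<open>The path \<open>1\<^sub>x\<close> of length zero is the empty list.\<close>

definition reduced_gpaths ::
  "('v, 'e, 'g, 'h, 'z) gog_scheme \<Rightarrow> ('e \<Rightarrow> 'g set) \<Rightarrow> 'v \<Rightarrow> ('g \<times> 'e) list set" where
  "reduced_gpaths \<G> S x =
     {p. (\<exists>y. word_of_chain \<G> x p \<in> gwords \<G> x y) \<and> reduced_gword \<G> S (word_of_chain \<G> x p)}"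

definition boundary ::
  "('v, 'e, 'g, 'h, 'z) gog_scheme \<Rightarrow> ('e \<Rightarrow> 'g set) \<Rightarrow> 'v \<Rightarrow> (nat \<Rightarrow> 'g \<times> 'e) set" where
  "boundary \<G> S x = {\<xi>. \<forall>n. map \<xi> [0..<n] \<in> reduced_gpaths \<G> S x}"

definition lies_on :: "'e \<Rightarrow> (nat \<Rightarrow> 'g \<times> 'e) \<Rightarrow> bool" where
  "lies_on e \<xi> \<longleftrightarrow> (\<exists>i. snd (\<xi> i) = e)"

definition cylinder ::
  "('v, 'e, 'g, 'h, 'z) gog_scheme \<Rightarrow> ('e \<Rightarrow> 'g set) \<Rightarrow> 'v \<Rightarrow> ('g \<times> 'e) list \<Rightarrow>
     (nat \<Rightarrow> 'g \<times> 'e) set" where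
  "cylinder \<G> S x \<mu> = {\<xi> \<in> boundary \<G> S x. map \<xi> [0..<length \<mu>] = \<mu>}"

text \<open>Two cylinder sets are nested or disjoint, so they form a base of the topology they
  generate.\<close>

definition boundary_topology ::
  "('v, 'e, 'g, 'h, 'z) gog_scheme \<Rightarrow> ('e \<Rightarrow> 'g set) \<Rightarrow> 'v \<Rightarrow> (nat \<Rightarrow> 'g \<times> 'e) topology" where
  "boundary_topology \<G> S x =
     topology_generated_by {cylinder \<G> S x \<mu> | \<mu>. \<mu> \<in> reduced_gpaths \<G> S x}"

text \<open>Concatenation followed by reduction: the reduction of the infinite word \<open>w \<xi>\<close> is the
  infinite reduced path \<open>\<eta>\<close> to which the reduced forms of the finite words
  \<open>w h\<^sub>1 f\<^sub>1 \<dots> h\<^sub>m f\<^sub>m\<close> converge letter by letter, where \<open>\<xi> = h\<^sub>1 f\<^sub>1 h\<^sub>2 f\<^sub>2 \<dots>\<close>.  The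
  result is the same for all words \<open>w\<close> in the class \<open>\<gamma>\<close>.\<close>

definition reduces_to ::
  "('v, 'e, 'g, 'h, 'z) gog_scheme \<Rightarrow> ('e \<Rightarrow> 'g set) \<Rightarrow> 'v \<Rightarrow> ('v, 'e, 'g) gword \<Rightarrow>
     (nat \<Rightarrow> 'g \<times> 'e) \<Rightarrow> (nat \<Rightarrow> 'g \<times> 'e) \<Rightarrow> bool" where
  "reduces_to \<G> S v w \<xi> \<eta> \<longleftrightarrow>
     (\<forall>n. \<forall>\<^sub>F m in sequentially.
        case reduced_form \<G> S (wconcat \<G> w (word_of_chain \<G> v (map \<xi> [0..<m]))) of
          (x, p, g) \<Rightarrow> take n p = map \<eta> [0..<n])"

definition boundary_action ::
  "('v, 'e, 'g, 'h, 'z) gog_scheme \<Rightarrow> ('e \<Rightarrow> 'g set) \<Rightarrow> 'v \<Rightarrow> ('v, 'e, 'g) gword set \<Rightarrow>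
     (nat \<Rightarrow> 'g \<times> 'e) \<Rightarrow> (nat \<Rightarrow> 'g \<times> 'e)" where
  "boundary_action \<G> S v \<gamma> =
     (\<lambda>\<xi>\<in>boundary \<G> S v.
        THE \<eta>. \<eta> \<in> boundary \<G> S v \<and> (\<forall>w\<in>\<gamma>. reduces_to \<G> S v w \<xi> \<eta>))"

definition minimal_action ::
  "('a, 'c) monoid_scheme \<Rightarrow> 'b topology \<Rightarrow> ('a \<Rightarrow> 'b \<Rightarrow> 'b) \<Rightarrow> bool" where
  "minimal_action G X \<phi> \<longleftrightarrow> (\<forall>x\<in>topspace X. X closure_of (orbit G \<phi> x) = topspace X)"


section \<open>Upstream graphs and treelike graphs of groups\<close>

text \<open>The subgraph of \<open>\<Gamma>\<close> spanned by \<open>x\<close> and the nonempty reduced paths with range \<open>x\<close> whose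
  first edge is not in \<open>F\<close>.\<close>

definition upstream_paths ::
  "('v, 'e, 'z) sgraph_scheme \<Rightarrow> 'v \<Rightarrow> 'e set \<Rightarrow> 'v \<Rightarrow> 'e list set" where
  "upstream_paths \<Gamma> x F y = {p \<in> rpaths \<Gamma> x y. p \<noteq> [] \<and> hd p \<notin> F}"

definition upstream ::
  "('v, 'e, 'z) sgraph_scheme \<Rightarrow> 'v \<Rightarrow> 'e set \<Rightarrow> ('v, 'e, 'z) sgraph_scheme" where
  "upstream \<Gamma> x F =
     \<Gamma>\<lparr>verts := insert x {y. upstream_paths \<Gamma> x F y \<noteq> {}},
       edges := (let A = (\<Union>y. \<Union>p\<in>upstream_paths \<Gamma> x F y. set p) in A \<union> opp \<Gamma> ` A)\<rparr>"

definition upstream_edge ::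
  "('v, 'e, 'z) sgraph_scheme \<Rightarrow> 'e \<Rightarrow> ('v, 'e, 'z) sgraph_scheme" where
  "upstream_edge \<Gamma> e =
     upstream \<Gamma> (src \<Gamma> e) (if src \<Gamma> e = rng \<Gamma> e then {e, opp \<Gamma> e} else {opp \<Gamma> e})"

text \<open>Here \<open>j\<close> is the position, counted from zero, of an edge on the cycle \<open>\<eta>\<close>.\<close>

definition upstream_cycle ::
  "('v, 'e, 'z) sgraph_scheme \<Rightarrow> 'e list \<Rightarrow> nat \<Rightarrow> ('v, 'e, 'z) sgraph_scheme" where
  "upstream_cycle \<Gamma> \<eta> j =
     upstream \<Gamma> (src \<Gamma> (\<eta> ! j)) {\<eta> ! (Suc j mod length \<eta>), opp \<Gamma> (\<eta> ! j)}"

definition treelike_edge :: "('v, 'e, 'g, 'h, 'z) gog_scheme \<Rightarrow> 'e \<Rightarrow> bool" where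
  "treelike_edge \<G> e \<longleftrightarrow>
     is_tree (upstream_edge \<G> e) \<and>
     (\<forall>f\<in>edges (upstream_edge \<G> e).
        points_towards (upstream_edge \<G> e) f (src \<G> e) \<longrightarrow> emb_surj \<G> (opp \<G> f))"

definition treelike_cycle :: "('v, 'e, 'g, 'h, 'z) gog_scheme \<Rightarrow> 'e list \<Rightarrow> bool" where
  "treelike_cycle \<G> \<eta> \<longleftrightarrow>
     (\<forall>j<length \<eta>.
        is_tree (upstream_cycle \<G> \<eta> j) \<and>
        (\<forall>f\<in>edges (upstream_cycle \<G> \<eta> j).
           points_towards (upstream_cycle \<G> \<eta> j) f (src \<G> (\<eta> ! j)) \<longrightarrow> emb_surj \<G> (opp \<G> f)))"

end

theory Submission
  imports Defs
begin

text \<open>Write \<open>e \<rightarrow> f\<close> if \<open>r f = s e\<close> and either \<open>f\<close> is not the reversal of \<open>e\<close> or \<open>\<alpha>\<^sub>f\<close> is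
  not onto, that is, if \<open>e\<close> can be followed by \<open>f\<close> in a reduced word.  By the normal form theorem, the
  orbit of \<open>\<xi> = h\<^sub>1 f\<^sub>1 h\<^sub>2 f\<^sub>2 \<dots>\<close> meets the cylinder of a path ending in \<open>e\<close> iff \<open>e \<rightarrow>\<^sup>* f\<^sub>k\<close> for
  some \<open>k\<close>.  Hence the action fails to be minimal iff some nonempty set \<open>D\<close> of edges closed under \<open>\<rightarrow>\<close>
  is avoided by an infinite \<open>\<rightarrow>\<close>-chain; the base vertex plays no role.

  Given such a \<open>D\<close>, no edge of \<open>D\<close> has its reversal in \<open>D\<close>.  Therefore \<open>\<alpha>\<close> is onto at the reversal of
  every edge of \<open>D\<close>, and at most one edge of \<open>D\<close> has a given source, so that what lies upstream of an
  edge or cycle in \<open>D\<close> is a tree.  Conversely, a treelike edge or cycle together with the edges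
  upstream of it forms a closed set; it is avoided by the reversed cycle, respectively by \<open>\<xi>\<close>.\<close>

section \<open>Upstream graphs and minimal cycles\<close>

context serre_graph
begin

text \<open>The normal form theorem is obtained by letting words act on reduced words: the defining
  relations act trivially, and a reduced word applied to the trivial one gives itself back. Applied
  to longer and longer initial segments of a boundary point, the same action stabilises letter by
  letter. It alters the group elements of the tail but not its edges, which is why edges alone
  decide which cylinders an orbit meets.

  Changing the base vertex works because the complement of a closed set contains all predecessors of
  its members: an avoiding chain can be extended backwards to any vertex, after cancellation.
  Nonsingularity enters as the existence of a successor of every edge, without which cylinders could
  be empty. A loop is treated as a minimal cycle of length one. The recurring obstacle in the graph
  arguments is backtracking where an upstream path meets the cycle or the edge again.\<close>

lemma gpath_verts: "gpath \<Gamma> x p y \<Longrightarrow> x \<in> verts \<Gamma> \<and> y \<in> verts \<Gamma>"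
  by (induction p arbitrary: x) (auto simp: rng_closed)

lemma gpath_edges: "gpath \<Gamma> x p y \<Longrightarrow> set p \<subseteq> edges \<Gamma>"
  by (induction p arbitrary: x) auto

lemma gpath_append: "gpath \<Gamma> x (p @ q) z \<longleftrightarrow> (\<exists>y. gpath \<Gamma> x p y \<and> gpath \<Gamma> y q z)"
  by (induction p arbitrary: x) (auto dest: gpath_verts)

lemma gpath_snoc: "gpath \<Gamma> x (p @ [e]) z \<longleftrightarrow> gpath \<Gamma> x p (rng \<Gamma> e) \<and> e \<in> edges \<Gamma> \<and> src \<Gamma> e = z"
  by (auto simp: gpath_append src_closed)

lemma rng_opp: "e \<in> edges \<Gamma> \<Longrightarrow> rng \<Gamma> (opp \<Gamma> e) = src \<Gamma> e"
  by (simp add: src_eq_rng_opp)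

lemma src_opp: "e \<in> edges \<Gamma> \<Longrightarrow> src \<Gamma> (opp \<Gamma> e) = rng \<Gamma> e"
  by (simp add: src_eq_rng_opp opp_closed opp_opp)

lemma gpath_rev: "gpath \<Gamma> x p y \<Longrightarrow> gpath \<Gamma> y (rev (map (opp \<Gamma>) p)) x"
proof (induction p arbitrary: x)
  case (Cons e p)
  then show ?case using gpath_verts by (auto simp: gpath_snoc src_opp rng_opp opp_closed)
qed auto

lemma reduced_path_iff: "reduced_path \<Gamma> p \<longleftrightarrow> successively (\<lambda>e f. f \<noteq> opp \<Gamma> e) p"
  by (simp add: reduced_path_def successively_conv_nth)

lemma reduced_path_Cons: "reduced_path \<Gamma> (e # p) \<longleftrightarrow> reduced_path \<Gamma> p \<and> (p \<noteq> [] \<longrightarrow> hd p \<noteq> opp \<Gamma> e)"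
  by (auto simp: reduced_path_iff successively_Cons)

lemma reduced_path_append: "reduced_path \<Gamma> (p @ q) \<longleftrightarrow>
    reduced_path \<Gamma> p \<and> reduced_path \<Gamma> q \<and> (p \<noteq> [] \<longrightarrow> q \<noteq> [] \<longrightarrow> hd q \<noteq> opp \<Gamma> (last p))"
  by (auto simp: reduced_path_iff successively_append_iff)

lemma reduced_path_Nil [simp]: "reduced_path \<Gamma> []"
  by (simp add: reduced_path_iff)

lemma reduced_path_rev:
  assumes "set p \<subseteq> edges \<Gamma>" "reduced_path \<Gamma> p"
  shows "reduced_path \<Gamma> (rev (map (opp \<Gamma>) p))"
  using assms by (auto simp: reduced_path_iff successively_map opp_opp elim!: successively_mono)

text \<open>The map sends \<open>p\<close> to the reduced form of \<open>e # p\<close>. One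
  cancellation is enough, since it exposes the tail of a path that was reduced already.\<close>

lemma rpaths_shift:
  assumes e: "e \<in> edges \<Gamma>" and p: "p \<in> rpaths \<Gamma> (src \<Gamma> e) z"
  shows "(if p \<noteq> [] \<and> hd p = opp \<Gamma> e then tl p else e # p) \<in> rpaths \<Gamma> (rng \<Gamma> e) z"
proof (cases "p \<noteq> [] \<and> hd p = opp \<Gamma> e")
  case True
  then obtain q where "p = opp \<Gamma> e # q" by (cases p) auto
  then show ?thesis using p e by (auto simp: rpaths_def src_opp reduced_path_Cons)
next
  case False
  then have "(if p \<noteq> [] \<and> hd p = opp \<Gamma> e then tl p else e # p) = e # p" by (rule if_not_P)
  moreover have "e # p \<in> rpaths \<Gamma> (rng \<Gamma> e) z"
    using p e False by (auto simp: rpaths_def reduced_path_Cons)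
  ultimately show ?thesis by simp
qed

lemma rpath_exists: "gpath \<Gamma> x p y \<Longrightarrow> \<exists>q. q \<in> rpaths \<Gamma> x y"
proof (induction p arbitrary: x)
  case Nil
  then show ?case by (intro exI[of _ "[]"]) (auto simp: rpaths_def)
next
  case (Cons e p)
  then obtain q where "q \<in> rpaths \<Gamma> (src \<Gamma> e) y" by auto
  then show ?case using rpaths_shift[of e q y] Cons.prems by auto
qed

text \<open>The map of \<open>rpaths_shift\<close> is injective: if it cancels on \<open>p\<close>
  but not on \<open>q\<close>, then \<open>tl p = e # q\<close>, so \<open>p\<close> begins with
  \<open>opp \<Gamma> e\<close> followed by \<open>e\<close> and is not reduced. Existence comes
  from the same map for the reversed edge.\<close>

lemma unique_rpath_shift:
  assumes e: "e \<in> edges \<Gamma>" and ex1: "\<exists>!p. p \<in> rpaths \<Gamma> (rng \<Gamma> e) z"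
  shows "\<exists>!p. p \<in> rpaths \<Gamma> (src \<Gamma> e) z"
proof (rule ex_ex1I)
  obtain q where "q \<in> rpaths \<Gamma> (src \<Gamma> (opp \<Gamma> e)) z" using ex1 e by (auto simp: src_opp)
  then show "\<exists>p. p \<in> rpaths \<Gamma> (src \<Gamma> e) z"
    using rpaths_shift[OF opp_closed[OF e]] e by (metis rng_opp)
  fix p q assume p: "p \<in> rpaths \<Gamma> (src \<Gamma> e) z" and q: "q \<in> rpaths \<Gamma> (src \<Gamma> e) z"
  have eq: "(if p \<noteq> [] \<and> hd p = opp \<Gamma> e then tl p else e # p) = (if q \<noteq> [] \<and> hd q = opp \<Gamma> e then tl q else e # q)"
    using rpaths_shift[OF e p] rpaths_shift[OF e q] ex1 by blast
  have ne: "tl p \<noteq> e # q" if "p \<in> rpaths \<Gamma> (src \<Gamma> e) z" "p \<noteq> []" "hd p = opp \<Gamma> e" for p q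
    using that e by (cases p) (auto simp: rpaths_def reduced_path_Cons opp_opp)
  show "p = q"
  proof (cases "p \<noteq> [] \<and> hd p = opp \<Gamma> e"; cases "q \<noteq> [] \<and> hd q = opp \<Gamma> e")
    assume "p \<noteq> [] \<and> hd p = opp \<Gamma> e" "q \<noteq> [] \<and> hd q = opp \<Gamma> e"
    then show "p = q" using eq by (metis list.collapse)
  next
    assume a: "p \<noteq> [] \<and> hd p = opp \<Gamma> e" "\<not> (q \<noteq> [] \<and> hd q = opp \<Gamma> e)"
    then have "tl p = e # q" using eq by auto
    then show "p = q" using ne[OF p] a by blast
  next
    assume a: "\<not> (p \<noteq> [] \<and> hd p = opp \<Gamma> e)" "q \<noteq> [] \<and> hd q = opp \<Gamma> e"
    then have "tl q = e # p" using eq by auto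
    then show "p = q" using ne[OF q] a by blast
  next
    assume "\<not> (p \<noteq> [] \<and> hd p = opp \<Gamma> e)" "\<not> (q \<noteq> [] \<and> hd q = opp \<Gamma> e)"
    then show "p = q" using eq by auto
  qed
qed

text \<open>Uniqueness of reduced paths from one vertex spreads along edges to all others. This
  suits upstream graphs, which are described from their root.\<close>

lemma tree_from_root:
  assumes x: "x \<in> verts \<Gamma>" and root: "\<And>z. z \<in> verts \<Gamma> \<Longrightarrow> \<exists>!p. p \<in> rpaths \<Gamma> x z"
  shows "is_tree \<Gamma>"
proof -
  have path: "\<exists>p. gpath \<Gamma> x p z" if "z \<in> verts \<Gamma>" for z
    using root[OF that] by (auto simp: rpaths_def)
  have "\<exists>!q. q \<in> rpaths \<Gamma> y z" if "gpath \<Gamma> x p y" "\<exists>!q. q \<in> rpaths \<Gamma> x z" for x p y z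
    using that
  proof (induction p arbitrary: x)
    case (Cons e p)
    then have "e \<in> edges \<Gamma>" "rng \<Gamma> e = x" "gpath \<Gamma> (src \<Gamma> e) p y" by auto
    then show ?case using Cons.IH[of "src \<Gamma> e"] unique_rpath_shift[of e z] Cons.prems(2) by blast
  qed simp
  then have "\<exists>!q. q \<in> rpaths \<Gamma> y z" if "y \<in> verts \<Gamma>" "z \<in> verts \<Gamma>" for y z
    using path[OF that(1)] root[OF that(2)] by blast
  then show ?thesis
    unfolding is_tree_def connected_sgraph_def rpaths_def by blast
qed

section \<open>Upstream graphs: their paths and arcs, and when they are trees\<close>

lemma upstream_simps [simp]:
  "rng (upstream \<Gamma> x F) = rng \<Gamma>" "src (upstream \<Gamma> x F) = src \<Gamma>" "opp (upstream \<Gamma> x F) = opp \<Gamma>"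
  "verts (upstream \<Gamma> x F) = insert x {y. upstream_paths \<Gamma> x F y \<noteq> {}}"
  by (simp_all add: upstream_def)

text \<open>If the upstream graph is a tree, these are exactly its edges pointing towards \<open>x\<close>.\<close>

definition upstream_arcs :: "'v \<Rightarrow> 'e set \<Rightarrow> 'e set" where
  "upstream_arcs x F = {e. \<exists>p. p @ [e] \<in> upstream_paths \<Gamma> x F (src \<Gamma> e)}"

lemma upstream_paths_snoc: "p @ [e] \<in> upstream_paths \<Gamma> x F y \<longleftrightarrow>
    e \<in> edges \<Gamma> \<and> src \<Gamma> e = y \<and>
    (if p = [] then rng \<Gamma> e = x \<and> e \<notin> F else p \<in> upstream_paths \<Gamma> x F (rng \<Gamma> e) \<and> e \<noteq> opp \<Gamma> (last p))"
  by (auto simp: upstream_paths_def rpaths_def gpath_snoc reduced_path_append reduced_path_Cons rng_closed)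

lemma upstream_paths_append:
  assumes "p @ q \<in> upstream_paths \<Gamma> x F y" "p \<noteq> []"
  shows "p \<in> upstream_paths \<Gamma> x F (src \<Gamma> (last p))"
proof -
  obtain z where "gpath \<Gamma> x p z" using assms by (auto simp: upstream_paths_def rpaths_def gpath_append)
  then have "gpath \<Gamma> x p (src \<Gamma> (last p))" using assms(2) by (metis append_butlast_last_id gpath_snoc)
  then show ?thesis using assms by (auto simp: upstream_paths_def rpaths_def reduced_path_append)
qed

lemma upstream_paths_arcs:
  assumes "p \<in> upstream_paths \<Gamma> x F y" "e \<in> set p"
  shows "e \<in> upstream_arcs x F"
proof -
  obtain a b where "p = a @ e # b" using assms(2) by (meson split_list)
  then have "(a @ [e]) @ b \<in> upstream_paths \<Gamma> x F y" using assms by simp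
  from upstream_paths_append[OF this] show ?thesis by (auto simp: upstream_arcs_def)
qed

lemma edges_upstream: "edges (upstream \<Gamma> x F) = upstream_arcs x F \<union> opp \<Gamma> ` upstream_arcs x F"
proof -
  have "(\<Union>y. \<Union>p\<in>upstream_paths \<Gamma> x F y. set p) = upstream_arcs x F"
    using upstream_paths_arcs by (force simp: upstream_arcs_def)
  then show ?thesis by (simp add: upstream_def Let_def)
qed

lemma upstream_arcs_edges: "upstream_arcs x F \<subseteq> edges \<Gamma>"
  by (auto simp: upstream_arcs_def upstream_paths_snoc)

lemma upstream_serre:
  assumes x: "x \<in> verts \<Gamma>"
  shows "serre_graph (upstream \<Gamma> x F)"
proof -
  let ?T = "upstream \<Gamma> x F"
  have sub: "edges ?T \<subseteq> edges \<Gamma>" using upstream_arcs_edges opp_closed by (auto simp: edges_upstream)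
  have "verts ?T \<subseteq> verts \<Gamma>"
    using x by (auto simp: upstream_paths_def rpaths_def dest: gpath_verts)
  then have count: "countable (verts ?T)" "countable (edges ?T)"
    using sub countable_verts countable_edges countable_subset by blast+
  have arc: "src \<Gamma> e \<in> verts ?T \<and> rng \<Gamma> e \<in> verts ?T" if e: "e \<in> upstream_arcs x F" for e
  proof -
    obtain p where p: "p @ [e] \<in> upstream_paths \<Gamma> x F (src \<Gamma> e)" using e by (auto simp: upstream_arcs_def)
    then have "rng \<Gamma> e = x \<or> p \<in> upstream_paths \<Gamma> x F (rng \<Gamma> e)"
      unfolding upstream_paths_snoc by (simp split: if_splits)
    then show ?thesis using p by auto
  qed
  have ends: "rng \<Gamma> e \<in> verts ?T \<and> src \<Gamma> e \<in> verts ?T" if e: "e \<in> edges ?T" for e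
  proof (cases "e \<in> upstream_arcs x F")
    case False
    then obtain d where "d \<in> upstream_arcs x F" "e = opp \<Gamma> d" using e by (auto simp: edges_upstream)
    moreover from this have "d \<in> edges \<Gamma>" using upstream_arcs_edges by blast
    ultimately show ?thesis using arc[of d] by (simp only: rng_opp src_opp)
  qed (use arc in blast)
  have opp: "opp \<Gamma> e \<in> edges ?T" if "e \<in> edges ?T" for e
    using that upstream_arcs_edges by (auto simp: edges_upstream opp_opp subset_iff)
  show ?thesis
  proof
    fix e assume e: "e \<in> edges ?T"
    then have e': "e \<in> edges \<Gamma>" using sub by blast
    show "rng ?T e \<in> verts ?T" "src ?T e \<in> verts ?T" using ends[OF e] by (simp_all only: upstream_simps)
    show "opp ?T e \<in> edges ?T" using opp[OF e] by (simp only: upstream_simps)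
    show "opp ?T e \<noteq> e" "opp ?T (opp ?T e) = e" "src ?T e = rng ?T (opp ?T e)"
      unfolding upstream_simps by (fact opp_neq[OF e'] opp_opp[OF e'] src_eq_rng_opp[OF e'])+
  qed (use count in auto)
qed

lemma gpath_upstream:
  assumes "x \<in> verts \<Gamma>"
  shows "gpath (upstream \<Gamma> x F) y p z \<longleftrightarrow> y \<in> verts (upstream \<Gamma> x F) \<and> gpath \<Gamma> y p z \<and> set p \<subseteq> edges (upstream \<Gamma> x F)"
proof -
  interpret T: serre_graph "upstream \<Gamma> x F" by (rule upstream_serre[OF assms])
  have v: "verts (upstream \<Gamma> x F) \<subseteq> verts \<Gamma>"
    using assms by (auto simp: upstream_paths_def rpaths_def dest: gpath_verts)
  have e: "edges (upstream \<Gamma> x F) \<subseteq> edges \<Gamma>"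
    using upstream_arcs_edges opp_closed by (auto simp: edges_upstream)
  show ?thesis
    using T.rng_closed T.src_closed v e by (induction p arbitrary: y) (auto simp del: upstream_simps(4) simp: subset_iff)
qed

lemma rpaths_upstream:
  assumes "x \<in> verts \<Gamma>"
  shows "p \<in> rpaths (upstream \<Gamma> x F) y z \<longleftrightarrow>
    p \<in> rpaths \<Gamma> y z \<and> y \<in> verts (upstream \<Gamma> x F) \<and> set p \<subseteq> edges (upstream \<Gamma> x F)"
  using gpath_upstream[OF assms] by (auto simp: rpaths_def reduced_path_def simp del: upstream_simps(4))

lemma upstream_rpaths:
  assumes "x \<in> verts \<Gamma>" "p \<in> upstream_paths \<Gamma> x F y"
  shows "p \<in> rpaths (upstream \<Gamma> x F) x y"
  using assms upstream_paths_arcs[OF assms(2)]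
  by (auto simp: rpaths_upstream edges_upstream upstream_paths_def)

lemma Nil_rpaths_upstream: "x \<in> verts \<Gamma> \<Longrightarrow> [] \<in> rpaths (upstream \<Gamma> x F) x x"
  by (simp add: rpaths_upstream) (simp add: rpaths_def)

lemma tree_unique_rpath:
  assumes "x \<in> verts \<Gamma>" "is_tree (upstream \<Gamma> x F)"
    "p \<in> rpaths (upstream \<Gamma> x F) x y" "q \<in> rpaths (upstream \<Gamma> x F) x y"
  shows "p = q"
proof -
  interpret T: serre_graph "upstream \<Gamma> x F" by (rule upstream_serre[OF assms(1)])
  have "x \<in> verts (upstream \<Gamma> x F)" "y \<in> verts (upstream \<Gamma> x F)"
    using assms(3) T.gpath_verts unfolding rpaths_def by blast+
  then show ?thesis using assms(2-4) unfolding is_tree_def by blast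
qed

lemma tree_no_upstream_cycle:
  assumes "x \<in> verts \<Gamma>" "is_tree (upstream \<Gamma> x F)"
  shows "upstream_paths \<Gamma> x F x = {}"
proof -
  have "p = []" if "p \<in> upstream_paths \<Gamma> x F x" for p
    using tree_unique_rpath[OF assms upstream_rpaths[OF assms(1) that] Nil_rpaths_upstream[OF assms(1)]] .
  then show ?thesis by (auto simp: upstream_paths_def)
qed

text \<open>The reduced path from \<open>x\<close> to the range of \<open>d\<close> is an upstream
  path through \<open>d\<close> cut off just before \<open>d\<close>. If it contained
  \<open>d\<close> or its reversal, cutting it there would give a second, shorter reduced path to
  the source of \<open>d\<close>.\<close>

lemma tree_points_towards:
  assumes x: "x \<in> verts \<Gamma>" and tree: "is_tree (upstream \<Gamma> x F)" and d: "d \<in> upstream_arcs x F"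
  shows "points_towards (upstream \<Gamma> x F) d x"
proof -
  let ?T = "upstream \<Gamma> x F"
  obtain p where pd: "p @ [d] \<in> upstream_paths \<Gamma> x F (src \<Gamma> d)"
    using d by (auto simp: upstream_arcs_def)
  have de: "d \<in> edges \<Gamma>" using d upstream_arcs_edges by blast
  have pre: "a \<in> rpaths ?T x (if a = [] then x else src \<Gamma> (last a))" if "a @ b = p @ [d]" for a b
    using upstream_rpaths[OF x upstream_paths_append[of a b x F "src \<Gamma> d"]] Nil_rpaths_upstream[OF x] pd that by auto
  have pT: "p \<in> rpaths ?T x (rng \<Gamma> d)"
    using upstream_rpaths[OF x, of p F "rng \<Gamma> d"] Nil_rpaths_upstream[OF x, of F] pd
    unfolding upstream_paths_snoc by (simp split: if_splits)
  then have the: "(THE p. p \<in> rpaths ?T x (rng \<Gamma> d)) = p"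
    using tree_unique_rpath[OF x tree] by blast
  have pdT: "p @ [d] \<in> rpaths ?T x (src \<Gamma> d)" by (rule upstream_rpaths[OF x pd])
  have "d \<notin> set p"
  proof
    assume "d \<in> set p"
    then obtain a b where p: "p = a @ d # b" by (meson split_list)
    then have "a @ [d] \<in> rpaths ?T x (src \<Gamma> d)" using pre[of "a @ [d]" "b @ [d]"] by simp
    then show False using tree_unique_rpath[OF x tree pdT] p by force
  qed
  moreover have "opp \<Gamma> d \<notin> set p"
  proof
    assume "opp \<Gamma> d \<in> set p"
    then obtain a b where p: "p = a @ opp \<Gamma> d # b" by (meson split_list)
    have "(a @ [opp \<Gamma> d]) @ b @ [d] \<in> upstream_paths \<Gamma> x F (src \<Gamma> d)" using pd p by simp
    from upstream_paths_append[OF this] have "a @ [opp \<Gamma> d] \<in> upstream_paths \<Gamma> x F (rng \<Gamma> d)"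
      using de by (simp add: src_opp)
    then have "a \<in> rpaths ?T x (src \<Gamma> d)"
      using upstream_rpaths[OF x, of a F "src \<Gamma> d"] Nil_rpaths_upstream[OF x, of F] de
      unfolding upstream_paths_snoc by (simp add: rng_opp split: if_splits)
    then show False using tree_unique_rpath[OF x tree pdT] p by force
  qed
  ultimately show ?thesis unfolding points_towards_def by (simp add: the)
qed

text \<open>Injectivity of the source map says that the last edge of an upstream path is determined
  by the vertex it reaches. As no upstream path returns to \<open>x\<close>, two paths to the same
  vertex can be compared from their ends backwards.\<close>

lemma upstream_tree:
  assumes x: "x \<in> verts \<Gamma>"
    and inj: "inj_on (src \<Gamma>) (upstream_arcs x F)"
    and acyc: "upstream_paths \<Gamma> x F x = {}"
  shows "is_tree (upstream \<Gamma> x F)"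
    and "\<And>f. f \<in> edges (upstream \<Gamma> x F) \<Longrightarrow> points_towards (upstream \<Gamma> x F) f x \<Longrightarrow> f \<in> upstream_arcs x F"
proof -
  let ?T = "upstream \<Gamma> x F"
  interpret T: serre_graph ?T by (rule upstream_serre[OF x])
  \<comment> \<open>The upstream graph also contains the reversals of its arcs, so a reduced path in
    it might leave \<open>x\<close> by an edge of \<open>F\<close>. Such an edge would be the
    reversal of an arc with source \<open>x\<close>, or an arc met later on an upstream path; either
    way some upstream path would lead back to \<open>x\<close>.\<close>
  have up: "p = [] \<or> p \<in> upstream_paths \<Gamma> x F z" if "p \<in> rpaths ?T x z" for p z
    using that
  proof (induction p arbitrary: z rule: rev_induct)
    case (snoc g p)
    have pg: "gpath \<Gamma> x p (rng \<Gamma> g)" "g \<in> edges \<Gamma>" "src \<Gamma> g = z" "reduced_path \<Gamma> (p @ [g])" "g \<in> edges ?T" "set p \<subseteq> edges ?T"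
      using snoc.prems unfolding rpaths_upstream[OF x] by (auto simp: rpaths_def gpath_snoc)
    have pT: "p \<in> rpaths ?T x (rng \<Gamma> g)"
      using pg unfolding rpaths_upstream[OF x] by (auto simp: rpaths_def reduced_path_append)
    show ?case
    proof (cases "p = []")
      case True
      then have gx: "rng \<Gamma> g = x" using pg by simp
      have "g \<in> upstream_arcs x F"
      proof (rule ccontr)
        assume "g \<notin> upstream_arcs x F"
        then obtain a where a: "a \<in> upstream_arcs x F" "g = opp \<Gamma> a" using pg(5) by (auto simp: edges_upstream)
        then have "src \<Gamma> a = x" using gx upstream_arcs_edges rng_opp by fastforce
        then show False using a acyc by (auto simp: upstream_arcs_def)
      qed
      then obtain q where q: "q @ [g] \<in> upstream_paths \<Gamma> x F (src \<Gamma> g)" by (auto simp: upstream_arcs_def)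
      then have "q = []" using acyc gx by (auto simp: upstream_paths_snoc split: if_splits)
      then show ?thesis using q True pg by simp
    next
      case False
      then have "p \<in> upstream_paths \<Gamma> x F (rng \<Gamma> g)" using snoc.IH[OF pT] by simp
      then show ?thesis using pg False by (simp add: upstream_paths_snoc reduced_path_append)
    qed
  qed simp
  have uniq: "p = q" if "p \<in> rpaths ?T x z" "q \<in> rpaths ?T x z" for p q z
    using that
  proof (induction p arbitrary: q z rule: rev_induct)
    case Nil
    then have "z = x" by (auto simp: rpaths_def)
    then show ?case using up[OF Nil(2)] acyc by auto
  next
    case (snoc c p)
    have pc: "p @ [c] \<in> upstream_paths \<Gamma> x F z" using up[OF snoc.prems(1)] by simp
    have "q \<noteq> []"
    proof
      assume "q = []"
      then have "z = x" using snoc.prems by (auto simp: rpaths_def)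
      then show False using pc acyc by auto
    qed
    then obtain q' d where q: "q = q' @ [d]" by (metis rev_exhaust)
    have qd: "q' @ [d] \<in> upstream_paths \<Gamma> x F z" using up[OF snoc.prems(2)] q by simp
    have "src \<Gamma> c = z" "src \<Gamma> d = z" using pc qd by (auto simp: upstream_paths_snoc)
    moreover have "c \<in> upstream_arcs x F" "d \<in> upstream_arcs x F"
      using upstream_paths_arcs pc qd by (metis in_set_conv_decomp)+
    ultimately have cd: "c = d" using inj by (auto dest: inj_onD)
    have "p \<in> rpaths ?T x (rng \<Gamma> c)" "q' \<in> rpaths ?T x (rng \<Gamma> c)"
      using snoc.prems unfolding q cd
      by (auto simp: rpaths_def T.gpath_snoc T.reduced_path_append)
    then show ?case using snoc.IH cd q by simp
  qed
  show "is_tree ?T"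
  proof (rule T.tree_from_root)
    show "x \<in> verts ?T" by simp
    show "\<exists>!p. p \<in> rpaths ?T x z" if "z \<in> verts ?T" for z
    proof (rule ex_ex1I)
      show "\<exists>p. p \<in> rpaths ?T x z"
        using that upstream_rpaths[OF x] Nil_rpaths_upstream[OF x] by fastforce
    qed (rule uniq)
  qed
  fix f assume f: "f \<in> edges ?T" "points_towards ?T f x"
  show "f \<in> upstream_arcs x F"
  proof (rule ccontr)
    assume "f \<notin> upstream_arcs x F"
    then obtain d where d: "d \<in> upstream_arcs x F" "f = opp \<Gamma> d" using f(1) by (auto simp: edges_upstream)
    have de: "d \<in> edges \<Gamma>" using d(1) upstream_arcs_edges by blast
    obtain p where "p @ [d] \<in> upstream_paths \<Gamma> x F (src \<Gamma> d)" using d(1) by (auto simp: upstream_arcs_def)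
    then have pd: "p @ [d] \<in> rpaths ?T x (rng \<Gamma> f)" using upstream_rpaths[OF x] de d(2) rng_opp by simp
    then have "(THE p. p \<in> rpaths ?T x (rng \<Gamma> f)) = p @ [d]" using uniq by blast
    then show False using f(2) d(2) de by (simp add: points_towards_def opp_opp)
  qed
qed

text \<open>The cycle is read with indices modulo its length. Reducedness of the list says nothing
  about the step from the last edge to the first; that this step does not backtrack follows from
  distinctness of the ranges.\<close>

lemma minimal_cycle_nth:
  assumes "minimal_cycle \<Gamma> \<eta>"
  shows "0 < length \<eta>"
    and "i < length \<eta> \<Longrightarrow> \<eta> ! i \<in> edges \<Gamma>"
    and "i < length \<eta> \<Longrightarrow> src \<Gamma> (\<eta> ! i) = rng \<Gamma> (\<eta> ! (Suc i mod length \<eta>))"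
    and "i < length \<eta> \<Longrightarrow> \<eta> ! (Suc i mod length \<eta>) \<noteq> opp \<Gamma> (\<eta> ! i)"
    and "i < length \<eta> \<Longrightarrow> j < length \<eta> \<Longrightarrow> rng \<Gamma> (\<eta> ! i) = rng \<Gamma> (\<eta> ! j) \<Longrightarrow> i = j"
proof -
  let ?L = "length \<eta>"
  obtain x where ne: "\<eta> \<noteq> []" and path: "gpath \<Gamma> x \<eta> x" and red: "reduced_path \<Gamma> \<eta>" and dist: "distinct (map (rng \<Gamma>) \<eta>)"
    using assms by (auto simp: minimal_cycle_def rpaths_def)
  show L: "0 < ?L" using ne by simp
  show edge: "\<eta> ! i \<in> edges \<Gamma>" if "i < ?L" for i using gpath_edges[OF path] that by auto
  show inj: "i = j" if "i < ?L" "j < ?L" "rng \<Gamma> (\<eta> ! i) = rng \<Gamma> (\<eta> ! j)" for i j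
    using nth_eq_iff_index_eq[OF dist, of i j] that by simp
  show step: "src \<Gamma> (\<eta> ! i) = rng \<Gamma> (\<eta> ! (Suc i mod ?L))" if i: "i < ?L" for i
  proof (cases "Suc i < ?L")
    case True
    have "\<eta> = take i \<eta> @ \<eta> ! i # \<eta> ! Suc i # drop (Suc (Suc i)) \<eta>"
      using True by (metis Cons_nth_drop_Suc Suc_lessD append_take_drop_id)
    then have "gpath \<Gamma> x (take i \<eta> @ \<eta> ! i # \<eta> ! Suc i # drop (Suc (Suc i)) \<eta>) x" using path by simp
    then show ?thesis using True by (simp add: gpath_append)
  next
    case False
    then have "Suc i = ?L" using i by simp
    moreover have "gpath \<Gamma> x (butlast \<eta> @ [last \<eta>]) x" using path ne by simp
    moreover have "last \<eta> = \<eta> ! i" using \<open>Suc i = ?L\<close> ne by (simp add: last_conv_nth flip: \<open>Suc i = ?L\<close>)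
    moreover have "rng \<Gamma> (\<eta> ! 0) = x" using path ne by (cases \<eta>) auto
    ultimately show ?thesis by (simp add: gpath_snoc)
  qed
  show "\<eta> ! (Suc i mod ?L) \<noteq> opp \<Gamma> (\<eta> ! i)" if i: "i < ?L" for i
  proof (cases "Suc i < ?L")
    case True
    then show ?thesis using red by (simp add: reduced_path_def)
  next
    case False
    then have Si: "Suc i = ?L" using i by simp
    show ?thesis
    proof
      assume eq: "\<eta> ! (Suc i mod ?L) = opp \<Gamma> (\<eta> ! i)"
      then have eq: "\<eta> ! 0 = opp \<Gamma> (\<eta> ! i)" using Si by simp
      show False
      proof (cases "?L = 1")
        case True
        then have "i = 0" using Si by simp
        then show False using eq opp_neq[OF edge[OF i]] by metis
      next
        case False
        then have L1: "1 < ?L" using L by linarith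
        \<comment> \<open>If the first edge reverses the last, the vertex after the first edge is
          the range of the last one. So the cycle has length two, and its only inner step already
          backtracks.\<close>
        have "rng \<Gamma> (\<eta> ! 1) = src \<Gamma> (\<eta> ! 0)" using step[OF L] L1 by simp
        also have "\<dots> = rng \<Gamma> (\<eta> ! i)" using eq edge[OF i] by (simp add: src_opp)
        finally have "i = 1" using inj[OF L1 i] by simp
        then have "\<eta> ! Suc 0 \<noteq> opp \<Gamma> (\<eta> ! 0)" using red L1 by (simp add: reduced_path_def)
        then show False using eq \<open>i = 1\<close> edge[OF i] by (simp add: opp_opp)
      qed
    qed
  qed
qed

lemma minimal_cycle_loop:
  assumes "e \<in> edges \<Gamma>" "rng \<Gamma> e = src \<Gamma> e"
  shows "minimal_cycle \<Gamma> [e]"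
  using assms by (auto simp: minimal_cycle_def rpaths_def reduced_path_Cons src_closed)

text \<open>Loop erasure: if the starting vertex occurs again on the simple path built so far,
  everything before that occurrence is dropped. Keeping the edges in \<open>N\<close> later
  guarantees that the shortened path is reduced.\<close>

lemma simple_path:
  assumes "gpath \<Gamma> x p y" "set p \<subseteq> N"
  shows "\<exists>q. gpath \<Gamma> x q y \<and> set q \<subseteq> N \<and> distinct (map (rng \<Gamma>) q @ [y])"
  using assms
proof (induction p arbitrary: x)
  case Nil
  then show ?case by (intro exI[of _ "[]"]) auto
next
  case (Cons e p)
  then obtain q where q: "gpath \<Gamma> (src \<Gamma> e) q y" "set q \<subseteq> N" "distinct (map (rng \<Gamma>) q @ [y])"
    using Cons.IH[of "src \<Gamma> e"] by (metis gpath.simps(2) list.set_intros(2) subset_iff)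
  consider "x = y" | c where "c \<in> set q" "rng \<Gamma> c = x" | "x \<notin> set (map (rng \<Gamma>) q @ [y])" by auto
  then show ?case
  proof cases
    case 1
    then show ?thesis using Cons.prems gpath_verts by (intro exI[of _ "[]"]) auto
  next
    case 2
    then obtain a b where "q = a @ c # b" by (meson split_list)
    then show ?thesis using q 2 by (intro exI[of _ "c # b"]) (auto simp: gpath_append)
  next
    case 3
    then show ?thesis using Cons.prems q by (intro exI[of _ "e # q"]) auto
  qed
qed

lemma upstream_paths_last:
  assumes "p \<in> upstream_paths \<Gamma> x F y"
  shows "src \<Gamma> (last p) = y"
proof -
  have "p \<noteq> []" using assms by (auto simp: upstream_paths_def)
  then show ?thesis using assms upstream_paths_snoc[of "butlast p" "last p" x F y] by simp
qed

lemma upstream_arcs_last: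
  assumes "p \<in> upstream_paths \<Gamma> x F y"
  shows "last p \<in> upstream_arcs x F"
  using assms upstream_paths_arcs by (metis (mono_tags, lifting) last_in_set mem_Collect_eq upstream_paths_def)

lemma upstream_arcs_step:
  assumes d: "d \<in> upstream_arcs x F" and g: "g \<in> edges \<Gamma>" "rng \<Gamma> g = src \<Gamma> d" "g \<noteq> opp \<Gamma> d"
  shows "g \<in> upstream_arcs x F"
proof -
  obtain p where "p @ [d] \<in> upstream_paths \<Gamma> x F (src \<Gamma> d)" using d by (auto simp: upstream_arcs_def)
  then have "(p @ [d]) @ [g] \<in> upstream_paths \<Gamma> x F (src \<Gamma> g)"
    unfolding upstream_paths_snoc[of "p @ [d]"] using g by simp
  then show ?thesis unfolding upstream_arcs_def by blast
qed

lemma upstream_arcs_start: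
  assumes "g \<in> edges \<Gamma>" "rng \<Gamma> g = x" "g \<notin> F"
  shows "g \<in> upstream_arcs x F"
proof -
  have "[] @ [g] \<in> upstream_paths \<Gamma> x F (src \<Gamma> g)" unfolding upstream_paths_snoc using assms by simp
  then show ?thesis unfolding upstream_arcs_def by blast
qed

end

section \<open>Left multiplication of reduced words\<close>

locale gog_transversals = graph_of_groups \<G> for \<G> :: "('v, 'e, 'g, 'h, 'z) gog_scheme" +
  fixes S :: "'e \<Rightarrow> 'g set"
  assumes transversal: "e \<in> edges \<G> \<Longrightarrow> is_transversal \<G> e (S e)"
begin

abbreviation G :: "'v \<Rightarrow> 'g monoid" where "G \<equiv> vgrp \<G>"
abbreviation E :: "'e \<Rightarrow> 'h monoid" where "E \<equiv> egrp \<G>"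
abbreviation r :: "'e \<Rightarrow> 'v" where "r \<equiv> rng \<G>"
abbreviation s :: "'e \<Rightarrow> 'v" where "s \<equiv> src \<G>"
abbreviation bar :: "'e \<Rightarrow> 'e" where "bar \<equiv> opp \<G>"
abbreviation \<alpha> :: "'e \<Rightarrow> 'h \<Rightarrow> 'g" where "\<alpha> \<equiv> emb \<G>"

lemma graph_simps [simp]:
  assumes "e \<in> edges \<G>"
  shows "r e \<in> verts \<G>" "s e \<in> verts \<G>" "bar e \<in> edges \<G>" "bar e \<noteq> e" "e \<noteq> bar e" "bar (bar e) = e"
    "r (bar e) = s e" "s (bar e) = r e" "E (bar e) = E e" "group (E e)"
  using assms rng_closed src_closed opp_closed opp_neq opp_opp src_eq_rng_opp egrp_opp egrp_group
  by (metis)+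

declare vgrp_group [simp]

lemma emb_hom: "e \<in> edges \<G> \<Longrightarrow> group_hom (E e) (G (r e)) (\<alpha> e)"
  using emb_mon[of e] by (simp add: group_hom_def group_hom_axioms_def mon_def)

lemma emb_bar_hom: "e \<in> edges \<G> \<Longrightarrow> group_hom (E e) (G (s e)) (\<alpha> (bar e))"
  using emb_hom[of "bar e"] by simp

lemma emb_inj: "e \<in> edges \<G> \<Longrightarrow> inj_on (\<alpha> e) (carrier (E e))"
  using emb_mon[of e] by (simp add: mon_def)

lemma transversal_closed: "e \<in> edges \<G> \<Longrightarrow> h \<in> S e \<Longrightarrow> h \<in> carrier (G (r e))"
  and one_transversal: "e \<in> edges \<G> \<Longrightarrow> \<one>\<^bsub>G (r e)\<^esub> \<in> S e"
  using transversal[of e] by (auto simp: is_transversal_def)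

section \<open>Coset representatives and the element carried across an edge\<close>

definition rep :: "'e \<Rightarrow> 'g \<Rightarrow> 'g" where
  "rep e y = (THE h. h \<in> S e \<and> h \<in> y <#\<^bsub>G (r e)\<^esub> emb_image \<G> e)"

definition carry :: "'e \<Rightarrow> 'g \<Rightarrow> 'g" where
  "carry e y = \<alpha> (bar e) (inv_into (carrier (E e)) (\<alpha> e) (inv\<^bsub>G (r e)\<^esub> (rep e y) \<otimes>\<^bsub>G (r e)\<^esub> y))"

lemma emb_coset_iff:
  "x \<in> y <#\<^bsub>G (r e)\<^esub> emb_image \<G> e \<longleftrightarrow> (\<exists>a\<in>carrier (E e). x = y \<otimes>\<^bsub>G (r e)\<^esub> \<alpha> e a)"
  by (auto simp: l_coset_def emb_image_def)

lemma unique_rep: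
  assumes e: "e \<in> edges \<G>" and y: "y \<in> carrier (G (r e))"
  shows "\<exists>!h. h \<in> S e \<and> h \<in> y <#\<^bsub>G (r e)\<^esub> emb_image \<G> e"
  using transversal[OF e] y by (auto simp: is_transversal_def emb_cosets_def LCOSETS_def)

lemma rep_mult:
  assumes e: "e \<in> edges \<G>" and h: "h \<in> S e" and a: "a \<in> carrier (E e)"
  shows "rep e (h \<otimes>\<^bsub>G (r e)\<^esub> \<alpha> e a) = h"
    and "carry e (h \<otimes>\<^bsub>G (r e)\<^esub> \<alpha> e a) = \<alpha> (bar e) a"
proof -
  interpret group_hom "E e" "G (r e)" "\<alpha> e" by (rule emb_hom[OF e])
  have hc: "h \<in> carrier (G (r e))" using e h by (rule transversal_closed)
  let ?y = "h \<otimes>\<^bsub>G (r e)\<^esub> \<alpha> e a"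
  have "h = ?y \<otimes>\<^bsub>G (r e)\<^esub> \<alpha> e (inv\<^bsub>E e\<^esub> a)"
    using hc a by (simp add: H.m_assoc)
  then have "h \<in> ?y <#\<^bsub>G (r e)\<^esub> emb_image \<G> e"
    unfolding emb_coset_iff using a G.inv_closed by blast
  then show rep: "rep e ?y = h"
    unfolding rep_def using unique_rep[OF e, of ?y] h hc a by (intro the1_equality) auto
  have "inv\<^bsub>G (r e)\<^esub> h \<otimes>\<^bsub>G (r e)\<^esub> ?y = \<alpha> e a"
    using hc a by (simp flip: H.m_assoc)
  then show "carry e ?y = \<alpha> (bar e) a"
    unfolding carry_def rep using emb_inj[OF e] a by simp
qed

lemma rep_cases:
  assumes e: "e \<in> edges \<G>" and y: "y \<in> carrier (G (r e))"
  obtains h a where "h \<in> S e" "h \<in> carrier (G (r e))" "a \<in> carrier (E e)"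
    "y = h \<otimes>\<^bsub>G (r e)\<^esub> \<alpha> e a" "rep e y = h" "carry e y = \<alpha> (bar e) a"
proof -
  interpret group_hom "E e" "G (r e)" "\<alpha> e" by (rule emb_hom[OF e])
  obtain h b where h: "h \<in> S e" and b: "b \<in> carrier (E e)" "h = y \<otimes>\<^bsub>G (r e)\<^esub> \<alpha> e b"
    using unique_rep[OF e y] unfolding emb_coset_iff by blast
  have "y = h \<otimes>\<^bsub>G (r e)\<^esub> \<alpha> e (inv\<^bsub>E e\<^esub> b)"
    using b y by (simp add: H.m_assoc)
  then show thesis
    using that[OF h transversal_closed[OF e h], of "inv\<^bsub>E e\<^esub> b"] rep_mult[OF e h, of "inv\<^bsub>E e\<^esub> b"] b by auto
qed

lemma rep_in: "e \<in> edges \<G> \<Longrightarrow> y \<in> carrier (G (r e)) \<Longrightarrow> rep e y \<in> S e"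
  by (elim rep_cases) auto

lemma carry_closed:
  assumes e: "e \<in> edges \<G>" and y: "y \<in> carrier (G (r e))"
  shows "carry e y \<in> carrier (G (s e))"
proof (rule rep_cases[OF e y])
  fix a assume "a \<in> carrier (E e)" "carry e y = \<alpha> (bar e) a"
  then show ?thesis using group_hom.hom_closed[OF emb_bar_hom[OF e]] by simp
qed

lemma rep_transversal:
  assumes e: "e \<in> edges \<G>" and h: "h \<in> S e"
  shows "rep e h = h" "carry e h = \<one>\<^bsub>G (s e)\<^esub>"
proof -
  interpret A: group_hom "E e" "G (r e)" "\<alpha> e" by (rule emb_hom[OF e])
  interpret B: group_hom "E e" "G (s e)" "\<alpha> (bar e)" by (rule emb_bar_hom[OF e])
  show "rep e h = h" "carry e h = \<one>\<^bsub>G (s e)\<^esub>"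
    using rep_mult[OF e h, of "\<one>\<^bsub>E e\<^esub>"] transversal_closed[OF e h] by simp_all
qed

text \<open>Left multiplication by an element of the edge subgroup permutes its left cosets and
  fixes the trivial one, so 1 stays 1 and nothing else becomes 1. This is why pushing such an
  element through a word neither creates nor destroys a cancellation.\<close>

lemma rep_emb_mult:
  assumes e: "e \<in> edges \<G>" and h: "h \<in> S e" and a: "a \<in> carrier (E e)"
  shows "rep e (\<alpha> e a \<otimes>\<^bsub>G (r e)\<^esub> h) = \<one>\<^bsub>G (r e)\<^esub> \<longleftrightarrow> h = \<one>\<^bsub>G (r e)\<^esub>"
proof -
  interpret A: group_hom "E e" "G (r e)" "\<alpha> e" by (rule emb_hom[OF e])
  have hc: "h \<in> carrier (G (r e))" using e h by (rule transversal_closed)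
  show ?thesis
  proof
    assume "h = \<one>\<^bsub>G (r e)\<^esub>"
    then show "rep e (\<alpha> e a \<otimes>\<^bsub>G (r e)\<^esub> h) = \<one>\<^bsub>G (r e)\<^esub>"
      using rep_mult(1)[OF e one_transversal[OF e] a] a by simp
  next
    assume 1: "rep e (\<alpha> e a \<otimes>\<^bsub>G (r e)\<^esub> h) = \<one>\<^bsub>G (r e)\<^esub>"
    have "\<alpha> e a \<otimes>\<^bsub>G (r e)\<^esub> h \<in> carrier (G (r e))" using hc a by simp
    then obtain b where b: "b \<in> carrier (E e)"
      and "\<alpha> e a \<otimes>\<^bsub>G (r e)\<^esub> h = \<one>\<^bsub>G (r e)\<^esub> \<otimes>\<^bsub>G (r e)\<^esub> \<alpha> e b"
      by (rule rep_cases[OF e]) (use 1 in simp)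
    then have ab: "\<alpha> e a \<otimes>\<^bsub>G (r e)\<^esub> h = \<alpha> e b" by simp
    have "h = inv\<^bsub>G (r e)\<^esub> \<alpha> e a \<otimes>\<^bsub>G (r e)\<^esub> (\<alpha> e a \<otimes>\<^bsub>G (r e)\<^esub> h)"
      using a hc by (simp flip: A.H.m_assoc)
    then have "h = \<one>\<^bsub>G (r e)\<^esub> \<otimes>\<^bsub>G (r e)\<^esub> \<alpha> e (inv\<^bsub>E e\<^esub> a \<otimes>\<^bsub>E e\<^esub> b)"
      unfolding ab using a b by simp
    then have "rep e h = \<one>\<^bsub>G (r e)\<^esub>"
      using rep_mult(1)[OF e one_transversal[OF e], of "inv\<^bsub>E e\<^esub> a \<otimes>\<^bsub>E e\<^esub> b"] a b by simp
    then show "h = \<one>\<^bsub>G (r e)\<^esub>" using rep_transversal[OF e h] by simp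
  qed
qed

text \<open>Left multiplication by \<open>g\<close> pushes \<open>g\<close> through a word from left to right: if \<open>y = h \<alpha>\<^sub>e(a)\<close> with
  \<open>h\<close> in the transversal, then \<open>y e\<close> equals \<open>h e b\<close> where \<open>b\<close> is the image of \<open>a\<close> in the group at \<open>s e\<close>;
  here \<open>h = rep e y\<close> and \<open>b = carry e y\<close>.  The letters produced are \<open>out g p\<close>, and \<open>rest g p\<close> is the
  element that remains at the end.\<close>

fun out :: "'g \<Rightarrow> ('g \<times> 'e) list \<Rightarrow> ('g \<times> 'e) list" where
  "out g [] = []"
| "out g ((h, e) # p) = (rep e (g \<otimes>\<^bsub>G (r e)\<^esub> h), e) # out (carry e (g \<otimes>\<^bsub>G (r e)\<^esub> h)) p"

fun rest :: "'g \<Rightarrow> ('g \<times> 'e) list \<Rightarrow> 'g" where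
  "rest g [] = g"
| "rest g ((h, e) # p) = rest (carry e (g \<otimes>\<^bsub>G (r e)\<^esub> h)) p"

lemma out_append: "out g (p @ q) = out g p @ out (rest g p) q"
  by (induction g p rule: out.induct) auto

lemma length_out [simp]: "length (out g p) = length p"
  by (induction g p rule: out.induct) auto

lemma snd_out [simp]: "map snd (out g p) = map snd p"
  by (induction g p rule: out.induct) auto

lemma out_eq_Nil [simp]: "out g p = [] \<longleftrightarrow> p = []"
  by (metis length_out length_0_conv)

lemma vgrp_m_closed [simp]: "x \<in> verts \<G> \<Longrightarrow> g \<in> carrier (G x) \<Longrightarrow> h \<in> carrier (G x) \<Longrightarrow> g \<otimes>\<^bsub>G x\<^esub> h \<in> carrier (G x)"
  by (meson group.is_monoid monoid.m_closed vgrp_group)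

lemma vgrp_one_closed [simp]: "x \<in> verts \<G> \<Longrightarrow> \<one>\<^bsub>G x\<^esub> \<in> carrier (G x)"
  by (meson group.is_monoid monoid.one_closed vgrp_group)

lemma vgrp_one [simp]:
  "x \<in> verts \<G> \<Longrightarrow> g \<in> carrier (G x) \<Longrightarrow> \<one>\<^bsub>G x\<^esub> \<otimes>\<^bsub>G x\<^esub> g = g"
  "x \<in> verts \<G> \<Longrightarrow> g \<in> carrier (G x) \<Longrightarrow> g \<otimes>\<^bsub>G x\<^esub> \<one>\<^bsub>G x\<^esub> = g"
  by (meson group.is_monoid monoid.l_one monoid.r_one vgrp_group)+

lemma vgrp_m_assoc:
  "x \<in> verts \<G> \<Longrightarrow> g \<in> carrier (G x) \<Longrightarrow> h \<in> carrier (G x) \<Longrightarrow> k \<in> carrier (G x)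
   \<Longrightarrow> g \<otimes>\<^bsub>G x\<^esub> h \<otimes>\<^bsub>G x\<^esub> k = g \<otimes>\<^bsub>G x\<^esub> (h \<otimes>\<^bsub>G x\<^esub> k)"
  by (meson group.is_monoid monoid.m_assoc vgrp_group)

lemma gchain_verts: "gchain \<G> x p y \<Longrightarrow> x \<in> verts \<G> \<and> y \<in> verts \<G>"
  by (induction p arbitrary: x) auto

lemma gchain_append: "gchain \<G> x (p @ q) z \<longleftrightarrow> (\<exists>y. gchain \<G> x p y \<and> gchain \<G> y q z)"
  by (induction p arbitrary: x) (auto dest: gchain_verts)

lemma gchain_out:
  assumes "gchain \<G> x p y" "g \<in> carrier (G x)"
  shows "gchain \<G> x (out g p) y \<and> rest g p \<in> carrier (G y)"
  using assms
proof (induction g p arbitrary: x rule: out.induct)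
  case (2 g h e p)
  then show ?case
    using carry_closed[of e "g \<otimes>\<^bsub>G (r e)\<^esub> h"] rep_in[of e "g \<otimes>\<^bsub>G (r e)\<^esub> h"] transversal_closed[of e]
    by auto
qed auto

text \<open>Makes left multiplication an action. With \<open>h k = t \<alpha>(a)\<close> and
  \<open>g t = u \<alpha>(b)\<close> one has \<open>g h k = u \<alpha>(b a)\<close>, so the carried
  elements multiply too and the induction continues behind the edge.\<close>

lemma out_mult:
  assumes "gchain \<G> x p y" "g \<in> carrier (G x)" "h \<in> carrier (G x)"
  shows "out g (out h p) = out (g \<otimes>\<^bsub>G x\<^esub> h) p \<and> rest (g \<otimes>\<^bsub>G x\<^esub> h) p = rest g (out h p) \<otimes>\<^bsub>G y\<^esub> rest h p"
  using assms
proof (induction p arbitrary: x g h)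
  case (Cons l p)
  obtain k e where l: "l = (k, e)" by fastforce
  have e: "e \<in> edges \<G>" "r e = x" and k: "k \<in> carrier (G x)" and p: "gchain \<G> (s e) p y"
    using Cons.prems l by auto
  interpret A: group_hom "E e" "G (r e)" "\<alpha> e" by (rule emb_hom[OF e(1)])
  interpret B: group_hom "E e" "G (s e)" "\<alpha> (bar e)" by (rule emb_bar_hom[OF e(1)])
  have hk: "h \<otimes>\<^bsub>G (r e)\<^esub> k \<in> carrier (G (r e))" using e k Cons.prems by auto
  obtain t a where t: "t \<in> S e" "t \<in> carrier (G (r e))" "a \<in> carrier (E e)"
    "h \<otimes>\<^bsub>G (r e)\<^esub> k = t \<otimes>\<^bsub>G (r e)\<^esub> \<alpha> e a" "rep e (h \<otimes>\<^bsub>G (r e)\<^esub> k) = t" "carry e (h \<otimes>\<^bsub>G (r e)\<^esub> k) = \<alpha> (bar e) a"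
    by (rule rep_cases[OF e(1) hk])
  have gt: "g \<otimes>\<^bsub>G (r e)\<^esub> t \<in> carrier (G (r e))" using e t Cons.prems by auto
  obtain u b where u: "u \<in> S e" "u \<in> carrier (G (r e))" "b \<in> carrier (E e)"
    "g \<otimes>\<^bsub>G (r e)\<^esub> t = u \<otimes>\<^bsub>G (r e)\<^esub> \<alpha> e b" "rep e (g \<otimes>\<^bsub>G (r e)\<^esub> t) = u" "carry e (g \<otimes>\<^bsub>G (r e)\<^esub> t) = \<alpha> (bar e) b"
    by (rule rep_cases[OF e(1) gt])
  have "g \<otimes>\<^bsub>G (r e)\<^esub> h \<otimes>\<^bsub>G (r e)\<^esub> k = g \<otimes>\<^bsub>G (r e)\<^esub> (t \<otimes>\<^bsub>G (r e)\<^esub> \<alpha> e a)"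
    unfolding t(4)[symmetric] using e k Cons.prems by (intro vgrp_m_assoc) auto
  also have "\<dots> = u \<otimes>\<^bsub>G (r e)\<^esub> \<alpha> e b \<otimes>\<^bsub>G (r e)\<^esub> \<alpha> e a"
    unfolding u(4)[symmetric] using t(2,3) e(2) Cons.prems(2) by (auto simp: A.H.m_assoc)
  also have "\<dots> = u \<otimes>\<^bsub>G (r e)\<^esub> \<alpha> e (b \<otimes>\<^bsub>E e\<^esub> a)"
    using t u by (simp add: A.H.m_assoc)
  finally have ghk: "g \<otimes>\<^bsub>G (r e)\<^esub> h \<otimes>\<^bsub>G (r e)\<^esub> k = u \<otimes>\<^bsub>G (r e)\<^esub> \<alpha> e (b \<otimes>\<^bsub>E e\<^esub> a)" .
  have "rep e (g \<otimes>\<^bsub>G (r e)\<^esub> h \<otimes>\<^bsub>G (r e)\<^esub> k) = u"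
    "carry e (g \<otimes>\<^bsub>G (r e)\<^esub> h \<otimes>\<^bsub>G (r e)\<^esub> k) = \<alpha> (bar e) b \<otimes>\<^bsub>G (s e)\<^esub> \<alpha> (bar e) a"
    unfolding ghk using rep_mult[OF e(1) u(1), of "b \<otimes>\<^bsub>E e\<^esub> a"] t u by auto
  then show ?case
    using Cons.IH[OF p, of "\<alpha> (bar e) b" "\<alpha> (bar e) a"] t u e by (auto simp: l)
qed auto

section \<open>Reduced words and left multiplication by an edge\<close>

definition link :: "'g \<times> 'e \<Rightarrow> 'g \<times> 'e \<Rightarrow> bool" where
  "link a b \<longleftrightarrow> (snd a = bar (snd b) \<longrightarrow> fst b \<noteq> \<one>\<^bsub>G (r (snd b))\<^esub>)"

definition red :: "('g \<times> 'e) list \<Rightarrow> bool" where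
  "red p \<longleftrightarrow> (\<forall>a\<in>set p. fst a \<in> S (snd a)) \<and> successively link p"

lemma red_Nil [simp]: "red []" by (simp add: red_def)

lemma red_Cons: "red (a # p) \<longleftrightarrow> fst a \<in> S (snd a) \<and> red p \<and> (p \<noteq> [] \<longrightarrow> link a (hd p))"
  by (auto simp: red_def successively_Cons)

lemma red_append: "red (p @ q) \<longleftrightarrow> red p \<and> red q \<and> (p \<noteq> [] \<longrightarrow> q \<noteq> [] \<longrightarrow> link (last p) (hd q))"
  by (auto simp: red_def successively_append_iff)

lemma reduced_gword_iff: "reduced_gword \<G> S (x, p, g) \<longleftrightarrow> red p"
  unfolding reduced_gword_def red_def successively_conv_nth link_def
  by (auto simp: all_set_conv_all_nth)

lemma out_one:
  assumes "gchain \<G> x p y" "red p"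
  shows "out \<one>\<^bsub>G x\<^esub> p = p \<and> rest \<one>\<^bsub>G x\<^esub> p = \<one>\<^bsub>G y\<^esub>"
  using assms by (induction p arbitrary: x) (auto simp: red_Cons rep_transversal)

text \<open>The element arriving at a letter \<open>(k, f)\<close> is
  \<open>\<alpha> (bar e) a\<close>, where \<open>e\<close> is the edge just crossed. Only
  \<open>f = bar e\<close> is critical, and then this element lies in the image of
  \<open>\<alpha> f\<close>, so \<open>rep_emb_mult\<close> keeps a nontrivial \<open>k\<close>
  nontrivial.\<close>

lemma red_out:
  assumes "gchain \<G> x p y" "red p" "g \<in> carrier (G x)"
  shows "red (out g p)"
  using assms
proof (induction p arbitrary: x g)
  case (Cons l p)
  obtain h e where l: "l = (h, e)" by fastforce
  have e: "e \<in> edges \<G>" "r e = x" and h: "h \<in> carrier (G x)" and p: "gchain \<G> (s e) p y"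
    using Cons.prems l by auto
  have gh: "g \<otimes>\<^bsub>G (r e)\<^esub> h \<in> carrier (G (r e))" using e h Cons.prems by auto
  obtain t a where t: "t \<in> S e" "t \<in> carrier (G (r e))" "a \<in> carrier (E e)"
    "rep e (g \<otimes>\<^bsub>G (r e)\<^esub> h) = t" "carry e (g \<otimes>\<^bsub>G (r e)\<^esub> h) = \<alpha> (bar e) a"
    by (rule rep_cases[OF e(1) gh])
  have "\<alpha> (bar e) a \<in> carrier (G (s e))"
    using emb_bar_hom[OF e(1)] t(3) group_hom.hom_closed by fastforce
  then have 1: "red (out (\<alpha> (bar e) a) p)"
    using Cons p by (simp add: red_Cons)
  have "link (t, e) (hd (out (\<alpha> (bar e) a) p))" if ne: "p \<noteq> []"
  proof -
    obtain k f p' where p': "p = (k, f) # p'" using ne by (cases p) auto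
    have f: "f \<in> edges \<G>" and kS: "k \<in> S f" and lk: "link (h, e) (k, f)"
      using p Cons.prems by (auto simp: p' l red_Cons)
    show ?thesis
      using rep_emb_mult[OF f kS, of a] lk f t(3) by (auto simp: link_def p')
  qed
  then show ?case
    using 1 t by (auto simp: l red_Cons)
qed auto

text \<open>Left multiplication by the edge \<open>e\<close> on reduced words. The new leading group
  element is 1, so nothing has to be carried further; the only possible cancellation is against a
  leading \<open>bar e\<close> with group element 1.\<close>

definition lcons :: "'e \<Rightarrow> ('g \<times> 'e) list \<Rightarrow> ('g \<times> 'e) list" where
  "lcons e p = (if p \<noteq> [] \<and> hd p = (\<one>\<^bsub>G (s e)\<^esub>, bar e) then tl p else (\<one>\<^bsub>G (r e)\<^esub>, e) # p)"

lemma lcons_closed: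
  assumes "e \<in> edges \<G>" "gchain \<G> (s e) p y" "red p"
  shows "gchain \<G> (r e) (lcons e p) y" "red (lcons e p)"
proof -
  show "gchain \<G> (r e) (lcons e p) y"
    using assms by (cases p) (auto simp: lcons_def)
  have "link (\<one>\<^bsub>G (r e)\<^esub>, e) (hd p)" if "p \<noteq> []" "hd p \<noteq> (\<one>\<^bsub>G (s e)\<^esub>, bar e)"
  proof (cases p)
    case (Cons l q)
    obtain k f where l: "l = (k, f)" by fastforce
    have f: "f \<in> edges \<G>" "r f = s e" using assms Cons l by auto
    show ?thesis
    proof (cases "f = bar e")
      case True
      then show ?thesis using that f assms by (simp add: Cons l link_def)
    next
      case False
      then have "e \<noteq> bar f" using f by auto
      then show ?thesis by (simp add: Cons l link_def)
    qed
  qed (use that in auto)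
  then show "red (lcons e p)"
    using assms one_transversal[of e] by (cases p) (simp_all add: lcons_def red_Cons)
qed

text \<open>The relation \<open>e (bar e) = 1\<close> on reduced words. If \<open>p\<close> begins
  with \<open>1 e\<close>, this letter is removed and restored; reducedness of \<open>p\<close>
  keeps the rest from beginning with \<open>1 (bar e)\<close>, which would be cancelled
  instead.\<close>

lemma lcons_bar:
  assumes e: "e \<in> edges \<G>" and p: "gchain \<G> (r e) p y" "red p"
  shows "lcons e (lcons (bar e) p) = p"
proof (cases "p \<noteq> [] \<and> hd p = (\<one>\<^bsub>G (r e)\<^esub>, e)")
  case True
  then obtain q where q: "p = (\<one>\<^bsub>G (r e)\<^esub>, e) # q" by (cases p) auto
  have "\<not> (q \<noteq> [] \<and> hd q = (\<one>\<^bsub>G (s e)\<^esub>, bar e))"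
    using p e by (auto simp: q red_Cons link_def)
  then show ?thesis using e by (auto simp: q lcons_def)
next
  case False
  then show ?thesis using e by (auto simp: lcons_def)
qed

text \<open>The relation that slides an edge group element across \<open>e\<close>, on reduced
  words. Elements of the edge subgroup have representative 1 and cross the edge whole, and by
  \<open>rep_emb_mult\<close> multiplying by one does not change whether \<open>e\<close>
  cancels.\<close>

lemma lcons_out:
  assumes e: "e \<in> edges \<G>" and p: "gchain \<G> (s e) p y" "red p" and a: "a \<in> carrier (E e)"
  shows "lcons e (out (\<alpha> (bar e) a) p) = out (\<alpha> e a) (lcons e p)"
    and "rest (\<alpha> (bar e) a) p = rest (\<alpha> e a) (lcons e p)"
proof -
  interpret A: group_hom "E e" "G (r e)" "\<alpha> e" by (rule emb_hom[OF e(1)])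
  interpret B: group_hom "E e" "G (s e)" "\<alpha> (bar e)" by (rule emb_bar_hom[OF e(1)])
  have "rep e (\<alpha> e a) = \<one>\<^bsub>G (r e)\<^esub>" "carry e (\<alpha> e a) = \<alpha> (bar e) a"
    "rep (bar e) (\<alpha> (bar e) a) = \<one>\<^bsub>G (s e)\<^esub>" "carry (bar e) (\<alpha> (bar e) a) = \<alpha> e a"
    using rep_mult[OF e one_transversal, OF e a] rep_mult[OF _ one_transversal, of "bar e" a] a e by auto
  note reps = this
  have "lcons e (out (\<alpha> (bar e) a) p) = out (\<alpha> e a) (lcons e p) \<and>
    rest (\<alpha> (bar e) a) p = rest (\<alpha> e a) (lcons e p)"
  proof (cases "p \<noteq> [] \<and> hd p = (\<one>\<^bsub>G (s e)\<^esub>, bar e)")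
    case True
    then obtain q where q: "p = (\<one>\<^bsub>G (s e)\<^esub>, bar e) # q" by (cases p) auto
    show ?thesis using reps a e by (simp add: q lcons_def)
  next
    case False
    have "\<not> (p \<noteq> [] \<and> hd (out (\<alpha> (bar e) a) p) = (\<one>\<^bsub>G (s e)\<^esub>, bar e))"
    proof (cases p)
      case (Cons l q)
      obtain k f where l: "l = (k, f)" by fastforce
      have "f = bar e \<Longrightarrow> k \<noteq> \<one>\<^bsub>G (s e)\<^esub>" "k \<in> S f"
        using False p by (auto simp: Cons l red_Cons)
      then show ?thesis
        using rep_emb_mult[of "bar e" k a] e a by (auto simp: Cons l)
    qed auto
    then show ?thesis using False reps a e by (auto simp: lcons_def)
  qed
  then show "lcons e (out (\<alpha> (bar e) a) p) = out (\<alpha> e a) (lcons e p)"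
    "rest (\<alpha> (bar e) a) p = rest (\<alpha> e a) (lcons e p)" by auto
qed

section \<open>Words acting on reduced words\<close>

definition rwords :: "'v \<Rightarrow> 'v \<Rightarrow> (('g \<times> 'e) list \<times> 'g) set" where
  "rwords x y = {(p, k). gchain \<G> x p y \<and> red p \<and> k \<in> carrier (G y)}"

fun lmult :: "'v \<Rightarrow> 'g \<Rightarrow> ('g \<times> 'e) list \<times> 'g \<Rightarrow> ('g \<times> 'e) list \<times> 'g" where
  "lmult y g (p, k) = (out g p, rest g p \<otimes>\<^bsub>G y\<^esub> k)"

fun act :: "'v \<Rightarrow> ('g \<times> 'e) list \<Rightarrow> ('g \<times> 'e) list \<times> 'g \<Rightarrow> ('g \<times> 'e) list \<times> 'g" where
  "act y [] w = w"
| "act y ((g, e) # q) w = lmult y g (apfst (lcons e) (act y q w))"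

text \<open>As in van der Waerden's argument for free products, words become operators on reduced
  words, here with fixed source \<open>y\<close>. The final group element of a word acts first, then
  its letters from right to left.\<close>

fun actw :: "'v \<Rightarrow> ('v, 'e, 'g) gword \<Rightarrow> ('g \<times> 'e) list \<times> 'g \<Rightarrow> ('g \<times> 'e) list \<times> 'g" where
  "actw y (x, q, g) w = act y q (lmult y g w)"

lemma lmult_closed:
  assumes "w \<in> rwords x y" "g \<in> carrier (G x)"
  shows "lmult y g w \<in> rwords x y"
proof -
  obtain p k where w: "w = (p, k)" by fastforce
  have p: "gchain \<G> x p y" "red p" "k \<in> carrier (G y)" using assms w by (auto simp: rwords_def)
  then show ?thesis
    using gchain_out[OF p(1) assms(2)] red_out[OF p(1,2) assms(2)] gchain_verts[OF p(1)]
    by (simp add: rwords_def w)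
qed

lemma lcons_rwords: "e \<in> edges \<G> \<Longrightarrow> w \<in> rwords (s e) y \<Longrightarrow> apfst (lcons e) w \<in> rwords (r e) y"
  using lcons_closed by (cases w) (auto simp: rwords_def)

lemma lmult_lmult:
  assumes "w \<in> rwords x y" "g \<in> carrier (G x)" "h \<in> carrier (G x)"
  shows "lmult y g (lmult y h w) = lmult y (g \<otimes>\<^bsub>G x\<^esub> h) w"
proof -
  obtain p k where w: "w = (p, k)" by fastforce
  have p: "gchain \<G> x p y" "red p" "k \<in> carrier (G y)" using assms w by (auto simp: rwords_def)
  have y: "y \<in> verts \<G>" using p gchain_verts by auto
  have "rest h p \<in> carrier (G y)" "rest g (out h p) \<in> carrier (G y)"
    using gchain_out[OF p(1) assms(3)] gchain_out[of x "out h p" y g] assms(2) by auto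
  then show ?thesis
    using out_mult[OF p(1) assms(2,3)] p y by (simp add: w vgrp_m_assoc)
qed

lemma lmult_one: "w \<in> rwords x y \<Longrightarrow> lmult y \<one>\<^bsub>G x\<^esub> w = w"
  using out_one gchain_verts by (cases w) (fastforce simp: rwords_def)

lemma act_closed: "gchain \<G> x q z \<Longrightarrow> w \<in> rwords z y \<Longrightarrow> act y q w \<in> rwords x y"
  by (induction q arbitrary: x) (auto intro!: lmult_closed lcons_rwords)

lemma act_append: "act y (q @ q') w = act y q (act y q' w)"
  by (induction q) auto

lemma gwords_iff: "(x, p, g) \<in> gwords \<G> z y \<longleftrightarrow> x = z \<and> gchain \<G> x p y \<and> g \<in> carrier (G y)"
  by (auto simp: gwords_def)

lemma gchain_end_unique: "gchain \<G> x p y \<Longrightarrow> gchain \<G> x p z \<Longrightarrow> y = z"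
  by (induction p arbitrary: x) auto

lemma gwords_unique: "w \<in> gwords \<G> x y \<Longrightarrow> w \<in> gwords \<G> x' y' \<Longrightarrow> x = x' \<and> y = y'"
  using gchain_end_unique by (auto simp: gwords_def)

lemma actw_closed: "u \<in> gwords \<G> x z \<Longrightarrow> w \<in> rwords z y \<Longrightarrow> actw y u w \<in> rwords x y"
  by (cases u) (auto simp: gwords_iff intro!: act_closed lmult_closed)

lemma wconcat_closed:
  assumes "u \<in> gwords \<G> x y" "t \<in> gwords \<G> y z"
  shows "wconcat \<G> u t \<in> gwords \<G> x z"
proof -
  obtain p g where u: "u = (x, p, g)" and p: "gchain \<G> x p y" "g \<in> carrier (G y)"
    using assms by (auto simp: gwords_def)
  obtain q k where t: "t = (y, q, k)" and q: "gchain \<G> y q z" "k \<in> carrier (G z)"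
    using assms by (auto simp: gwords_def)
  show ?thesis
  proof (cases q)
    case Nil
    then show ?thesis using p q by (auto simp: u t gwords_iff)
  next
    case (Cons l q')
    obtain h e where l: "l = (h, e)" by fastforce
    have "gchain \<G> y ((g \<otimes>\<^bsub>G y\<^esub> h, e) # q') z" using p q by (auto simp: Cons l dest: gchain_verts)
    then show ?thesis using p q unfolding u t Cons l by (auto simp: gwords_iff gchain_append)
  qed
qed

lemma actw_wconcat:
  assumes "u \<in> gwords \<G> x z" "t \<in> gwords \<G> z z'" "w \<in> rwords z' y"
  shows "actw y (wconcat \<G> u t) w = actw y u (actw y t w)"
proof -
  obtain p g where u: "u = (x, p, g)" and p: "gchain \<G> x p z" "g \<in> carrier (G z)"
    using assms by (auto simp: gwords_def)
  obtain q k where t: "t = (z, q, k)" and q: "gchain \<G> z q z'" "k \<in> carrier (G z')"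
    using assms by (auto simp: gwords_def)
  show ?thesis
  proof (cases q)
    case Nil
    then show ?thesis using p q assms by (auto simp: u t lmult_lmult)
  next
    case (Cons l q')
    obtain h e where l: "l = (h, e)" by fastforce
    have e: "e \<in> edges \<G>" "r e = z" "h \<in> carrier (G z)" "gchain \<G> (s e) q' z'"
      using q by (auto simp: Cons l)
    have "apfst (lcons e) (act y q' (lmult y k w)) \<in> rwords z y"
      using lcons_rwords[of e] act_closed[OF e(4)] lmult_closed assms q e by auto
    then show ?thesis using p e by (simp add: u t Cons l act_append lmult_lmult)
  qed
qed

lemma apfst_lcons_bar:
  assumes "e \<in> edges \<G>" "w \<in> rwords (r e) y"
  shows "apfst (lcons e) (apfst (lcons (bar e)) w) = w"
  using assms lcons_bar by (cases w) (auto simp: rwords_def)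

lemma lcons_lmult:
  assumes "e \<in> edges \<G>" "w \<in> rwords (s e) y" "a \<in> carrier (E e)"
  shows "apfst (lcons e) (lmult y (\<alpha> (bar e) a) w) = lmult y (\<alpha> e a) (apfst (lcons e) w)"
  using assms lcons_out by (cases w) (auto simp: rwords_def)

text \<open>The two defining relations hold for operators by \<open>apfst_lcons_bar\<close> and
  \<open>lcons_lmult\<close>. The claim also carries range and source, because an equivalence does
  not mention them and the cases \<open>trans\<close> and \<open>cong\<close> need matching end
  points.\<close>

lemma weq_actw:
  assumes "weq \<G> w w'"
  shows "\<exists>x y. w \<in> gwords \<G> x y \<and> w' \<in> gwords \<G> x y \<and> (\<forall>z. \<forall>t\<in>rwords y z. actw z w t = actw z w' t)"
  using assms
proof (induction rule: weq.induct)
  case (backtrack e)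
  have "actw z (r e, [(\<one>\<^bsub>G (r e)\<^esub>, e), (\<one>\<^bsub>G (s e)\<^esub>, bar e)], \<one>\<^bsub>G (r e)\<^esub>) t = t" if t: "t \<in> rwords (r e) z" for z t
  proof -
    have 1: "apfst (lcons (bar e)) t \<in> rwords (s e) z"
      using lcons_rwords[of "bar e" t z] backtrack t by simp
    show ?thesis
      using lmult_one[OF t] lmult_one[OF 1] apfst_lcons_bar[OF backtrack t] by simp
  qed
  then show ?case
    using backtrack by (intro exI[of _ "r e"]) (auto simp: gwords_iff lmult_one)
next
  case (slide e g)
  interpret A: group_hom "E e" "G (r e)" "\<alpha> e" by (rule emb_hom[OF slide(1)])
  interpret B: group_hom "E e" "G (s e)" "\<alpha> (bar e)" by (rule emb_bar_hom[OF slide(1)])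
  have "actw z (r e, [(\<one>\<^bsub>G (r e)\<^esub>, e)], \<alpha> (bar e) g) t = actw z (r e, [(\<alpha> e g, e)], \<one>\<^bsub>G (s e)\<^esub>) t"
    if t: "t \<in> rwords (s e) z" for z t
    using lcons_lmult[OF slide(1) t slide(2)] lmult_one[OF t]
      lmult_one[OF lmult_closed[OF lcons_rwords[OF slide(1) t], of "\<alpha> e g"]] slide by simp
  then show ?case
    using slide by (intro exI[of _ "r e"] exI[of _ "s e"]) (auto simp: gwords_iff)
next
  case (refl w x y)
  then show ?case by blast
next
  case (sym w w')
  then show ?case by metis
next
  case (trans w w' w'')
  then show ?case using gwords_unique by metis
next
  case (cong w w' x y u z t z')
  have eq: "\<forall>z. \<forall>t\<in>rwords y z. actw z w t = actw z w' t"
    using cong.IH cong.hyps gwords_unique by metis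
  show ?case
  proof (intro exI conjI allI ballI)
    show "wconcat \<G> u (wconcat \<G> w t) \<in> gwords \<G> z z'" "wconcat \<G> u (wconcat \<G> w' t) \<in> gwords \<G> z z'"
      using cong.hyps wconcat_closed by metis+
    fix y' t' assume t': "t' \<in> rwords z' y'"
    have "actw y' (wconcat \<G> u (wconcat \<G> v t)) t' = actw y' u (actw y' v (actw y' t t'))"
      if "v \<in> gwords \<G> x y" for v
      using actw_wconcat[OF cong.hyps(4) wconcat_closed[OF that cong.hyps(5)] t']
        actw_wconcat[OF that cong.hyps(5) t'] by simp
    then show "actw y' (wconcat \<G> u (wconcat \<G> w t)) t' = actw y' (wconcat \<G> u (wconcat \<G> w' t)) t'"
      using cong.hyps eq actw_closed[OF cong.hyps(5) t'] by simp
  qed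
qed

section \<open>Normal forms\<close>

lemma weq_gwords: "weq \<G> w w' \<Longrightarrow> w \<in> gwords \<G> x y \<Longrightarrow> w' \<in> gwords \<G> x y"
  using weq_actw gwords_unique by metis

lemma wconcat_one_right: "w \<in> gwords \<G> x y \<Longrightarrow> wconcat \<G> w (y, [], \<one>\<^bsub>G y\<^esub>) = w"
  by (auto simp: gwords_def dest: gchain_verts)

lemma wconcat_one_left:
  assumes "w \<in> gwords \<G> x y"
  shows "wconcat \<G> (x, [], \<one>\<^bsub>G x\<^esub>) w = w"
proof -
  obtain p g where w: "w = (x, p, g)" "gchain \<G> x p y" "g \<in> carrier (G y)"
    using assms by (auto simp: gwords_def)
  then show ?thesis by (cases p) (auto dest: gchain_verts)
qed

lemma one_gwords: "x \<in> verts \<G> \<Longrightarrow> (x, [], \<one>\<^bsub>G x\<^esub>) \<in> gwords \<G> x x"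
  by (simp add: gwords_iff)

lemma gwords_verts: "w \<in> gwords \<G> x y \<Longrightarrow> x \<in> verts \<G> \<and> y \<in> verts \<G>"
  by (auto simp: gwords_def dest: gchain_verts)

lemma weq_concat_left:
  assumes "weq \<G> w w'" "w \<in> gwords \<G> x y" "u \<in> gwords \<G> z x"
  shows "weq \<G> (wconcat \<G> u w) (wconcat \<G> u w')"
  using cong[OF assms(1,2) weq_gwords[OF assms(1,2)] assms(3) one_gwords[of y]]
    wconcat_one_right gwords_verts assms weq_gwords[OF assms(1,2)] by metis

lemma weq_concat_right:
  assumes "weq \<G> w w'" "w \<in> gwords \<G> x y" "t \<in> gwords \<G> y z"
  shows "weq \<G> (wconcat \<G> w t) (wconcat \<G> w' t)"
  using cong[OF assms(1,2) weq_gwords[OF assms(1,2)] one_gwords[of x] assms(3)]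
    wconcat_one_left wconcat_closed gwords_verts assms weq_gwords[OF assms(1,2)] by metis

lemma wconcat_letter:
  assumes "e \<in> edges \<G>" "(s e, p, k) \<in> gwords \<G> (s e) y"
  shows "wconcat \<G> (x, [(g, e)], \<one>\<^bsub>G (s e)\<^esub>) (s e, p, k) = (x, (g, e) # p, k)"
  using assms by (cases p) (auto simp: gwords_iff dest: gchain_verts)

lemma letter_gwords:
  "e \<in> edges \<G> \<Longrightarrow> g \<in> carrier (G (r e)) \<Longrightarrow> (r e, [(g, e)], \<one>\<^bsub>G (s e)\<^esub>) \<in> gwords \<G> (r e) (s e)"
  by (auto simp: gwords_iff)

lemma weq_slide:
  assumes e: "e \<in> edges \<G>" and h: "h \<in> carrier (G (r e))" and a: "a \<in> carrier (E e)"
    and p: "(s e, p, k) \<in> gwords \<G> (s e) y"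
  shows "weq \<G> (r e, (h \<otimes>\<^bsub>G (r e)\<^esub> \<alpha> e a, e) # p, k)
    (wconcat \<G> (r e, [(h, e)], \<one>\<^bsub>G (s e)\<^esub>) (wconcat \<G> (s e, [], \<alpha> (bar e) a) (s e, p, k)))"
proof -
  interpret A: group_hom "E e" "G (r e)" "\<alpha> e" by (rule emb_hom[OF e(1)])
  interpret B: group_hom "E e" "G (s e)" "\<alpha> (bar e)" by (rule emb_bar_hom[OF e(1)])
  have words: "(r e, [(\<one>\<^bsub>G (r e)\<^esub>, e)], \<alpha> (bar e) a) \<in> gwords \<G> (r e) (s e)"
    "(r e, [(\<alpha> e a, e)], \<one>\<^bsub>G (s e)\<^esub>) \<in> gwords \<G> (r e) (s e)"
    "(r e, [], h) \<in> gwords \<G> (r e) (r e)"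
    using e h a by (auto simp: gwords_iff)
  have y: "y \<in> verts \<G>" using p gwords_verts by auto
  have "weq \<G> (wconcat \<G> (r e, [], h) (wconcat \<G> (r e, [(\<one>\<^bsub>G (r e)\<^esub>, e)], \<alpha> (bar e) a) (s e, p, k)))
    (wconcat \<G> (r e, [], h) (wconcat \<G> (r e, [(\<alpha> e a, e)], \<one>\<^bsub>G (s e)\<^esub>) (s e, p, k)))"
    by (rule cong[OF slide[OF e a] words p])
  moreover have "wconcat \<G> (r e, [], h) (wconcat \<G> (r e, [(\<one>\<^bsub>G (r e)\<^esub>, e)], \<alpha> (bar e) a) (s e, p, k)) =
    wconcat \<G> (r e, [(h, e)], \<one>\<^bsub>G (s e)\<^esub>) (wconcat \<G> (s e, [], \<alpha> (bar e) a) (s e, p, k))"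
    using e h a p y by (cases p) (auto simp: gwords_iff)
  moreover have "wconcat \<G> (r e, [], h) (wconcat \<G> (r e, [(\<alpha> e a, e)], \<one>\<^bsub>G (s e)\<^esub>) (s e, p, k)) =
    (r e, (h \<otimes>\<^bsub>G (r e)\<^esub> \<alpha> e a, e) # p, k)"
    using wconcat_letter[OF e p] by simp
  ultimately show ?thesis by (metis weq.sym)
qed

lemma weq_lmult:
  assumes "(x, p, k) \<in> gwords \<G> x y" "g \<in> carrier (G x)"
  shows "weq \<G> (wconcat \<G> (x, [], g) (x, p, k)) (x, lmult y g (p, k))"
  using assms
proof (induction p arbitrary: x g)
  case Nil
  then have 1: "(x, [], g \<otimes>\<^bsub>G x\<^esub> k) \<in> gwords \<G> x x" by (auto simp: gwords_iff)
  from weq.refl[OF 1] show ?case using Nil by (auto simp: gwords_iff)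
next
  case (Cons l p)
  obtain h e where l: "l = (h, e)" by fastforce
  have e: "e \<in> edges \<G>" "r e = x" and h: "h \<in> carrier (G x)" and p: "(s e, p, k) \<in> gwords \<G> (s e) y"
    using Cons.prems l by (auto simp: gwords_iff)
  interpret B: group_hom "E e" "G (s e)" "\<alpha> (bar e)" by (rule emb_bar_hom[OF e(1)])
  have gh: "g \<otimes>\<^bsub>G (r e)\<^esub> h \<in> carrier (G (r e))" using e h Cons.prems by auto
  obtain t a where t: "t \<in> S e" "t \<in> carrier (G (r e))" "a \<in> carrier (E e)"
    "g \<otimes>\<^bsub>G (r e)\<^esub> h = t \<otimes>\<^bsub>G (r e)\<^esub> \<alpha> e a" "rep e (g \<otimes>\<^bsub>G (r e)\<^esub> h) = t" "carry e (g \<otimes>\<^bsub>G (r e)\<^esub> h) = \<alpha> (bar e) a"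
    by (rule rep_cases[OF e(1) gh])
  let ?w = "wconcat \<G> (s e, [], \<alpha> (bar e) a) (s e, p, k)"
  have w: "?w \<in> gwords \<G> (s e) y"
    by (rule wconcat_closed[OF _ p]) (use t e in \<open>auto simp: gwords_iff\<close>)
  have IH: "weq \<G> ?w (s e, lmult y (\<alpha> (bar e) a) (p, k))"
    using Cons.IH[OF p] t by simp
  have w': "(s e, lmult y (\<alpha> (bar e) a) (p, k)) \<in> gwords \<G> (s e) y"
    by (rule weq_gwords[OF IH w])
  have 1: "weq \<G> (r e, (t \<otimes>\<^bsub>G (r e)\<^esub> \<alpha> e a, e) # p, k) (wconcat \<G> (r e, [(t, e)], \<one>\<^bsub>G (s e)\<^esub>) ?w)"
    by (rule weq_slide[OF e(1) t(2,3) p])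
  have 2: "weq \<G> (wconcat \<G> (r e, [(t, e)], \<one>\<^bsub>G (s e)\<^esub>) ?w)
      (wconcat \<G> (r e, [(t, e)], \<one>\<^bsub>G (s e)\<^esub>) (s e, lmult y (\<alpha> (bar e) a) (p, k)))"
    by (rule weq_concat_left[OF IH w letter_gwords[OF e(1) t(2)]])
  have 3: "wconcat \<G> (r e, [(t, e)], \<one>\<^bsub>G (s e)\<^esub>) (s e, lmult y (\<alpha> (bar e) a) (p, k)) =
      (r e, lmult y g ((h, e) # p, k))"
    using wconcat_letter[OF e(1)] w' t by auto
  have "weq \<G> (r e, (t \<otimes>\<^bsub>G (r e)\<^esub> \<alpha> e a, e) # p, k) (r e, lmult y g ((h, e) # p, k))"
    using weq.trans[OF 1 2] unfolding 3 .
  then show ?case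
    unfolding t(4)[symmetric] using e(2) by (simp add: l)
qed

lemma weq_lcons:
  assumes e: "e \<in> edges \<G>" and w: "(s e, w) \<in> gwords \<G> (s e) y"
  shows "weq \<G> (wconcat \<G> (r e, [(\<one>\<^bsub>G (r e)\<^esub>, e)], \<one>\<^bsub>G (s e)\<^esub>) (s e, w)) (r e, apfst (lcons e) w)"
proof -
  obtain p k where pk: "w = (p, k)" by fastforce
  have 1: "wconcat \<G> (r e, [(\<one>\<^bsub>G (r e)\<^esub>, e)], \<one>\<^bsub>G (s e)\<^esub>) (s e, w) = (r e, (\<one>\<^bsub>G (r e)\<^esub>, e) # p, k)"
    using wconcat_letter[OF e] w pk by auto
  have gw: "(r e, (\<one>\<^bsub>G (r e)\<^esub>, e) # p, k) \<in> gwords \<G> (r e) y"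
    using w e by (simp add: gwords_iff pk)
  show ?thesis
  proof (cases "p \<noteq> [] \<and> hd p = (\<one>\<^bsub>G (s e)\<^esub>, bar e)")
    case True
    then obtain q where q: "p = (\<one>\<^bsub>G (s e)\<^esub>, bar e) # q" by (cases p) auto
    have q': "(r e, q, k) \<in> gwords \<G> (r e) y" using w e by (simp add: gwords_iff pk q)
    have "weq \<G> (wconcat \<G> (r e, [(\<one>\<^bsub>G (r e)\<^esub>, e), (\<one>\<^bsub>G (s e)\<^esub>, bar e)], \<one>\<^bsub>G (r e)\<^esub>) (r e, q, k))
       (wconcat \<G> (r e, [], \<one>\<^bsub>G (r e)\<^esub>) (r e, q, k))"
      by (rule weq_concat_right[OF backtrack[OF e] _ q']) (use e in \<open>simp add: gwords_iff\<close>)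
    moreover have "wconcat \<G> (r e, [(\<one>\<^bsub>G (r e)\<^esub>, e), (\<one>\<^bsub>G (s e)\<^esub>, bar e)], \<one>\<^bsub>G (r e)\<^esub>) (r e, q, k) =
      (r e, (\<one>\<^bsub>G (r e)\<^esub>, e) # (\<one>\<^bsub>G (s e)\<^esub>, bar e) # q, k)"
      using q' gwords_verts[OF q'] by (cases q) (auto simp: gwords_iff)
    ultimately show ?thesis
      unfolding 1 using wconcat_one_left[OF q'] e by (simp add: pk q lcons_def)
  next
    case False
    then show ?thesis unfolding 1 using weq.refl[OF gw] by (auto simp: pk lcons_def)
  qed
qed

text \<open>Existence of normal forms: letting the letters act on the final group element, from
  right to left, uses only steps justified by \<open>weq_lcons\<close> and
  \<open>weq_lmult\<close>.\<close>

lemma weq_act: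
  assumes "(x, q, g) \<in> gwords \<G> x y"
  shows "weq \<G> (x, q, g) (x, act y q ([], g))"
  using assms
proof (induction q arbitrary: x)
  case Nil
  then show ?case by (auto intro: weq.refl)
next
  case (Cons l q)
  obtain h e where l: "l = (h, e)" by fastforce
  have e: "e \<in> edges \<G>" "r e = x" and h: "h \<in> carrier (G (r e))" and q: "(s e, q, g) \<in> gwords \<G> (s e) y"
    using Cons.prems l by (auto simp: gwords_iff)
  let ?l = "(r e, [(\<one>\<^bsub>G (r e)\<^esub>, e)], \<one>\<^bsub>G (s e)\<^esub>)" and ?a = "act y q ([], g)"
  have lw: "?l \<in> gwords \<G> (r e) (s e)" by (rule letter_gwords) (use e(1) in auto)
  have h': "(r e, [], h) \<in> gwords \<G> (r e) (r e)" using h e(1) by (simp add: gwords_iff)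
  have IH: "weq \<G> (s e, q, g) (s e, ?a)" by (rule Cons.IH[OF q])
  note IHw = weq_gwords[OF IH q]
  have 1: "(x, l # q, g) = wconcat \<G> (r e, [], h) (wconcat \<G> ?l (s e, q, g))"
    using wconcat_letter[OF e(1) q] e h gwords_verts[OF Cons.prems] by (simp add: l)
  have 2: "weq \<G> (wconcat \<G> ?l (s e, q, g)) (wconcat \<G> ?l (s e, ?a))"
    by (rule weq_concat_left[OF IH q lw])
  have 3: "weq \<G> (wconcat \<G> ?l (s e, ?a)) (r e, apfst (lcons e) ?a)"
    by (rule weq_lcons[OF e(1) IHw])
  have 4: "weq \<G> (wconcat \<G> ?l (s e, q, g)) (r e, apfst (lcons e) ?a)"
    using 2 3 weq.trans by blast
  have w: "wconcat \<G> ?l (s e, q, g) \<in> gwords \<G> (r e) y"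
    by (rule wconcat_closed[OF lw q])
  have 5: "weq \<G> (x, l # q, g) (wconcat \<G> (r e, [], h) (r e, apfst (lcons e) ?a))"
    unfolding 1 by (rule weq_concat_left[OF 4 w h'])
  obtain p k where pk: "apfst (lcons e) ?a = (p, k)" by fastforce
  have "weq \<G> (wconcat \<G> (r e, [], h) (r e, apfst (lcons e) ?a)) (r e, lmult y h (apfst (lcons e) ?a))"
    unfolding pk by (rule weq_lmult) (use weq_gwords[OF 4 w] h pk in auto)
  then show ?case using weq.trans[OF 5] e by (simp add: l)
qed

text \<open>Uniqueness of normal forms rests on this: when a reduced word is rebuilt from its end,
  no letter cancels or changes.\<close>

lemma act_red:
  assumes "gchain \<G> x p y" "red p" "k \<in> carrier (G y)"
  shows "act y p ([], k) = (p, k)"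
  using assms
proof (induction p arbitrary: x)
  case (Cons l p)
  obtain h e where l: "l = (h, e)" by fastforce
  have e: "e \<in> edges \<G>" "r e = x" "h \<in> S e" and p: "gchain \<G> (s e) p y" "red p"
    using Cons.prems by (auto simp: l red_Cons)
  have "\<not> (p \<noteq> [] \<and> hd p = (\<one>\<^bsub>G (s e)\<^esub>, bar e))"
    using Cons.prems e by (auto simp: l red_Cons link_def)
  then have "lcons e p = (\<one>\<^bsub>G (r e)\<^esub>, e) # p" by (auto simp: lcons_def)
  moreover have "h \<in> carrier (G (r e))" using e transversal_closed by blast
  ultimately show ?case
    using Cons.IH[OF p] Cons.prems(3) e(1,3) e(2)[symmetric] rep_transversal[OF e(1,3)] out_one[OF p] gchain_verts[OF p(1)]
    by (simp add: l)
qed simp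

definition nf :: "'v \<Rightarrow> ('v, 'e, 'g) gword \<Rightarrow> ('g \<times> 'e) list \<times> 'g" where
  "nf y w = actw y w ([], \<one>\<^bsub>G y\<^esub>)"

lemma one_rwords: "y \<in> verts \<G> \<Longrightarrow> ([], \<one>\<^bsub>G y\<^esub>) \<in> rwords y y"
  by (simp add: rwords_def)

lemma nf_act: "(x, q, g) \<in> gwords \<G> x y \<Longrightarrow> nf y (x, q, g) = act y q ([], g)"
  by (auto simp: nf_def gwords_iff dest: gchain_verts)

text \<open>Evaluates the definite description. A reduced word equivalent to \<open>w\<close> acts
  like \<open>w\<close> by \<open>weq_actw\<close>, and its value on the trivial word is itself by
  \<open>act_red\<close>, so it is \<open>nf y w\<close>.\<close>

lemma reduced_form_eq:
  assumes w: "w \<in> gwords \<G> x y"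
  shows "reduced_form \<G> S w = (x, nf y w)" "weq \<G> w (x, nf y w)"
proof -
  obtain q g where q: "w = (x, q, g)" using w by (auto simp: gwords_def)
  have y: "y \<in> verts \<G>" using w gwords_verts by auto
  show weq: "weq \<G> w (x, nf y w)"
    using weq_act w by (simp add: q nf_act)
  have rw: "nf y w \<in> rwords x y"
    unfolding nf_def by (rule actw_closed[OF w one_rwords[OF y]])
  show "reduced_form \<G> S w = (x, nf y w)"
    unfolding reduced_form_def
  proof (rule the_equality)
    show "weq \<G> w (x, nf y w) \<and> reduced_gword \<G> S (x, nf y w)"
      using weq rw by (cases "nf y w") (auto simp: reduced_gword_iff rwords_def)
    fix w' assume w': "weq \<G> w w' \<and> reduced_gword \<G> S w'"
    then have gw: "w' \<in> gwords \<G> x y" using weq_gwords w by blast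
    then obtain p k where p: "w' = (x, p, k)" by (auto simp: gwords_def)
    have "nf y w' = (p, k)"
      using gw w' act_red[of x p y k] by (simp add: p nf_act reduced_gword_iff) (simp add: gwords_iff)
    moreover have "nf y w = nf y w'"
      unfolding nf_def using weq_actw w' w gwords_unique one_rwords[OF y] by metis
    ultimately show "w' = (x, nf y w)" by (simp add: p)
  qed
qed

lemma reduced_form_weq: "weq \<G> w w' \<Longrightarrow> reduced_form \<G> S w = reduced_form \<G> S w'"
  unfolding reduced_form_def by (metis weq.sym weq.trans)

lemma reduced_form_red:
  "(x, p, g) \<in> gwords \<G> x y \<Longrightarrow> red p \<Longrightarrow> reduced_form \<G> S (x, p, g) = (x, p, g)"
  using reduced_form_eq(1)[of "(x, p, g)" x y] act_red[of x p y g] by (simp add: nf_act) (simp add: gwords_iff)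

lemma wconcat_assoc:
  assumes "u \<in> gwords \<G> x y" "v \<in> gwords \<G> y z" "w \<in> gwords \<G> z t"
  shows "wconcat \<G> (wconcat \<G> u v) w = wconcat \<G> u (wconcat \<G> v w)"
proof -
  obtain p g where u: "u = (x, p, g)" "gchain \<G> x p y" "g \<in> carrier (G y)"
    using assms by (auto simp: gwords_def)
  obtain q h where v: "v = (y, q, h)" "gchain \<G> y q z" "h \<in> carrier (G z)"
    using assms by (auto simp: gwords_def)
  obtain o' k where w: "w = (z, o', k)" "gchain \<G> z o' t" "k \<in> carrier (G t)"
    using assms by (auto simp: gwords_def)
  have verts: "y \<in> verts \<G>" "z \<in> verts \<G>" using u v gchain_verts by auto
  show ?thesis
    using u v w verts by (cases q; cases o') (auto simp: vgrp_m_assoc)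
qed

text \<open>Used to exchange an initial segment of a boundary point for another path with the same
  source. The letter \<open>h e\<close> is undone by \<open>1 (bar e)\<close> followed by the
  inverse of \<open>h\<close>.\<close>

lemma left_inverse_word:
  assumes "t \<in> gwords \<G> x y"
  shows "\<exists>u\<in>gwords \<G> y x. weq \<G> (wconcat \<G> u t) (y, [], \<one>\<^bsub>G y\<^esub>)"
proof -
  obtain p g where t: "t = (x, p, g)" using assms by (auto simp: gwords_def)
  show ?thesis using assms unfolding t
  proof (induction p arbitrary: x)
    case Nil
    then have x: "x = y" "x \<in> verts \<G>" "g \<in> carrier (G x)" by (auto simp: gwords_iff)
    interpret group "G x" using x by simp
    have "weq \<G> (x, [], \<one>\<^bsub>G x\<^esub>) (x, [], \<one>\<^bsub>G x\<^esub>)" by (rule weq.refl[OF one_gwords[OF x(2)]])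
    show ?case unfolding x(1)[symmetric] using x(2,3) \<open>weq \<G> _ _\<close>
      by (intro bexI[of _ "(x, [], inv\<^bsub>G x\<^esub> g)"]) (simp_all add: gwords_iff)
  next
    case (Cons l p)
    obtain h e where l: "l = (h, e)" by fastforce
    have e: "e \<in> edges \<G>" "r e = x" and h: "h \<in> carrier (G (r e))" and p: "(s e, p, g) \<in> gwords \<G> (s e) y"
      using Cons.prems l by (auto simp: gwords_iff)
    interpret group "G (r e)" using e(1) by simp
    let ?a = "(r e, [(h, e)], \<one>\<^bsub>G (s e)\<^esub>)" and ?b = "(s e, [(\<one>\<^bsub>G (s e)\<^esub>, bar e)], inv\<^bsub>G (r e)\<^esub> h)"
    have a: "?a \<in> gwords \<G> (r e) (s e)" using e(1) h by (simp add: gwords_iff)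
    have b: "?b \<in> gwords \<G> (s e) (r e)" using e(1) h by (simp add: gwords_iff)
    obtain u where u: "u \<in> gwords \<G> y (s e)" "weq \<G> (wconcat \<G> u (s e, p, g)) (y, [], \<one>\<^bsub>G y\<^esub>)"
      using Cons.IH[OF p] by blast
    have ba: "weq \<G> (wconcat \<G> ?b ?a) (s e, [], \<one>\<^bsub>G (s e)\<^esub>)"
      using backtrack[OF graph_simps(3)[OF e(1)]] e(1) h by simp
    note bat = weq_concat_right[OF ba wconcat_closed[OF b a] p]
    have "weq \<G> (wconcat \<G> u (wconcat \<G> (wconcat \<G> ?b ?a) (s e, p, g))) (wconcat \<G> u (wconcat \<G> (s e, [], \<one>\<^bsub>G (s e)\<^esub>) (s e, p, g)))"
      by (rule weq_concat_left[OF bat wconcat_closed[OF wconcat_closed[OF b a] p] u(1)])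
    then have "weq \<G> (wconcat \<G> u (wconcat \<G> (wconcat \<G> ?b ?a) (s e, p, g))) (y, [], \<one>\<^bsub>G y\<^esub>)"
      unfolding wconcat_one_left[OF p] using u(2) by (rule weq.trans)
    moreover have "wconcat \<G> u (wconcat \<G> (wconcat \<G> ?b ?a) (s e, p, g)) = wconcat \<G> (wconcat \<G> u ?b) (wconcat \<G> ?a (s e, p, g))"
      using wconcat_assoc[OF b a p] wconcat_assoc[OF u(1) b wconcat_closed[OF a p]] by simp
    moreover have "wconcat \<G> ?a (s e, p, g) = (x, l # p, g)"
      using wconcat_letter[OF e(1) p] e(2) by (simp add: l)
    ultimately show ?case using wconcat_closed[OF u(1) b] e(2) by metis
  qed
qed

section \<open>Reduced paths and boundary points\<close>

definition follows :: "'e \<Rightarrow> 'e \<Rightarrow> bool" where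
  "follows e f \<longleftrightarrow> e \<in> edges \<G> \<and> f \<in> edges \<G> \<and> r f = s e \<and> (f = bar e \<longrightarrow> \<not> emb_surj \<G> f)"

text \<open>Surjectivity means a single coset. In this form it decides whether there is a nontrivial
  group element to put in front of \<open>e\<close>, as reducedness demands after
  backtracking.\<close>

lemma emb_surj_iff:
  assumes e: "e \<in> edges \<G>"
  shows "emb_surj \<G> e \<longleftrightarrow> (\<forall>h\<in>S e. h = \<one>\<^bsub>G (r e)\<^esub>)"
proof
  interpret A: group_hom "E e" "G (r e)" "\<alpha> e" by (rule emb_hom[OF e])
  {
    assume surj: "emb_surj \<G> e"
    show "\<forall>h\<in>S e. h = \<one>\<^bsub>G (r e)\<^esub>"
    proof
      fix h assume h: "h \<in> S e"
      then obtain a where a: "a \<in> carrier (E e)" "h = \<alpha> e a"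
        using surj transversal_closed[OF e] by (auto simp: emb_surj_def emb_image_def)
      then show "h = \<one>\<^bsub>G (r e)\<^esub>"
        using rep_mult(1)[OF e one_transversal[OF e] a(1)] rep_transversal(1)[OF e h] by simp
    qed
  }
  assume 1: "\<forall>h\<in>S e. h = \<one>\<^bsub>G (r e)\<^esub>"
  have "y \<in> emb_image \<G> e" if "y \<in> carrier (G (r e))" for y
  proof (rule rep_cases[OF e that])
    fix h a assume "h \<in> S e" "a \<in> carrier (E e)" "y = h \<otimes>\<^bsub>G (r e)\<^esub> \<alpha> e a"
    moreover from this have "h = \<one>\<^bsub>G (r e)\<^esub>" using 1 by blast
    ultimately have "y = \<alpha> e a" by simp
    then show ?thesis using \<open>a \<in> carrier (E e)\<close> by (auto simp: emb_image_def)
  qed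
  then show "emb_surj \<G> e" by (auto simp: emb_surj_def emb_image_def)
qed

lemma follows_link:
  assumes "snd a \<in> edges \<G>" "snd b \<in> edges \<G>" "fst b \<in> S (snd b)" "r (snd b) = s (snd a)" "link a b"
  shows "follows (snd a) (snd b)"
proof -
  have "\<not> emb_surj \<G> (snd b)" if "snd b = bar (snd a)"
  proof -
    have "snd a = bar (snd b)" using graph_simps(6)[OF assms(1)] that by simp
    then show ?thesis using assms(2,3,5) emb_surj_iff unfolding link_def by blast
  qed
  then show ?thesis using assms unfolding follows_def by blast
qed

text \<open>One \<open>g\<close> works for every preceding group element \<open>h\<close>, because
  \<open>link\<close> looks only at the edge of its first argument. Letters can therefore be chosen
  independently along a chain of edges.\<close>

lemma link_follows:
  assumes "follows e f"
  shows "\<exists>g\<in>S f. \<forall>h. link (h, e) (g, f)"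
proof (cases "f = bar e")
  case True
  then obtain g where "g \<in> S f" "g \<noteq> \<one>\<^bsub>G (r f)\<^esub>"
    using assms by (auto simp: follows_def emb_surj_iff)
  then show ?thesis by (auto simp: link_def)
next
  case False
  then have "e \<noteq> bar f" using assms by (auto simp: follows_def)
  moreover have "\<one>\<^bsub>G (r f)\<^esub> \<in> S f" using assms one_transversal[of f] by (simp add: follows_def)
  ultimately show ?thesis by (auto simp: link_def)
qed

lemma gchain_chain_src: "gchain \<G> x p y \<Longrightarrow> chain_src \<G> x p = y"
  by (induction p arbitrary: x) (auto simp: chain_src_def split: if_splits)

lemma reduced_gpaths_iff: "p \<in> reduced_gpaths \<G> S x \<longleftrightarrow> (\<exists>y. gchain \<G> x p y) \<and> red p"
proof -
  have "gchain \<G> x p y \<Longrightarrow> \<one>\<^bsub>G (chain_src \<G> x p)\<^esub> \<in> carrier (G y)" for y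
    using gchain_chain_src gchain_verts by fastforce
  then show ?thesis
    unfolding reduced_gpaths_def word_of_chain_def by (auto simp: gwords_iff reduced_gword_iff)
qed

lemma gchain_snoc: "gchain \<G> x (p @ [a]) y \<longleftrightarrow>
    gchain \<G> x p (r (snd a)) \<and> snd a \<in> edges \<G> \<and> fst a \<in> carrier (G (r (snd a))) \<and> s (snd a) = y"
  by (cases a) (auto simp: gchain_append)

lemma reduced_gpaths_snoc: "p @ [a] \<in> reduced_gpaths \<G> S x \<longleftrightarrow>
    p \<in> reduced_gpaths \<G> S x \<and> gchain \<G> x p (r (snd a)) \<and> snd a \<in> edges \<G> \<and> fst a \<in> S (snd a) \<and>
    (p \<noteq> [] \<longrightarrow> link (last p) a)"
  using transversal_closed by (auto simp: reduced_gpaths_iff gchain_snoc red_append red_Cons)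

lemma reduced_gpaths_append: "p @ q \<in> reduced_gpaths \<G> S x \<Longrightarrow> p \<in> reduced_gpaths \<G> S x"
  by (auto simp: reduced_gpaths_iff gchain_append red_append)

lemma gchain_edges: "gchain \<G> x p y \<Longrightarrow> i < length p \<Longrightarrow> snd (p ! i) \<in> edges \<G>"
  by (induction p arbitrary: x i) (auto simp: less_Suc_eq_0_disj)

lemma gchain_first: "gchain \<G> x p y \<Longrightarrow> p \<noteq> [] \<Longrightarrow> r (snd (p ! 0)) = x"
  by (cases p) auto

lemma gchain_last: "gchain \<G> x p y \<Longrightarrow> p \<noteq> [] \<Longrightarrow> s (snd (last p)) = y"
  using gchain_chain_src[of x p y] by (simp add: chain_src_def)

lemma gchain_step: "gchain \<G> x p y \<Longrightarrow> Suc i < length p \<Longrightarrow> r (snd (p ! Suc i)) = s (snd (p ! i))"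
proof (induction p arbitrary: x i)
  case (Cons l p)
  then show ?case using gchain_first[of "s (snd l)" p y] by (cases l; cases i) auto
qed auto

lemma boundary_iff: "\<xi> \<in> boundary \<G> S x \<longleftrightarrow>
    r (snd (\<xi> 0)) = x \<and> (\<forall>n. snd (\<xi> n) \<in> edges \<G> \<and> fst (\<xi> n) \<in> S (snd (\<xi> n))) \<and>
    (\<forall>n. r (snd (\<xi> (Suc n))) = s (snd (\<xi> n)) \<and> link (\<xi> n) (\<xi> (Suc n)))"
  (is "?l \<longleftrightarrow> ?r")
proof
  assume ?l
  then have path: "map \<xi> [0..<n] \<in> reduced_gpaths \<G> S x" for n by (auto simp: boundary_def)
  have "map \<xi> [0..<n] @ [\<xi> n] \<in> reduced_gpaths \<G> S x" for n
    using path[of "Suc n"] by simp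
  then have 1: "gchain \<G> x (map \<xi> [0..<n]) (r (snd (\<xi> n)))" "snd (\<xi> n) \<in> edges \<G>" "fst (\<xi> n) \<in> S (snd (\<xi> n))"
    "n > 0 \<longrightarrow> link (last (map \<xi> [0..<n])) (\<xi> n)" for n
    unfolding reduced_gpaths_snoc by auto
  have "r (snd (\<xi> (Suc n))) = s (snd (\<xi> n))" for n
    using gchain_last[OF 1(1)[of "Suc n"]] by simp
  then show ?r using 1(1)[of 0] 1(2,3) 1(4)[of "Suc n" for n] by auto
next
  assume r: ?r
  have "map \<xi> [0..<n] \<in> reduced_gpaths \<G> S x \<and> gchain \<G> x (map \<xi> [0..<n]) (r (snd (\<xi> n)))" for n
  proof (induction n)
    case 0
    have "x \<in> verts \<G>" using r by auto
    then show ?case using r by (auto simp: reduced_gpaths_iff)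
  next
    case (Suc n)
    have "n \<noteq> 0 \<Longrightarrow> link (last (map \<xi> [0..<n])) (\<xi> n)"
      using r by (cases n) auto
    then have "map \<xi> [0..<n] @ [\<xi> n] \<in> reduced_gpaths \<G> S x"
      unfolding reduced_gpaths_snoc using r Suc by auto
    moreover have "gchain \<G> x (map \<xi> [0..<n] @ [\<xi> n]) (r (snd (\<xi> (Suc n))))"
      unfolding gchain_snoc using r Suc transversal_closed by auto
    ultimately show ?case by simp
  qed
  then show ?l by (auto simp: boundary_def)
qed

lemma boundary_follows: "\<xi> \<in> boundary \<G> S x \<Longrightarrow> follows (snd (\<xi> n)) (snd (\<xi> (Suc n)))"
  by (rule follows_link) (auto simp: boundary_iff)

lemma boundary_shift: "\<xi> \<in> boundary \<G> S x \<Longrightarrow> (\<lambda>n. \<xi> (k + n)) \<in> boundary \<G> S (r (snd (\<xi> k)))"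
  by (auto simp: boundary_iff)

lemma chain_lift:
  assumes f: "\<And>n. follows (f n) (f (Suc n))"
  shows "\<exists>\<xi>\<in>boundary \<G> S (r (f 0)). \<forall>n. snd (\<xi> n) = f n"
proof -
  have "\<exists>g. g \<in> S (f (Suc n)) \<and> (\<forall>h. link (h, f n) (g, f (Suc n)))" for n
    using link_follows[OF f[of n]] by blast
  then obtain g where g: "\<And>n. g n \<in> S (f (Suc n))" "\<And>n h. link (h, f n) (g n, f (Suc n))"
    by metis
  define \<xi> where "\<xi> = (\<lambda>n. (case n of 0 \<Rightarrow> \<one>\<^bsub>G (r (f 0))\<^esub> | Suc m \<Rightarrow> g m, f n))"
  have "\<xi> \<in> boundary \<G> S (r (f 0))"
    unfolding boundary_iff
  proof (intro conjI allI)
    fix n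
    show "snd (\<xi> n) \<in> edges \<G>" using f by (simp add: \<xi>_def follows_def)
    show "fst (\<xi> n) \<in> S (snd (\<xi> n))"
      using g f one_transversal by (auto simp: \<xi>_def follows_def split: nat.split)
    show "r (snd (\<xi> (Suc n))) = s (snd (\<xi> n))" using f by (simp add: \<xi>_def follows_def)
    show "link (\<xi> n) (\<xi> (Suc n))" using g(2) by (simp add: \<xi>_def)
  qed (simp add: \<xi>_def)
  moreover have "\<forall>n. snd (\<xi> n) = f n" by (simp add: \<xi>_def)
  ultimately show ?thesis by blast
qed

lemma glue:
  assumes \<mu>: "\<mu> \<in> reduced_gpaths \<G> S x" "\<mu> \<noteq> []" and \<xi>: "\<xi> \<in> boundary \<G> S y" "snd (\<xi> 0) = snd (last \<mu>)"
  shows "\<exists>\<eta>\<in>cylinder \<G> S x \<mu>. \<forall>n. \<eta> (length \<mu> + n) = \<xi> (Suc n)"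
proof -
  \<comment> \<open>The letter \<open>\<xi> 0\<close> is absorbed: it has the same edge as the last
    letter of \<mu>, possibly with another group element, so after \<mu> the sequence continues with
    \<open>\<xi> 1\<close>.\<close>
  define \<eta> where "\<eta> = (\<lambda>n. if n < length \<mu> then \<mu> ! n else \<xi> (Suc n - length \<mu>))"
  obtain z where z: "gchain \<G> x \<mu> z" and red: "red \<mu>" using \<mu> by (auto simp: reduced_gpaths_iff)
  have "\<eta> \<in> boundary \<G> S x"
    unfolding boundary_iff
  proof (intro conjI allI)
    show "r (snd (\<eta> 0)) = x" using \<mu> gchain_first[OF z] by (simp add: \<eta>_def)
    fix n
    show "snd (\<eta> n) \<in> edges \<G>" using gchain_edges[OF z] \<xi> by (simp add: \<eta>_def boundary_iff)
    show "fst (\<eta> n) \<in> S (snd (\<eta> n))"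
      using red \<xi> by (auto simp: \<eta>_def boundary_iff red_def)
    consider "Suc n < length \<mu>" | "Suc n = length \<mu>" | "Suc n > length \<mu>" by linarith
    then have "r (snd (\<eta> (Suc n))) = s (snd (\<eta> n)) \<and> link (\<eta> n) (\<eta> (Suc n))"
    proof cases
      case 1
      then have "\<eta> n = \<mu> ! n" "\<eta> (Suc n) = \<mu> ! Suc n" by (simp_all add: \<eta>_def)
      moreover have "link (\<mu> ! n) (\<mu> ! Suc n)"
        using red 1 by (simp add: red_def successively_conv_nth)
      ultimately show ?thesis using gchain_step[OF z 1] by simp
    next
      case 2
      then have "\<mu> ! n = last \<mu>" using \<mu>(2) by (simp add: last_conv_nth flip: 2)
      then have "snd (\<eta> n) = snd (\<xi> 0)" "\<eta> (Suc n) = \<xi> 1" using 2 \<xi>(2) by (simp_all add: \<eta>_def)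
      moreover have "r (snd (\<xi> 1)) = s (snd (\<xi> 0))" "link (\<xi> 0) (\<xi> 1)"
        using \<xi>(1) unfolding boundary_iff by (metis One_nat_def)+
      ultimately show ?thesis unfolding link_def by metis
    next
      case 3
      then have "\<eta> n = \<xi> (Suc n - length \<mu>)" "\<eta> (Suc n) = \<xi> (Suc (Suc n - length \<mu>))"
        by (simp_all add: \<eta>_def Suc_diff_le)
      then show ?thesis using \<xi>(1) by (simp add: boundary_iff)
    qed
    then show "r (snd (\<eta> (Suc n))) = s (snd (\<eta> n))" "link (\<eta> n) (\<eta> (Suc n))" by auto
  qed
  moreover have "map \<eta> [0..<length \<mu>] = \<mu>" by (rule nth_equalityI) (auto simp: \<eta>_def)
  moreover have "\<forall>n. \<eta> (length \<mu> + n) = \<xi> (Suc n)" by (simp add: \<eta>_def)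
  ultimately show ?thesis unfolding cylinder_def by blast
qed

lemma extend_path:
  assumes "follows\<^sup>*\<^sup>* (snd (last \<mu>)) c" "\<mu> \<in> reduced_gpaths \<G> S x" "\<mu> \<noteq> []"
  shows "\<exists>\<nu>. \<mu> @ \<nu> \<in> reduced_gpaths \<G> S x \<and> snd (last (\<mu> @ \<nu>)) = c"
  using assms
proof (induction rule: rtranclp_induct)
  case base
  then show ?case by (intro exI[of _ "[]"]) auto
next
  case (step c d)
  then obtain \<nu> where \<nu>: "\<mu> @ \<nu> \<in> reduced_gpaths \<G> S x" "snd (last (\<mu> @ \<nu>)) = c" by auto
  obtain g where g: "g \<in> S d" "\<forall>h. link (h, c) (g, d)" using link_follows[OF step(2)] by blast
  obtain z where z: "gchain \<G> x (\<mu> @ \<nu>) z" using \<nu> by (auto simp: reduced_gpaths_iff)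
  have "s c = z" using gchain_last[OF z] \<nu> step by simp
  then have "r d = z" "d \<in> edges \<G>" using step(2) by (auto simp: follows_def)
  moreover have "link (last (\<mu> @ \<nu>)) (g, d)" using g(2) \<nu>(2) by (metis prod.collapse)
  ultimately have "(\<mu> @ \<nu>) @ [(g, d)] \<in> reduced_gpaths \<G> S x"
    unfolding reduced_gpaths_snoc using g \<nu> z by auto
  then show ?case by (intro exI[of _ "\<nu> @ [(g, d)]"]) auto
qed

section \<open>The action on the boundary\<close>

text \<open>The letters of \<open>act\<close> without the final group element. They do not depend on
  the source of the word acted on, which changes with the length of the prefix of a boundary
  point.\<close>

fun pact :: "('g \<times> 'e) list \<Rightarrow> ('g \<times> 'e) list \<Rightarrow> ('g \<times> 'e) list" where
  "pact [] p = p"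
| "pact ((g, e) # q) p = out g (lcons e (pact q p))"

lemma fst_lmult: "fst (lmult y g w) = out g (fst w)"
  by (cases w) simp

lemma fst_act: "fst (act y q w) = pact q (fst w)"
  by (induction q) (auto simp: fst_lmult)

text \<open>From \<open>m = b\<close> on, the words \<open>P m\<close> are prefixes of one sequence
  \<eta> and grow by one letter each time; the first \<open>b\<close> letters of \<xi> are accounted
  for by the first \<open>a\<close> letters of \<eta>. Beyond these only the edges agree, since an
  element carried along alters the group elements.\<close>

definition tracks :: "(nat \<Rightarrow> 'g \<times> 'e) \<Rightarrow> (nat \<Rightarrow> ('g \<times> 'e) list) \<Rightarrow> (nat \<Rightarrow> 'g \<times> 'e) \<Rightarrow> bool" where
  "tracks \<xi> P \<eta> \<longleftrightarrow> (\<exists>a b. (\<forall>m\<ge>b. P m = map \<eta> [0..<a + m - b]) \<and> (\<forall>n. snd (\<eta> (a + n)) = snd (\<xi> (b + n))))"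

lemma tracks_prefixes: "tracks \<xi> (\<lambda>m. map \<xi> [0..<m]) \<xi>"
  unfolding tracks_def by (intro exI[of _ 0]) auto

text \<open>A letter of \<open>out g p\<close> depends only on the letters of \<open>p\<close> up to
  that place, so the images of prefixes are again prefixes of one sequence.\<close>

lemma tracks_out:
  assumes "tracks \<xi> P \<eta>"
  shows "\<exists>\<eta>'. tracks \<xi> (\<lambda>m. out g (P m)) \<eta>'"
proof -
  obtain a b where ab: "\<And>m. m \<ge> b \<Longrightarrow> P m = map \<eta> [0..<a + m - b]" "\<And>n. snd (\<eta> (a + n)) = snd (\<xi> (b + n))"
    using assms unfolding tracks_def by blast
  define \<eta>' where "\<eta>' = (\<lambda>n. out g (map \<eta> [0..<Suc n]) ! n)"
  have out: "out g (map \<eta> [0..<n]) = map \<eta>' [0..<n]" for n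
  proof (induction n)
    case (Suc n)
    have "out g (map \<eta> [0..<Suc n]) = map \<eta>' [0..<n] @ out (rest g (map \<eta> [0..<n])) [\<eta> n]"
      by (simp add: out_append Suc)
    moreover obtain c where c: "out (rest g (map \<eta> [0..<n])) [\<eta> n] = [c]"
      by (cases "\<eta> n") auto
    ultimately have *: "out g (map \<eta> [0..<Suc n]) = map \<eta>' [0..<n] @ [c]" by simp
    have "c = \<eta>' n" unfolding \<eta>'_def * by (simp add: nth_append)
    then show ?case using * by simp
  qed simp
  have "snd (\<eta>' n) = snd (\<eta> n)" for n
  proof -
    have "map snd (map \<eta>' [0..<Suc n]) ! n = map snd (map \<eta> [0..<Suc n]) ! n"
      unfolding out[symmetric] snd_out ..
    then show ?thesis by (simp del: upt_Suc)
  qed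
  then have "tracks \<xi> (\<lambda>m. out g (P m)) \<eta>'"
    unfolding tracks_def using ab out by (intro exI[of _ a] exI[of _ b]) auto
  then show ?thesis by blast
qed

lemma tracks_lcons:
  assumes "tracks \<xi> P \<eta>"
  shows "\<exists>\<eta>'. tracks \<xi> (\<lambda>m. lcons e (P m)) \<eta>'"
proof -
  obtain a b where ab: "\<And>m. m \<ge> b \<Longrightarrow> P m = map \<eta> [0..<a + m - b]" "\<And>n. snd (\<eta> (a + n)) = snd (\<xi> (b + n))"
    using assms unfolding tracks_def by blast
  have P: "P m = \<eta> 0 # map (\<lambda>n. \<eta> (Suc n)) [0..<a + m - b - 1]" if "m \<ge> Suc b" for m
  proof -
    have "a + m - b = Suc (a + m - b - 1)" using that by linarith
    moreover have "P m = map \<eta> [0..<a + m - b]" using ab(1) that by auto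
    ultimately show ?thesis by (metis map_upt_Suc)
  qed
  show ?thesis
  proof (cases "\<eta> 0 = (\<one>\<^bsub>G (s e)\<^esub>, bar e)")
    case True
    have "tracks \<xi> (\<lambda>m. lcons e (P m)) (\<lambda>n. \<eta> (Suc n))"
      unfolding tracks_def
    proof (intro exI conjI allI impI)
      show "lcons e (P m) = map (\<lambda>n. \<eta> (Suc n)) [0..<a + m - Suc b]" if "m \<ge> Suc b" for m
        unfolding P[OF that] using True by (simp add: lcons_def)
      show "snd (\<eta> (Suc (a + n))) = snd (\<xi> (Suc b + n))" for n
        using ab(2)[of "Suc n"] by simp
    qed
    then show ?thesis by blast
  next
    case False
    \<comment> \<open>Of the two extra letters counted before the common tail, one is the new letter
      with edge \<open>e\<close>. The other is \<open>\<eta> a\<close>, passed because the threshold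
      moves from \<open>b\<close> to \<open>Suc b\<close> to make \<open>P m\<close>
      nonempty.\<close>
    let ?\<eta> = "case_nat (\<one>\<^bsub>G (r e)\<^esub>, e) \<eta>"
    have "tracks \<xi> (\<lambda>m. lcons e (P m)) ?\<eta>"
      unfolding tracks_def
    proof (intro exI conjI allI impI)
      show "lcons e (P m) = map ?\<eta> [0..<Suc (Suc a) + m - Suc b]" if m: "m \<ge> Suc b" for m
      proof -
        have "lcons e (P m) = (\<one>\<^bsub>G (r e)\<^esub>, e) # map \<eta> [0..<a + m - b]"
          using P[OF m] False ab(1)[of m] m by (simp add: lcons_def)
        moreover have "Suc (Suc a) + m - Suc b = Suc (a + m - b)" using m by linarith
        ultimately show ?thesis by (simp add: map_upt_Suc del: upt_Suc)
      qed
      show "snd (?\<eta> (Suc (Suc a) + n)) = snd (\<xi> (Suc b + n))" for n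
        using ab(2)[of "Suc n"] by simp
    qed
    then show ?thesis by blast
  qed
qed

lemma tracks_pact: "\<exists>\<eta>. tracks \<xi> (\<lambda>m. pact q (out g (map \<xi> [0..<m]))) \<eta>"
proof (induction q)
  case Nil
  then show ?case using tracks_out[OF tracks_prefixes] by simp
next
  case (Cons l q)
  obtain h e where l: "l = (h, e)" by fastforce
  from Cons obtain \<eta> where "tracks \<xi> (\<lambda>m. pact q (out g (map \<xi> [0..<m]))) \<eta>" ..
  from tracks_lcons[OF this] obtain \<eta>' where "tracks \<xi> (\<lambda>m. lcons e (pact q (out g (map \<xi> [0..<m])))) \<eta>'" ..
  from tracks_out[OF this] show ?case by (simp add: l)
qed

lemma prefix_gwords:
  assumes "\<xi> \<in> boundary \<G> S x"
  shows "word_of_chain \<G> x (map \<xi> [0..<m]) \<in> gwords \<G> x (chain_src \<G> x (map \<xi> [0..<m]))"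
    and "red (map \<xi> [0..<m])"
proof -
  have "map \<xi> [0..<m] \<in> reduced_gpaths \<G> S x" using assms by (auto simp: boundary_def)
  then obtain y where y: "gchain \<G> x (map \<xi> [0..<m]) y" and red: "red (map \<xi> [0..<m])"
    by (auto simp: reduced_gpaths_iff)
  show "red (map \<xi> [0..<m])" by (rule red)
  show "word_of_chain \<G> x (map \<xi> [0..<m]) \<in> gwords \<G> x (chain_src \<G> x (map \<xi> [0..<m]))"
    using y gchain_chain_src[OF y] gchain_verts[OF y] by (simp add: word_of_chain_def gwords_iff)
qed

lemma reduced_form_prefix:
  assumes \<xi>: "\<xi> \<in> boundary \<G> S v" and w: "(v, q, g) \<in> gwords \<G> v v"
  shows "\<exists>k. reduced_form \<G> S (wconcat \<G> (v, q, g) (word_of_chain \<G> v (map \<xi> [0..<m])))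
      = (v, pact q (out g (map \<xi> [0..<m])), k)"
    and "pact q (out g (map \<xi> [0..<m])) \<in> reduced_gpaths \<G> S v"
proof -
  let ?p = "map \<xi> [0..<m]"
  define z where "z = chain_src \<G> v ?p"
  have t: "(v, ?p, \<one>\<^bsub>G z\<^esub>) \<in> gwords \<G> v z" and red: "red ?p"
    using prefix_gwords[OF \<xi>, of m] by (simp_all add: word_of_chain_def z_def)
  have z: "z \<in> verts \<G>" using gwords_verts[OF t] by simp
  have wt: "wconcat \<G> (v, q, g) (v, ?p, \<one>\<^bsub>G z\<^esub>) \<in> gwords \<G> v z" by (rule wconcat_closed[OF w t])
  have "actw z (v, ?p, \<one>\<^bsub>G z\<^esub>) ([], \<one>\<^bsub>G z\<^esub>) = (?p, \<one>\<^bsub>G z\<^esub>)"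
    using act_red[of v ?p z "\<one>\<^bsub>G z\<^esub>"] t red z by (simp add: gwords_iff)
  then have nf: "nf z (wconcat \<G> (v, q, g) (v, ?p, \<one>\<^bsub>G z\<^esub>)) = act z q (lmult z g (?p, \<one>\<^bsub>G z\<^esub>))"
    unfolding nf_def actw_wconcat[OF w t one_rwords[OF z]] by simp
  have "fst (nf z (wconcat \<G> (v, q, g) (v, ?p, \<one>\<^bsub>G z\<^esub>))) = pact q (out g ?p)"
    unfolding nf by (simp add: fst_act)
  moreover have "nf z (wconcat \<G> (v, q, g) (v, ?p, \<one>\<^bsub>G z\<^esub>)) \<in> rwords v z"
    unfolding nf_def by (rule actw_closed[OF wt one_rwords[OF z]])
  ultimately show "\<exists>k. reduced_form \<G> S (wconcat \<G> (v, q, g) (word_of_chain \<G> v ?p)) = (v, pact q (out g ?p), k)"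
    "pact q (out g ?p) \<in> reduced_gpaths \<G> S v"
    unfolding word_of_chain_def z_def[symmetric] reduced_form_eq(1)[OF wt]
    by (cases "nf z (wconcat \<G> (v, q, g) (v, ?p, \<one>\<^bsub>G z\<^esub>))"; auto simp: rwords_def reduced_gpaths_iff)+
qed

text \<open>Besides the limit this records that \<xi> and its image have the same edges from some
  points on, the invariant that controls which cylinders an orbit can meet.\<close>

lemma reduces_to_exists:
  assumes \<xi>: "\<xi> \<in> boundary \<G> S v" and w: "w \<in> gwords \<G> v v"
  shows "\<exists>\<eta>\<in>boundary \<G> S v. reduces_to \<G> S v w \<xi> \<eta> \<and> (\<exists>a b. \<forall>n. snd (\<eta> (a + n)) = snd (\<xi> (b + n)))"
proof -
  obtain q g where wq: "w = (v, q, g)" using w by (auto simp: gwords_def)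
  let ?P = "\<lambda>m. pact q (out g (map \<xi> [0..<m]))"
  obtain \<eta> where "tracks \<xi> ?P \<eta>" using tracks_pact by blast
  then obtain a b where ab: "\<And>m. m \<ge> b \<Longrightarrow> ?P m = map \<eta> [0..<a + m - b]" "\<And>n. snd (\<eta> (a + n)) = snd (\<xi> (b + n))"
    unfolding tracks_def by blast
  have take: "take n (?P m) = map \<eta> [0..<n]" if "m \<ge> b + n" for n m
    using ab(1)[of m] that by (simp add: take_map)
  have "map \<eta> [0..<n] \<in> reduced_gpaths \<G> S v" for n
  proof -
    have "take n (?P (b + n)) @ drop n (?P (b + n)) \<in> reduced_gpaths \<G> S v"
      using reduced_form_prefix(2)[OF \<xi>] w wq by simp
    then show ?thesis using take[of n "b + n"] reduced_gpaths_append by (metis order_refl)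
  qed
  then have "\<eta> \<in> boundary \<G> S v" by (simp add: boundary_def)
  moreover have "reduces_to \<G> S v w \<xi> \<eta>"
    unfolding reduces_to_def
  proof (intro allI eventually_sequentiallyI)
    fix n m assume "b + n \<le> m"
    moreover obtain k where "reduced_form \<G> S (wconcat \<G> w (word_of_chain \<G> v (map \<xi> [0..<m]))) = (v, ?P m, k)"
      using reduced_form_prefix(1)[OF \<xi>] w wq by blast
    ultimately show "case reduced_form \<G> S (wconcat \<G> w (word_of_chain \<G> v (map \<xi> [0..<m]))) of
        (x, p, g) \<Rightarrow> take n p = map \<eta> [0..<n]"
      using take by simp
  qed
  ultimately show ?thesis using ab(2) by blast
qed

lemma reduces_to_unique:
  assumes "reduces_to \<G> S v w \<xi> \<eta>" "reduces_to \<G> S v w \<xi> \<eta>'"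
  shows "\<eta> = \<eta>'"
proof
  fix n
  let ?Q = "\<lambda>\<eta> m. case reduced_form \<G> S (wconcat \<G> w (word_of_chain \<G> v (map \<xi> [0..<m]))) of
          (x, p, g) \<Rightarrow> take (Suc n) p = map \<eta> [0..<Suc n]"
  have "\<forall>\<^sub>F m in sequentially. ?Q \<eta> m \<and> ?Q \<eta>' m"
    using assms unfolding reduces_to_def by (intro eventually_conj) blast+
  from eventually_happens'[OF sequentially_bot this] obtain m where "?Q \<eta> m \<and> ?Q \<eta>' m"
    by (rule exE)
  then have "map \<eta> [0..<Suc n] = map \<eta>' [0..<Suc n]" by (auto split: prod.splits)
  then show "\<eta> n = \<eta>' n" by simp
qed

lemma reduces_to_weq:
  assumes "weq \<G> w w'" "w \<in> gwords \<G> v v" "\<xi> \<in> boundary \<G> S v"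
  shows "reduces_to \<G> S v w \<xi> \<eta> \<longleftrightarrow> reduces_to \<G> S v w' \<xi> \<eta>"
proof -
  have "reduced_form \<G> S (wconcat \<G> w (word_of_chain \<G> v (map \<xi> [0..<m]))) =
    reduced_form \<G> S (wconcat \<G> w' (word_of_chain \<G> v (map \<xi> [0..<m])))" for m
    by (rule reduced_form_weq[OF weq_concat_right[OF assms(1,2) prefix_gwords(1)[OF assms(3)]]])
  then show ?thesis by (simp add: reduces_to_def)
qed

lemma boundary_action_eq:
  assumes w: "w \<in> gwords \<G> v v" and \<xi>: "\<xi> \<in> boundary \<G> S v" and \<eta>: "\<eta> \<in> boundary \<G> S v" "reduces_to \<G> S v w \<xi> \<eta>"
  shows "boundary_action \<G> S v (weq_rel \<G> v `` {w}) \<xi> = \<eta>"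
proof -
  have "(THE \<eta>. \<eta> \<in> boundary \<G> S v \<and> (\<forall>w'\<in>weq_rel \<G> v `` {w}. reduces_to \<G> S v w' \<xi> \<eta>)) = \<eta>"
  proof (rule the_equality)
    show "\<eta> \<in> boundary \<G> S v \<and> (\<forall>w'\<in>weq_rel \<G> v `` {w}. reduces_to \<G> S v w' \<xi> \<eta>)"
      using \<eta> reduces_to_weq[OF _ w \<xi>] by (auto simp: weq_rel_def)
    have "w \<in> weq_rel \<G> v `` {w}" using w weq.refl[OF w] by (auto simp: weq_rel_def)
    then show "\<eta>' \<in> boundary \<G> S v \<and> (\<forall>w'\<in>weq_rel \<G> v `` {w}. reduces_to \<G> S v w' \<xi> \<eta>') \<Longrightarrow> \<eta>' = \<eta>" for \<eta>'
      using reduces_to_unique \<eta> by blast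
  qed
  then show ?thesis using \<xi> by (simp add: boundary_action_def)
qed

lemma follows_along:
  assumes "\<xi> \<in> boundary \<G> S x"
  shows "follows\<^sup>*\<^sup>* (snd (\<xi> n)) (snd (\<xi> (n + k)))"
proof (induction k)
  case (Suc k)
  then show ?case using boundary_follows[OF assms, of "n + k"] by simp
qed simp

text \<open>An image of \<xi> in the cylinder runs from the last edge of \<mu> into edges of \<xi>.
  Conversely, \<mu> is extended to a path that ends in the edge of \<open>\<xi> k\<close>, and a
  group element exchanging initial segments carries \<xi> into the cylinder.\<close>

lemma orbit_meets_cylinder:
  assumes \<xi>: "\<xi> \<in> boundary \<G> S v" and \<mu>: "\<mu> \<in> reduced_gpaths \<G> S v" "\<mu> \<noteq> []"
  shows "orbit (pi1 \<G> v) (boundary_action \<G> S v) \<xi> \<inter> cylinder \<G> S v \<mu> \<noteq> {} \<longleftrightarrow>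
    (\<exists>k. follows\<^sup>*\<^sup>* (snd (last \<mu>)) (snd (\<xi> k)))"
proof
  assume "orbit (pi1 \<G> v) (boundary_action \<G> S v) \<xi> \<inter> cylinder \<G> S v \<mu> \<noteq> {}"
  then obtain w where w: "w \<in> gwords \<G> v v"
    and cyl: "boundary_action \<G> S v (weq_rel \<G> v `` {w}) \<xi> \<in> cylinder \<G> S v \<mu>"
    by (auto simp: orbit_def pi1_def quotient_def)
  obtain \<eta> a b where \<eta>: "\<eta> \<in> boundary \<G> S v" "reduces_to \<G> S v w \<xi> \<eta>" "\<And>n. snd (\<eta> (a + n)) = snd (\<xi> (b + n))"
    using reduces_to_exists[OF \<xi> w] by blast
  have "map \<eta> [0..<length \<mu>] = \<mu>"
    using cyl boundary_action_eq[OF w \<xi> \<eta>(1,2)] by (simp add: cylinder_def)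
  then have "last \<mu> = \<eta> (length \<mu> - 1)"
    using \<mu>(2) by (metis diff_less last_conv_nth length_greater_0_conv nth_map_upt zero_less_one add.left_neutral diff_zero)
  \<comment> \<open>The index is chosen to equal \<open>a + length \<mu>\<close>, which is past the
    end of \<mu> and in the range where \<eta> has the edges of \<xi>.\<close>
  then have "follows\<^sup>*\<^sup>* (snd (last \<mu>)) (snd (\<eta> (length \<mu> - 1 + (a + 1))))"
    using follows_along[OF \<eta>(1), of "length \<mu> - 1" "a + 1"] by (simp only:)
  moreover have "length \<mu> - 1 + (a + 1) = a + length \<mu>" using \<mu>(2) by (cases \<mu>) auto
  ultimately show "\<exists>k. follows\<^sup>*\<^sup>* (snd (last \<mu>)) (snd (\<xi> k))" using \<eta>(3) by metis
next
  assume "\<exists>k. follows\<^sup>*\<^sup>* (snd (last \<mu>)) (snd (\<xi> k))"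
  then obtain k where k: "follows\<^sup>*\<^sup>* (snd (last \<mu>)) (snd (\<xi> k))" ..
  obtain \<nu>' where "\<mu> @ \<nu>' \<in> reduced_gpaths \<G> S v \<and> snd (last (\<mu> @ \<nu>')) = snd (\<xi> k)"
    using extend_path[OF k \<mu>] by blast
  moreover define \<nu> where "\<nu> = \<mu> @ \<nu>'"
  ultimately have \<nu>: "\<nu> \<in> reduced_gpaths \<G> S v" "\<nu> \<noteq> []" "snd (last \<nu>) = snd (\<xi> k)" using \<mu> by auto
  obtain \<eta> where \<eta>: "\<eta> \<in> cylinder \<G> S v \<nu>" "\<forall>n. \<eta> (length \<nu> + n) = \<xi> (k + Suc n)"
    using glue[OF \<nu>(1,2) boundary_shift[OF \<xi>, of k]] \<nu>(3) by auto
  have \<eta>b: "\<eta> \<in> boundary \<G> S v" and \<eta>\<nu>: "map \<eta> [0..<length \<nu>] = \<nu>" using \<eta>(1) by (auto simp: cylinder_def)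
  have "\<eta> \<in> cylinder \<G> S v \<mu>"
  proof -
    have "take (length \<mu>) (map \<eta> [0..<length \<nu>]) = \<mu>" unfolding \<eta>\<nu> by (simp add: \<nu>_def)
    then show ?thesis using \<eta>b by (simp add: cylinder_def take_map \<nu>_def)
  qed
  moreover have "\<eta> \<in> orbit (pi1 \<G> v) (boundary_action \<G> S v) \<xi>"
  proof -
    define z where "z = s (snd (\<xi> k))"
    let ?t = "(v, map \<xi> [0..<Suc k], \<one>\<^bsub>G z\<^esub>)" and ?n = "(v, \<nu>, \<one>\<^bsub>G z\<^esub>)"
    have "chain_src \<G> v (map \<xi> [0..<Suc k]) = z" by (simp add: chain_src_def z_def)
    then have t: "?t \<in> gwords \<G> v z" using prefix_gwords(1)[OF \<xi>, of "Suc k"] by (simp add: word_of_chain_def)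
    have z: "z \<in> verts \<G>" using gwords_verts[OF t] by simp
    obtain y where "gchain \<G> v \<nu> y" using \<nu>(1) by (auto simp: reduced_gpaths_iff)
    then have "gchain \<G> v \<nu> z" using gchain_last[of v \<nu> y] \<nu> z_def by simp
    then have n: "?n \<in> gwords \<G> v z" using z by (simp add: gwords_iff)
    obtain u where u: "u \<in> gwords \<G> z v" "weq \<G> (wconcat \<G> u ?t) (z, [], \<one>\<^bsub>G z\<^esub>)"
      using left_inverse_word[OF t] by blast
    \<comment> \<open>The group element is \<nu> times an inverse of the first \<open>Suc k\<close>
      letters of \<xi>; the two have the same source because \<nu> ends in the edge of
      \<open>\<xi> k\<close>.\<close>
    define w where "w = wconcat \<G> ?n u"
    have w: "w \<in> gwords \<G> v v" unfolding w_def by (rule wconcat_closed[OF n u(1)])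
    have "reduces_to \<G> S v w \<xi> \<eta>"
      unfolding reduces_to_def
    proof (intro allI eventually_sequentiallyI)
      fix n m assume m: "Suc k + n \<le> m"
      define p where "p = map \<xi> [Suc k..<m]"
      define y where "y = chain_src \<G> v (map \<xi> [0..<m])"
      have split: "map \<xi> [0..<m] = map \<xi> [0..<Suc k] @ p"
        unfolding p_def map_append[symmetric] using m upt_add_eq_append[of 0 "Suc k" "m - Suc k"] by simp
      have tm: "(v, map \<xi> [0..<Suc k] @ p, \<one>\<^bsub>G y\<^esub>) \<in> gwords \<G> v y"
        using prefix_gwords(1)[OF \<xi>, of m] by (simp add: word_of_chain_def y_def split)
      then obtain x where x: "gchain \<G> v (map \<xi> [0..<Suc k]) x" "gchain \<G> x p y"
        unfolding gwords_iff gchain_append by blast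
      moreover have "x = z" using gchain_end_unique[OF x(1)] t unfolding gwords_iff by blast
      ultimately have p: "(z, p, \<one>\<^bsub>G y\<^esub>) \<in> gwords \<G> z y"
        using gchain_verts[OF x(2)] by (simp add: gwords_iff)
      have concat: "wconcat \<G> (v, o', \<one>\<^bsub>G z\<^esub>) (z, p, \<one>\<^bsub>G y\<^esub>) = (v, o' @ p, \<one>\<^bsub>G y\<^esub>)" for o'
        using p gwords_verts[OF p] by (cases p) (auto simp: gwords_iff)
      have wc: "word_of_chain \<G> v (map \<xi> [0..<m]) = wconcat \<G> ?t (z, p, \<one>\<^bsub>G y\<^esub>)"
        by (simp only: word_of_chain_def y_def[symmetric] concat split[symmetric])
      have 1: "wconcat \<G> w (word_of_chain \<G> v (map \<xi> [0..<m])) = wconcat \<G> ?n (wconcat \<G> (wconcat \<G> u ?t) (z, p, \<one>\<^bsub>G y\<^esub>))"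
        by (simp only: wc w_def wconcat_assoc[OF n u(1) wconcat_closed[OF t p]] wconcat_assoc[OF u(1) t p])
      have ut: "wconcat \<G> u ?t \<in> gwords \<G> z z" by (rule wconcat_closed[OF u(1) t])
      have "weq \<G> (wconcat \<G> ?n (wconcat \<G> (wconcat \<G> u ?t) (z, p, \<one>\<^bsub>G y\<^esub>)))
         (wconcat \<G> ?n (wconcat \<G> (z, [], \<one>\<^bsub>G z\<^esub>) (z, p, \<one>\<^bsub>G y\<^esub>)))"
        by (rule weq_concat_left[OF weq_concat_right[OF u(2) ut p] wconcat_closed[OF ut p] n])
      \<comment> \<open>Multiplication by \<open>w\<close> replaces the first \<open>Suc k\<close>
        letters of the prefix by \<nu>. The outcome is a prefix of \<eta>, hence already
        reduced.\<close>
      then have 2: "weq \<G> (wconcat \<G> w (word_of_chain \<G> v (map \<xi> [0..<m]))) (v, \<nu> @ p, \<one>\<^bsub>G y\<^esub>)"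
        unfolding 1 wconcat_one_left[OF p] concat .
      have np: "(v, \<nu> @ p, \<one>\<^bsub>G y\<^esub>) \<in> gwords \<G> v y"
        using wconcat_closed[OF n p] by (simp add: concat)
      have \<eta>p: "\<nu> @ p = map \<eta> [0..<length \<nu> + (m - Suc k)]"
      proof (rule nth_equalityI)
        fix i assume i: "i < length (\<nu> @ p)"
        show "(\<nu> @ p) ! i = map \<eta> [0..<length \<nu> + (m - Suc k)] ! i"
        proof (cases "i < length \<nu>")
          case True
          then show ?thesis using arg_cong[OF \<eta>\<nu>, of "\<lambda>x. x ! i"] by (simp add: nth_append)
        next
          case False
          then show ?thesis using i spec[OF \<eta>(2), of "i - length \<nu>"] by (simp add: nth_append p_def)
        qed
      qed (simp add: p_def)
      then have "red (\<nu> @ p)" using prefix_gwords(2)[OF \<eta>b] by simp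
      then have "reduced_form \<G> S (wconcat \<G> w (word_of_chain \<G> v (map \<xi> [0..<m]))) = (v, \<nu> @ p, \<one>\<^bsub>G y\<^esub>)"
        unfolding reduced_form_weq[OF 2] by (rule reduced_form_red[OF np])
      then show "case reduced_form \<G> S (wconcat \<G> w (word_of_chain \<G> v (map \<xi> [0..<m]))) of
          (x, p, g) \<Rightarrow> take n p = map \<eta> [0..<n]"
        using m by (simp add: \<eta>p take_map)
    qed
    then have "boundary_action \<G> S v (weq_rel \<G> v `` {w}) \<xi> = \<eta>"
      by (rule boundary_action_eq[OF w \<xi> \<eta>b])
    then show ?thesis using w unfolding orbit_def pi1_def quotient_def by auto
  qed
  ultimately show "orbit (pi1 \<G> v) (boundary_action \<G> S v) \<xi> \<inter> cylinder \<G> S v \<mu> \<noteq> {}" by blast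
qed

text \<open>If \<open>bar e\<close> is the only edge with range \<open>s e\<close>, nonsingularity
  makes its index greater than one, so a nontrivial group element permits backtracking.\<close>

lemma successor_exists:
  assumes ns: "nonsingular_gog \<G>" and e: "e \<in> edges \<G>"
  shows "\<exists>f. follows e f"
proof (cases "\<exists>f\<in>edges \<G>. r f = s e \<and> f \<noteq> bar e")
  case True
  then show ?thesis using e by (auto simp: follows_def)
next
  case False
  let ?e = "bar e"
  have "{f \<in> edges \<G>. r f = r ?e} = {?e}" using False e by auto
  then have idx: "infinite (emb_cosets \<G> ?e) \<or> card (emb_cosets \<G> ?e) > 1"
    using ns e by (simp add: nonsingular_gog_def)
  have "\<not> emb_surj \<G> ?e"
  proof
    assume "emb_surj \<G> ?e"
    then have im: "emb_image \<G> ?e = carrier (G (r ?e))" by (simp add: emb_surj_def)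
    interpret group "G (r ?e)" using e by simp
    have "a <#\<^bsub>G (r ?e)\<^esub> carrier (G (r ?e)) = carrier (G (r ?e))" if "a \<in> carrier (G (r ?e))" for a
    proof
      show "carrier (G (r ?e)) \<subseteq> a <#\<^bsub>G (r ?e)\<^esub> carrier (G (r ?e))"
      proof
        fix x assume "x \<in> carrier (G (r ?e))"
        moreover from this have "x = a \<otimes>\<^bsub>G (r ?e)\<^esub> (inv\<^bsub>G (r ?e)\<^esub> a \<otimes>\<^bsub>G (r ?e)\<^esub> x)"
          using that by (simp flip: m_assoc)
        ultimately show "x \<in> a <#\<^bsub>G (r ?e)\<^esub> carrier (G (r ?e))"
          unfolding l_coset_def using that by blast
      qed
    qed (use that in \<open>auto simp: l_coset_def\<close>)
    then have "emb_cosets \<G> ?e \<subseteq> {carrier (G (r ?e))}"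
      unfolding emb_cosets_def im LCOSETS_def by auto
    then have "finite (emb_cosets \<G> ?e)" "card (emb_cosets \<G> ?e) \<le> 1"
      using finite_subset card_mono[of "{carrier (G (r ?e))}"] by auto
    then show False using idx by simp
  qed
  then show ?thesis using e by (intro exI[of _ "bar e"]) (simp add: follows_def)
qed

lemma cylinder_nonempty:
  assumes ns: "nonsingular_gog \<G>" and \<mu>: "\<mu> \<in> reduced_gpaths \<G> S v" "\<mu> \<noteq> []"
  shows "cylinder \<G> S v \<mu> \<noteq> {}"
proof -
  obtain z where z: "gchain \<G> v \<mu> z" using \<mu> by (auto simp: reduced_gpaths_iff)
  have last: "snd (last \<mu>) \<in> edges \<G>"
    using gchain_edges[OF z, of "length \<mu> - 1"] \<mu>(2) by (simp add: last_conv_nth)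
  \<comment> \<open>Dependent choice fixes no starting point by itself; the clause for
    \<open>n = 0\<close> makes the chain begin with the last edge of \<mu>.\<close>
  have "\<exists>f. \<forall>n. (f n \<in> edges \<G> \<and> (n = 0 \<longrightarrow> f n = snd (last \<mu>))) \<and> follows (f n) (f (Suc n))"
  proof (rule dependent_nat_choice)
    show "\<exists>x. x \<in> edges \<G> \<and> ((0::nat) = 0 \<longrightarrow> x = snd (last \<mu>))" using last by blast
    show "\<exists>y. (y \<in> edges \<G> \<and> (Suc n = 0 \<longrightarrow> y = snd (last \<mu>))) \<and> follows x y"
      if "x \<in> edges \<G> \<and> (n = 0 \<longrightarrow> x = snd (last \<mu>))" for x and n :: nat
      using successor_exists[OF ns, of x] that by (auto simp: follows_def)
  qed
  then obtain f where f: "f 0 = snd (last \<mu>)" "\<And>n. follows (f n) (f (Suc n))" by blast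
  obtain \<xi> where \<xi>: "\<xi> \<in> boundary \<G> S (r (f 0))" "\<forall>n. snd (\<xi> n) = f n"
    using chain_lift[of f, OF f(2)] by blast
  have "snd (\<xi> 0) = snd (last \<mu>)" using \<xi>(2) f(1) by simp
  then show ?thesis using glue[OF \<mu> \<xi>(1)] by blast
qed

section \<open>The topology of the boundary and a criterion for minimality\<close>

lemma topspace_boundary:
  assumes "v \<in> verts \<G>"
  shows "topspace (boundary_topology \<G> S v) = boundary \<G> S v"
proof -
  have "[] \<in> reduced_gpaths \<G> S v" using assms by (auto simp: reduced_gpaths_iff)
  moreover have "cylinder \<G> S v [] = boundary \<G> S v" by (auto simp: cylinder_def)
  ultimately have "boundary \<G> S v \<subseteq> \<Union> {cylinder \<G> S v \<mu> | \<mu>. \<mu> \<in> reduced_gpaths \<G> S v}" by blast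
  moreover have "\<Union> {cylinder \<G> S v \<mu> | \<mu>. \<mu> \<in> reduced_gpaths \<G> S v} \<subseteq> boundary \<G> S v"
    by (auto simp: cylinder_def)
  ultimately have "\<Union> {cylinder \<G> S v \<mu> | \<mu>. \<mu> \<in> reduced_gpaths \<G> S v} = boundary \<G> S v" by simp
  then show ?thesis by (simp add: boundary_topology_def)
qed

lemma openin_cylinder: "\<mu> \<in> reduced_gpaths \<G> S v \<Longrightarrow> openin (boundary_topology \<G> S v) (cylinder \<G> S v \<mu>)"
  unfolding boundary_topology_def by (rule topology_generated_by_Basis) blast

lemma cylinder_prefix_mono:
  "m \<le> n \<Longrightarrow> cylinder \<G> S v (map \<xi> [0..<n]) \<subseteq> cylinder \<G> S v (map \<xi> [0..<m])"
proof
  fix \<eta> assume "m \<le> n" "\<eta> \<in> cylinder \<G> S v (map \<xi> [0..<n])"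
  then have "\<eta> \<in> boundary \<G> S v" "map \<eta> [0..<n] = map \<xi> [0..<n]"
    unfolding cylinder_def by simp_all
  then have "\<eta> \<in> boundary \<G> S v" "take m (map \<eta> [0..<n]) = take m (map \<xi> [0..<n])"
    by (simp_all only:)
  then show "\<eta> \<in> cylinder \<G> S v (map \<xi> [0..<m])" using \<open>m \<le> n\<close> by (simp add: cylinder_def take_map)
qed

lemma openin_contains_cylinder:
  assumes "openin (boundary_topology \<G> S v) U" "\<xi> \<in> U"
  shows "\<exists>n. cylinder \<G> S v (map \<xi> [0..<n]) \<subseteq> U"
proof -
  have "generate_topology_on {cylinder \<G> S v \<mu> | \<mu>. \<mu> \<in> reduced_gpaths \<G> S v} U"
    using assms(1) unfolding boundary_topology_def by (simp add: openin_topology_generated_by_iff)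
  then show ?thesis using assms(2)
  proof (induction rule: generate_topology_on.induct)
    case (Int a b)
    then obtain m n where "cylinder \<G> S v (map \<xi> [0..<m]) \<subseteq> a" "cylinder \<G> S v (map \<xi> [0..<n]) \<subseteq> b" by auto
    then show ?case
      using cylinder_prefix_mono[of m "max m n" v \<xi>] cylinder_prefix_mono[of n "max m n" v \<xi>]
      by (intro exI[of _ "max m n"]) auto
  next
    case (UN K)
    then show ?case by blast
  next
    case (Basis c)
    then obtain \<mu> where "c = cylinder \<G> S v \<mu>" by auto
    moreover from this have "map \<xi> [0..<length \<mu>] = \<mu>" using Basis by (auto simp: cylinder_def)
    ultimately show ?case by (intro exI[of _ "length \<mu>"]) simp
  qed auto
qed

lemma minimal_action_iff:
  assumes ns: "nonsingular_gog \<G>" and v: "v \<in> verts \<G>"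
  shows "minimal_action (pi1 \<G> v) (boundary_topology \<G> S v) (boundary_action \<G> S v) \<longleftrightarrow>
    (\<forall>\<xi>\<in>boundary \<G> S v. \<forall>\<mu>\<in>reduced_gpaths \<G> S v. \<mu> \<noteq> [] \<longrightarrow> (\<exists>k. follows\<^sup>*\<^sup>* (snd (last \<mu>)) (snd (\<xi> k))))"
    (is "?l \<longleftrightarrow> ?r")
proof
  assume l: ?l
  show ?r
  proof (intro ballI impI)
    fix \<xi> \<mu> assume \<xi>: "\<xi> \<in> boundary \<G> S v" and \<mu>: "\<mu> \<in> reduced_gpaths \<G> S v" "\<mu> \<noteq> []"
    obtain \<eta> where \<eta>: "\<eta> \<in> cylinder \<G> S v \<mu>" using cylinder_nonempty[OF ns \<mu>] by blast
    then have "\<eta> \<in> boundary_topology \<G> S v closure_of orbit (pi1 \<G> v) (boundary_action \<G> S v) \<xi>"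
      using l \<xi> by (simp add: minimal_action_def topspace_boundary[OF v] cylinder_def)
    then have "\<exists>y. y \<in> orbit (pi1 \<G> v) (boundary_action \<G> S v) \<xi> \<and> y \<in> cylinder \<G> S v \<mu>"
      using openin_cylinder[OF \<mu>(1)] \<eta> unfolding in_closure_of by blast
    then show "\<exists>k. follows\<^sup>*\<^sup>* (snd (last \<mu>)) (snd (\<xi> k))"
      using orbit_meets_cylinder[OF \<xi> \<mu>] by blast
  qed
next
  assume r: ?r
  show ?l
    unfolding minimal_action_def topspace_boundary[OF v]
  proof (intro ballI equalityI subsetI)
    fix \<xi> \<eta> assume \<xi>: "\<xi> \<in> boundary \<G> S v" and \<eta>: "\<eta> \<in> boundary \<G> S v"
    show "\<eta> \<in> boundary_topology \<G> S v closure_of orbit (pi1 \<G> v) (boundary_action \<G> S v) \<xi>"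
      unfolding in_closure_of topspace_boundary[OF v]
    proof (intro conjI allI impI \<eta>)
      fix T assume T: "\<eta> \<in> T \<and> openin (boundary_topology \<G> S v) T"
      obtain n where n: "cylinder \<G> S v (map \<eta> [0..<n]) \<subseteq> T"
        using openin_contains_cylinder T by blast
      \<comment> \<open>One letter more than the inclusion in \<open>T\<close> asks for, so that the
        path is nonempty and has a last edge.\<close>
      let ?\<mu> = "map \<eta> [0..<Suc n]"
      have \<mu>: "?\<mu> \<in> reduced_gpaths \<G> S v" "?\<mu> \<noteq> []" using \<eta> unfolding boundary_def by (blast, simp)
      have "orbit (pi1 \<G> v) (boundary_action \<G> S v) \<xi> \<inter> cylinder \<G> S v ?\<mu> \<noteq> {}"
        using orbit_meets_cylinder[OF \<xi> \<mu>] r \<xi> \<mu> by blast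
      then show "\<exists>y. y \<in> orbit (pi1 \<G> v) (boundary_action \<G> S v) \<xi> \<and> y \<in> T"
        using n cylinder_prefix_mono[of n "Suc n" v \<eta>, OF le_SucI[OF order_refl]] by blast
    qed
  next
    fix \<xi> \<eta> assume "\<eta> \<in> boundary_topology \<G> S v closure_of orbit (pi1 \<G> v) (boundary_action \<G> S v) \<xi>"
    then show "\<eta> \<in> boundary \<G> S v" unfolding in_closure_of topspace_boundary[OF v] by blast
  qed
qed

section \<open>Closed sets of edges\<close>

definition closed_arcs :: "'e set \<Rightarrow> bool" where
  "closed_arcs D \<longleftrightarrow> D \<subseteq> edges \<G> \<and> (\<forall>c\<in>D. \<forall>g. follows c g \<longrightarrow> g \<in> D)"

lemma closed_arcs_reach: "closed_arcs D \<Longrightarrow> c \<in> D \<Longrightarrow> follows\<^sup>*\<^sup>* c d \<Longrightarrow> d \<in> D"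
  by (rotate_tac 2, induction rule: rtranclp_induct) (auto simp: closed_arcs_def)

lemma closed_arcs_reachable: "e \<in> edges \<G> \<Longrightarrow> closed_arcs {c. follows\<^sup>*\<^sup>* e c}"
proof -
  assume e: "e \<in> edges \<G>"
  have "c \<in> edges \<G>" if "follows\<^sup>*\<^sup>* e c" for c
    using that e by (induction rule: rtranclp_induct) (auto simp: follows_def)
  then show ?thesis by (auto simp: closed_arcs_def)
qed

text \<open>Reversal turns chains around. The exceptional case is its own mirror image:
  \<open>f = bar e\<close> is the same as \<open>bar e = bar (bar f)\<close>.\<close>

lemma follows_bar: "follows e f \<Longrightarrow> follows (bar f) (bar e)"
  unfolding follows_def by (metis graph_simps(3,6,7,8))

lemma follows_intro: "e \<in> edges \<G> \<Longrightarrow> f \<in> edges \<G> \<Longrightarrow> r f = s e \<Longrightarrow> f \<noteq> bar e \<Longrightarrow> follows e f"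
  by (simp add: follows_def)

lemma gpath_follows:
  assumes "gpath \<G> x p z" "reduced_path \<G> p"
  shows "successively follows p"
  using assms
proof (induction p arbitrary: x)
  case (Cons e p)
  then have "p \<noteq> [] \<Longrightarrow> follows e (hd p)"
    by (cases p) (auto simp: reduced_path_Cons intro: follows_intro)
  then show ?case using Cons by (auto simp: successively_Cons reduced_path_Cons)
qed simp

text \<open>Successors of edges in \<open>D\<close> lie in \<open>D\<close>, so predecessors of
  edges outside \<open>D\<close> lie outside: chains in the complement can be extended
  backwards.\<close>

lemma prepend_path:
  assumes D: "closed_arcs D" and f: "\<And>n. follows (f n) (f (Suc n))" "\<And>n. f n \<notin> D"
    and p: "successively follows (p @ [f 0])"
  shows "\<exists>f'. (\<forall>n. follows (f' n) (f' (Suc n))) \<and> (\<forall>n. f' n \<notin> D) \<and> f' 0 = hd (p @ [f 0])"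
  using p
proof (induction p)
  case Nil
  then show ?case using f by (intro exI[of _ f]) auto
next
  case (Cons c p)
  then obtain f' where f': "\<And>n. follows (f' n) (f' (Suc n))" "\<And>n. f' n \<notin> D" "f' 0 = hd (p @ [f 0])"
    by (auto simp: successively_Cons)
  have c: "follows c (f' 0)" using Cons.prems f'(3) by (simp add: successively_Cons)
  then have "c \<notin> D" using f'(2) D by (auto simp: closed_arcs_def)
  then have "\<forall>n. follows (case_nat c f' n) (case_nat c f' (Suc n))" "\<forall>n. case_nat c f' n \<notin> D"
    using f' c by (auto split: nat.split)
  then show ?case by (intro exI[of _ "case_nat c f'"]) simp
qed

text \<open>Moves the start of an avoiding chain to any vertex \<open>y\<close>. If the path from
  \<open>y\<close> ends with the reversal of \<open>f 0\<close>, both edges are dropped and the path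
  gets shorter; otherwise path and chain fit together and \<open>prepend_path\<close>
  applies.\<close>

lemma avoiding_chain:
  assumes D: "closed_arcs D" and f: "\<And>n. follows (f n) (f (Suc n))" "\<And>n. f n \<notin> D" and y: "y \<in> verts \<G>"
  shows "\<exists>f'. (\<forall>n. follows (f' n) (f' (Suc n))) \<and> (\<forall>n. f' n \<notin> D) \<and> r (f' 0) = y"
proof -
  have edge: "f n \<in> edges \<G>" for n using f(1)[of n] by (simp add: follows_def)
  obtain q where "gpath \<G> y q (r (f 0))"
    using connected y graph_simps(1)[OF edge[of 0]] unfolding connected_sgraph_def by blast
  then obtain p where "gpath \<G> y p (r (f 0))" "reduced_path \<G> p"
    using rpath_exists[of y q "r (f 0)"] unfolding rpaths_def by blast
  then show ?thesis using f
  proof (induction p arbitrary: f rule: rev_induct)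
    case Nil
    then show ?case by (intro exI[of _ f]) auto
  next
    case (snoc c p)
    have c: "c \<in> edges \<G>" "gpath \<G> y p (r c)" "s c = r (f 0)" "reduced_path \<G> p"
      using snoc.prems by (auto simp: gpath_snoc reduced_path_append)
    show ?case
    proof (cases "f 0 = bar c")
      case True
      have "r (f (Suc 0)) = s (f 0)" using snoc.prems(3)[of 0] by (simp add: follows_def)
      then have "r (f (Suc 0)) = r c" using True c(1) by simp
      then show ?thesis using snoc.IH[of "\<lambda>n. f (Suc n)"] c snoc.prems(3,4) by simp
    next
      case False
      have "follows c (f 0)" using False c snoc.prems(3)[of 0] by (auto simp: follows_def)
      then have "successively follows ((p @ [c]) @ [f 0])"
        using gpath_follows[OF snoc.prems(1,2)] by (simp add: successively_append_iff)
      then obtain f' where f': "\<forall>n. follows (f' n) (f' (Suc n))" "\<forall>n. f' n \<notin> D" "f' 0 = hd ((p @ [c]) @ [f 0])"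
        using prepend_path[of D f "p @ [c]"] D snoc.prems(3,4) by blast
      moreover have "r (hd ((p @ [c]) @ [f 0])) = y"
        using snoc.prems(1) by (cases p) auto
      ultimately show ?thesis by metis
    qed
  qed
qed

lemma reaching_path:
  assumes e: "follows\<^sup>*\<^sup>* e d" "e \<in> edges \<G>"
  shows "\<exists>\<mu>\<in>reduced_gpaths \<G> S (r e). \<mu> \<noteq> [] \<and> snd (last \<mu>) = d"
proof -
  let ?\<mu> = "[(\<one>\<^bsub>G (r e)\<^esub>, e)]"
  have "?\<mu> \<in> reduced_gpaths \<G> S (r e)"
    using e(2) one_transversal by (auto simp: reduced_gpaths_iff red_Cons)
  then obtain \<nu> where "?\<mu> @ \<nu> \<in> reduced_gpaths \<G> S (r e)" "snd (last (?\<mu> @ \<nu>)) = d"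
    using extend_path[of ?\<mu> d "r e"] e(1) by auto
  then show ?thesis by blast
qed

lemma successively_reach: "successively follows (c # p) \<Longrightarrow> follows\<^sup>*\<^sup>* c (last (c # p))"
proof (induction p arbitrary: c)
  case (Cons d p)
  then have "follows c d" "follows\<^sup>*\<^sup>* d (last (d # p))" by simp_all
  then show ?case by (metis converse_rtranclp_into_rtranclp last.simps list.distinct(1))
qed simp

text \<open>Either a reduced path from \<open>v\<close> to \<open>s e\<close> ends in
  \<open>e\<close>, or \<open>e\<close> followed by the reversed path is reduced and so stays in
  \<open>D\<close> until it arrives at \<open>v\<close>. In the latter case one more successor lies
  in \<open>D\<close> and has range \<open>v\<close>.\<close>

lemma path_into_closed:
  assumes ns: "nonsingular_gog \<G>" and v: "v \<in> verts \<G>" and D: "closed_arcs D" and e: "e \<in> D"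
  shows "\<exists>\<mu>\<in>reduced_gpaths \<G> S v. \<mu> \<noteq> [] \<and> snd (last \<mu>) \<in> D"
proof -
  have ee: "e \<in> edges \<G>" using e D by (auto simp: closed_arcs_def)
  obtain q where "gpath \<G> v q (s e)"
    using connected v graph_simps(2)[OF ee] unfolding connected_sgraph_def by blast
  then obtain p where p: "gpath \<G> v p (s e)" "reduced_path \<G> p"
    using rpath_exists[of v q "s e"] unfolding rpaths_def by blast
  show ?thesis
  proof (cases "p \<noteq> [] \<and> last p = e")
    case True
    then obtain c q where cq: "p = c # q" by (cases p) auto
    have "follows\<^sup>*\<^sup>* c e" using successively_reach[of c q] gpath_follows[OF p] True cq by simp
    then show ?thesis using reaching_path[of c e] p e by (auto simp: cq)
  next
    case False
    let ?q = "e # rev (map bar p)"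
    have q: "gpath \<G> (r e) ?q v" using gpath_rev[OF p(1)] ee by simp
    have red: "reduced_path \<G> ?q"
    proof -
      have "hd (rev (map bar p)) \<noteq> bar e" if "p \<noteq> []"
      proof -
        have "last p \<in> edges \<G>" using that gpath_edges[OF p(1)] by auto
        moreover have "hd (rev (map bar p)) = bar (last p)" using that by (simp add: hd_rev last_map)
        ultimately show ?thesis using False that ee graph_simps(6) by metis
      qed
      then show ?thesis using reduced_path_rev[OF gpath_edges[OF p(1)] p(2)] by (auto simp: reduced_path_Cons)
    qed
    have "?q = butlast ?q @ [last ?q]" by (rule append_butlast_last_id[symmetric]) simp
    then have "gpath \<G> (r e) (butlast ?q @ [last ?q]) v" using q by metis
    moreover have "follows\<^sup>*\<^sup>* e (last ?q)"
      by (rule successively_reach[OF gpath_follows[OF q red]])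
    ultimately have l: "last ?q \<in> D" "s (last ?q) = v"
      using closed_arcs_reach[OF D e] by (auto simp only: gpath_snoc)
    then obtain g where g: "follows (last ?q) g"
      using successor_exists[OF ns, of "last ?q"] D by (auto simp: closed_arcs_def)
    then have "g \<in> D" "r g = v" "g \<in> edges \<G>" using l D by (auto simp only: closed_arcs_def follows_def)
    then show ?thesis using reaching_path[of g g] by auto
  qed
qed

lemma not_minimal_iff:
  assumes ns: "nonsingular_gog \<G>" and v: "v \<in> verts \<G>"
  shows "\<not> minimal_action (pi1 \<G> v) (boundary_topology \<G> S v) (boundary_action \<G> S v) \<longleftrightarrow>
    (\<exists>D f. closed_arcs D \<and> D \<noteq> {} \<and> (\<forall>n. follows (f n) (f (Suc n))) \<and> (\<forall>n. f n \<notin> D))"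
    (is "\<not> ?l \<longleftrightarrow> ?r")
proof
  assume "\<not> ?l"
  then obtain \<xi> \<mu> where \<xi>: "\<xi> \<in> boundary \<G> S v" and \<mu>: "\<mu> \<in> reduced_gpaths \<G> S v" "\<mu> \<noteq> []"
    and no: "\<And>k. \<not> follows\<^sup>*\<^sup>* (snd (last \<mu>)) (snd (\<xi> k))"
    unfolding minimal_action_iff[OF assms] by blast
  obtain z where z: "gchain \<G> v \<mu> z" using \<mu> by (auto simp: reduced_gpaths_iff)
  have last: "snd (last \<mu>) \<in> edges \<G>"
    using gchain_edges[OF z, of "length \<mu> - 1"] \<mu>(2) by (simp add: last_conv_nth)
  show ?r
    using closed_arcs_reachable[OF last] boundary_follows[OF \<xi>] no
    by (intro exI[of _ "{c. follows\<^sup>*\<^sup>* (snd (last \<mu>)) c}"] exI[of _ "\<lambda>n. snd (\<xi> n)"]) auto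
next
  assume ?r
  then obtain D f where D: "closed_arcs D" "D \<noteq> {}" and f: "\<And>n. follows (f n) (f (Suc n))" "\<And>n. f n \<notin> D"
    by blast
  obtain f' where f': "\<And>n. follows (f' n) (f' (Suc n))" "\<And>n. f' n \<notin> D" "r (f' 0) = v"
    using avoiding_chain[of D f v] D(1) f v by blast
  obtain \<xi> where \<xi>: "\<xi> \<in> boundary \<G> S v" "\<And>n. snd (\<xi> n) = f' n"
    using chain_lift[of f', OF f'(1)] f'(3) by blast
  obtain \<mu> where \<mu>: "\<mu> \<in> reduced_gpaths \<G> S v" "\<mu> \<noteq> []" "snd (last \<mu>) \<in> D"
    using path_into_closed[OF ns v D(1)] D(2) by blast
  show "\<not> ?l"
    unfolding minimal_action_iff[OF assms]
    using \<xi> \<mu> f'(2) closed_arcs_reach[OF D(1) \<mu>(3)] by metis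
qed

section \<open>From treelike edges and cycles to closed sets of edges\<close>

definition treelike_at :: "'v \<Rightarrow> 'e set \<Rightarrow> bool" where
  "treelike_at x F \<longleftrightarrow> is_tree (upstream \<G> x F) \<and>
    (\<forall>f\<in>edges (upstream \<G> x F). points_towards (upstream \<G> x F) f x \<longrightarrow> emb_surj \<G> (bar f))"

lemma treelike_edge_iff:
  "treelike_edge \<G> e \<longleftrightarrow> treelike_at (s e) (if s e = r e then {e, bar e} else {bar e})"
  by (simp add: treelike_edge_def treelike_at_def upstream_edge_def)

lemma treelike_cycle_iff:
  "treelike_cycle \<G> \<eta> \<longleftrightarrow>
    (\<forall>j<length \<eta>. treelike_at (s (\<eta> ! j)) {\<eta> ! (Suc j mod length \<eta>), bar (\<eta> ! j)})"
  by (simp add: treelike_cycle_def treelike_at_def upstream_cycle_def)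

text \<open>With one edge the next index is again 0, so both definitions exclude \<open>e\<close>
  and its reversal. Case (a) thus becomes the cycle case for length one.\<close>

lemma treelike_loop: "s e = r e \<Longrightarrow> treelike_cycle \<G> [e] \<longleftrightarrow> treelike_edge \<G> e"
  by (simp add: treelike_edge_iff treelike_cycle_iff)

lemma treelike_surj:
  assumes "treelike_at x F" "x \<in> verts \<G>" "d \<in> upstream_arcs x F"
  shows "emb_surj \<G> (bar d)"
  using assms tree_points_towards[of x F d] by (auto simp: treelike_at_def edges_upstream)

text \<open>As \<alpha> is onto at the reversal of every edge of \<open>D\<close>, a successor never
  backtracks: it continues the cycle or an upstream path. The harder half is avoidance, for which
  upstream paths must not return to the cycle; this is the fact \<open>no\<close>.\<close>

lemma cycle_witness:
  assumes cyc: "minimal_cycle \<G> \<eta>" and surj: "\<And>f. f \<in> set \<eta> \<Longrightarrow> emb_surj \<G> (bar f)"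
    and tree: "treelike_cycle \<G> \<eta>"
  shows "\<exists>D f. closed_arcs D \<and> D \<noteq> {} \<and> (\<forall>n. follows (f n) (f (Suc n))) \<and> (\<forall>n. f n \<notin> D)"
proof -
  define L where "L = length \<eta>"
  define F where "F j = {\<eta> ! (Suc j mod L), bar (\<eta> ! j)}" for j
  define A where "A j = upstream_arcs (s (\<eta> ! j)) (F j)" for j
  have L: "0 < L" using minimal_cycle_nth(1)[OF cyc] by (simp add: L_def)
  have edge: "\<eta> ! i \<in> edges \<G>" if "i < L" for i using minimal_cycle_nth(2)[OF cyc] that by (simp add: L_def)
  have step: "s (\<eta> ! i) = r (\<eta> ! (Suc i mod L))" if "i < L" for i
    using minimal_cycle_nth(3)[OF cyc] that by (simp add: L_def)
  have red: "\<eta> ! (Suc i mod L) \<noteq> bar (\<eta> ! i)" if "i < L" for i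
    using minimal_cycle_nth(4)[OF cyc] that by (simp add: L_def)
  have inj: "i = j" if "i < L" "j < L" "r (\<eta> ! i) = r (\<eta> ! j)" for i j
    using minimal_cycle_nth(5)[OF cyc] that by (simp add: L_def)
  have mem: "c \<in> set \<eta> \<longleftrightarrow> (\<exists>i<L. c = \<eta> ! i)" for c by (auto simp: in_set_conv_nth L_def)
  have injs: "i = j" if "i < L" "j < L" "s (\<eta> ! i) = s (\<eta> ! j)" for i j
  proof -
    have "Suc i mod L = Suc j mod L" using inj[of "Suc i mod L" "Suc j mod L"] step that L by simp
    then show ?thesis using that by (auto simp: mod_Suc split: if_splits)
  qed
  have tl: "treelike_at (s (\<eta> ! j)) (F j)" if "j < L" for j
    using tree that by (simp add: treelike_cycle_iff F_def L_def)
  have acyc: "upstream_paths \<G> (s (\<eta> ! j)) (F j) (s (\<eta> ! j)) = {}" if "j < L" for j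
    using tree_no_upstream_cycle[of "s (\<eta> ! j)" "F j"] tl[OF that] edge[OF that] by (simp add: treelike_at_def)
  \<comment> \<open>Continued along the cycle, such a path would reach its root
    \<open>s (\<eta> ! j)\<close> again, which is impossible in a tree. Backtracking at the junction
    is removed by induction: deleting the last edge moves the meeting point one step on along the
    cycle, and a path of one edge would start with the excluded
    \<open>bar (\<eta> ! j)\<close>.\<close>
  have no: False if j: "j < L" and "i < L" "p \<in> upstream_paths \<G> (s (\<eta> ! j)) (F j) (s (\<eta> ! i))" for j i p
    using that(2,3)
  proof (induction p arbitrary: i rule: rev_induct)
    case Nil
    then show ?case by (simp add: upstream_paths_def)
  next
    case (snoc l q)
    let ?U = "upstream_paths \<G> (s (\<eta> ! j)) (F j)"
    show ?case
    proof (cases "l = bar (\<eta> ! (Suc i mod L))")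
      case True
      define i' where "i' = Suc i mod L"
      have i': "i' < L" using L by (simp add: i'_def)
      have rl: "r l = s (\<eta> ! i')" using True edge[OF i'] by (simp add: i'_def)
      show False
      proof (cases "q = []")
        case True
        then have "r l = s (\<eta> ! j)" "l \<notin> F j" using snoc.prems(2) unfolding upstream_paths_snoc by auto
        then have "i' = j" "l \<notin> F j" using injs[OF i' j] rl by auto
        then show False using \<open>l = _\<close> by (simp add: F_def i'_def)
      next
        case False
        then show False using snoc.IH[OF i'] snoc.prems(2) rl unfolding upstream_paths_snoc by simp
      qed
    next
      case False
      have "\<exists>p. p \<in> ?U (s (\<eta> ! ((i + n) mod L))) \<and> last p \<noteq> bar (\<eta> ! (Suc (i + n) mod L))" for n
      proof (induction n)
        case 0
        then show ?case using snoc.prems False by (intro exI[of _ "q @ [l]"]) simp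
      next
        case (Suc n)
        then obtain p where p: "p \<in> ?U (s (\<eta> ! ((i + n) mod L)))" "last p \<noteq> bar (\<eta> ! (Suc (i + n) mod L))" by blast
        define k where "k = Suc (i + n) mod L"
        have k: "k < L" using L by (simp add: k_def)
        have "s (\<eta> ! ((i + n) mod L)) = r (\<eta> ! k)" using step[of "(i + n) mod L"] L by (simp add: k_def mod_Suc_eq)
        moreover have "\<eta> ! k \<noteq> bar (last p)"
        proof
          assume "\<eta> ! k = bar (last p)"
          moreover have "last p \<in> edges \<G>" using upstream_arcs_last[OF p(1)] upstream_arcs_edges by blast
          ultimately show False using p(2) by (simp add: k_def)
        qed
        moreover have "p \<noteq> []" using p(1) by (auto simp: upstream_paths_def)
        ultimately have "p @ [\<eta> ! k] \<in> ?U (s (\<eta> ! k))"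
          unfolding upstream_paths_snoc using p(1) edge[OF k] by simp
        moreover have "\<eta> ! k \<noteq> bar (\<eta> ! (Suc k mod L))"
          using red[OF k] edge[OF k] edge[of "Suc k mod L"] L graph_simps(6) by (metis mod_less_divisor)
        ultimately show ?case
          by (intro exI[of _ "p @ [\<eta> ! k]"]) (simp add: k_def mod_Suc_eq)
      qed
      \<comment> \<open>This many steps lead from position \<open>i\<close> to position
        \<open>j\<close> modulo \<open>L\<close>; the difference is not truncated because
        \<open>i < L\<close>.\<close>
      from this[of "L - i + j"] show False using acyc[OF j] j snoc.prems(1) by simp
    qed
  qed
  define D where "D = set \<eta> \<union> (\<Union>j\<in>{..<L}. A j)"
  have surjD: "emb_surj \<G> (bar d)" if "d \<in> D" for d
    using that surj treelike_surj[OF tl] edge by (auto simp: D_def A_def)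
  have "closed_arcs D"
    unfolding closed_arcs_def
  proof (intro conjI ballI allI impI)
    show "D \<subseteq> edges \<G>" using edge upstream_arcs_edges by (auto simp: D_def A_def mem)
    fix c g assume c: "c \<in> D" and cg: "follows c g"
    have g: "g \<in> edges \<G>" "r g = s c" "g \<noteq> bar c"
      using cg surjD[OF c] by (auto simp: follows_def)
    show "g \<in> D"
    proof (cases "c \<in> set \<eta>")
      case True
      then obtain j where j: "j < L" "c = \<eta> ! j" by (auto simp: mem)
      show ?thesis
      proof (cases "g = \<eta> ! (Suc j mod L)")
        case True
        then have "g \<in> set \<eta>" using L by (simp add: L_def)
        then show ?thesis by (simp add: D_def)
      next
        case False
        then have "g \<in> A j" unfolding A_def using upstream_arcs_start[of g _ "F j"] g j by (simp add: F_def)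
        then show ?thesis using j by (auto simp: D_def)
      qed
    next
      case False
      then obtain j where "j < L" "c \<in> A j" using c by (auto simp: D_def)
      then show ?thesis using upstream_arcs_step[of c _ _ g] g by (auto simp: D_def A_def)
    qed
  qed
  moreover have "D \<noteq> {}" using L by (auto simp: D_def L_def)
  moreover have avoid: "bar (\<eta> ! i) \<notin> D" if i: "i < L" for i
  proof
    assume "bar (\<eta> ! i) \<in> D"
    then consider k where "k < L" "bar (\<eta> ! i) = \<eta> ! k" | j where "j < L" "bar (\<eta> ! i) \<in> A j"
      by (auto simp: D_def mem)
    then show False
    proof cases
      case 1
      \<comment> \<open>Among the edges of the cycle only the one after \<open>\<eta> ! i\<close>
        has the range of \<open>bar (\<eta> ! i)\<close>, and the cycle does not backtrack.\<close>
      then have "r (\<eta> ! k) = r (\<eta> ! (Suc i mod L))" using step[OF i] edge[OF i] by (metis graph_simps(7))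
      then have "k = Suc i mod L" using inj 1 L by simp
      then show False using red[OF i] 1 by simp
    next
      case 2
      then obtain p where p: "p @ [bar (\<eta> ! i)] \<in> upstream_paths \<G> (s (\<eta> ! j)) (F j) (r (\<eta> ! i))"
        using edge[OF i] by (auto simp: A_def upstream_arcs_def)
      show False
      proof (cases "p = []")
        case True
        then have "s (\<eta> ! i) = s (\<eta> ! j)" "bar (\<eta> ! i) \<notin> F j"
          using p edge[OF i] unfolding upstream_paths_snoc by auto
        then show False using injs[OF i 2(1)] by (simp add: F_def)
      next
        case False
        then show False using p no[OF 2(1) i] edge[OF i] unfolding upstream_paths_snoc by auto
      qed
    qed
  qed
  moreover have "\<exists>f. \<forall>n. (\<exists>i<L. f n = bar (\<eta> ! i)) \<and> follows (f n) (f (Suc n))"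
  proof (rule dependent_nat_choice)
    show "\<exists>x. \<exists>i<L. x = bar (\<eta> ! i)" using L by blast
    fix x and n :: nat assume "\<exists>i<L. x = bar (\<eta> ! i)"
    then obtain i where i: "i < L" "x = bar (\<eta> ! i)" by blast
    \<comment> \<open>The cyclic predecessor of \<open>i\<close>, written with \<open>L - 1\<close>
      to avoid subtracting from 0.\<close>
    define k where "k = (i + (L - 1)) mod L"
    have k: "k < L" "Suc k mod L = i" using L i by (simp_all add: k_def mod_Suc_eq)
    have "follows (\<eta> ! k) (\<eta> ! i)"
      using step[OF k(1)] red[OF k(1)] edge[OF k(1)] edge[OF i(1)] k(2) by (intro follows_intro) auto
    then show "\<exists>y. (\<exists>i<L. y = bar (\<eta> ! i)) \<and> follows x y" using follows_bar i k(1) by blast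
  qed
  ultimately show ?thesis by metis
qed

text \<open>No edge of the set has source \<open>r e\<close>, since upstream paths do not reach that
  vertex; for the same reason \<xi> cannot begin in the set. If \<xi> entered it later without using
  \<open>e\<close>, the reversal of its initial part would run inside the set back to
  \<open>r e\<close>.\<close>

lemma bridge_witness:
  assumes e: "e \<in> edges \<G>" and surj: "emb_surj \<G> (bar e)" and nocyc: "\<And>\<eta>. minimal_cycle \<G> \<eta> \<Longrightarrow> e \<notin> set \<eta>"
    and tree: "treelike_edge \<G> e" and \<xi>: "\<xi> \<in> boundary \<G> S (r e)" "\<not> lies_on e \<xi>"
  shows "\<exists>D f. closed_arcs D \<and> D \<noteq> {} \<and> (\<forall>n. follows (f n) (f (Suc n))) \<and> (\<forall>n. f n \<notin> D)"
proof -
  have ne: "s e \<noteq> r e" using minimal_cycle_loop[OF e] nocyc by force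
  define A where "A = upstream_arcs (s e) {bar e}"
  define D where "D = insert e A"
  define f where "f n = snd (\<xi> n)" for n
  have tl: "treelike_at (s e) {bar e}" using tree ne by (simp add: treelike_edge_iff)
  have acyc: "upstream_paths \<G> (s e) {bar e} (s e) = {}"
    using tree_no_upstream_cycle[of "s e"] tl e by (simp add: treelike_at_def)
  have surjD: "emb_surj \<G> (bar d)" if "d \<in> D" for d
    using that surj treelike_surj[OF tl] e by (auto simp: D_def A_def)
  have closed: "closed_arcs D"
    unfolding closed_arcs_def
  proof (intro conjI ballI allI impI)
    show "D \<subseteq> edges \<G>" using e upstream_arcs_edges by (auto simp: D_def A_def)
    fix c g assume c: "c \<in> D" and cg: "follows c g"
    have g: "g \<in> edges \<G>" "r g = s c" "g \<noteq> bar c"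
      using cg surjD[OF c] by (auto simp: follows_def)
    show "g \<in> D"
      using c g upstream_arcs_start[of g _ "{bar e}"] upstream_arcs_step[of c _ _ g] by (auto simp: D_def A_def)
  qed
  \<comment> \<open>An upstream path to \<open>r e\<close> would give one to \<open>s e\<close>:
    append \<open>e\<close>, or, if the path ends in \<open>bar e\<close>, delete that edge.\<close>
  have noU: "upstream_paths \<G> (s e) {bar e} (r e) = {}"
  proof (rule ccontr)
    assume "upstream_paths \<G> (s e) {bar e} (r e) \<noteq> {}"
    then obtain p where p: "p \<in> upstream_paths \<G> (s e) {bar e} (r e)" by blast
    then have pne: "p \<noteq> []" by (auto simp: upstream_paths_def)
    show False
    proof (cases "e = bar (last p)")
      case True
      have "last p \<in> edges \<G>" using upstream_arcs_last[OF p] upstream_arcs_edges by blast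
      then have "last p = bar e" using True by simp
      then have "butlast p @ [bar e] \<in> upstream_paths \<G> (s e) {bar e} (r e)" using p pne by (metis append_butlast_last_id)
      then show False unfolding upstream_paths_snoc using acyc e by (simp split: if_splits)
    next
      case False
      then have "p @ [e] \<in> upstream_paths \<G> (s e) {bar e} (s e)"
        unfolding upstream_paths_snoc using p pne e by simp
      then show False using acyc by blast
    qed
  qed
  have f: "follows (f n) (f (Suc n))" and fe: "f n \<noteq> e" for n
    using boundary_follows[OF \<xi>(1)] \<xi>(2) by (auto simp: f_def lies_on_def)
  have fedge: "f n \<in> edges \<G>" for n using f[of n] by (simp add: follows_def)
  have f0: "r (f 0) = r e" using \<xi>(1) by (simp add: f_def boundary_iff)
  have noA: "c \<notin> A" if "s c = r e" for c
    using noU that by (auto simp: A_def upstream_arcs_def)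
  have "f n \<notin> D" for n
  proof (induction n)
    case 0
    show ?case
    proof
      assume "f 0 \<in> D"
      then have "f 0 \<in> A" using fe[of 0] by (simp add: D_def)
      then obtain q where "q @ [f 0] \<in> upstream_paths \<G> (s e) {bar e} (s (f 0))" by (auto simp: A_def upstream_arcs_def)
      then show False unfolding upstream_paths_snoc using f0 noU ne by (simp split: if_splits)
    qed
  next
    case (Suc n)
    show ?case
    proof
      assume "f (Suc n) \<in> D"
      then have "f (Suc n) \<in> A" using fe[of "Suc n"] by (simp add: D_def)
      then obtain q where q: "q @ [f (Suc n)] \<in> upstream_paths \<G> (s e) {bar e} (s (f (Suc n)))"
        by (auto simp: A_def upstream_arcs_def)
      have rf: "r (f (Suc n)) = s (f n)" using f[of n] by (simp add: follows_def)
      have b: "bar (f n) \<in> edges \<G>" "r (bar (f n)) = s (f n)" using fedge by auto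
      \<comment> \<open>The vertex between \<open>f n\<close> and \<open>f (Suc n)\<close> is
        \<open>s e\<close> or the end of an upstream path \<open>q\<close>. Since \<open>f n\<close>
        is neither \<open>e\<close> nor the last edge of \<open>q\<close>, leaving this vertex by
        \<open>bar (f n)\<close> is again upstream.\<close>
      have "bar (f n) \<in> A"
      proof (cases "q = []")
        case True
        have "bar (f n) \<noteq> bar e" using fe[of n] fedge[of n] e by (metis graph_simps(6))
        then show ?thesis
          unfolding A_def using True q b rf by (intro upstream_arcs_start) (auto simp: upstream_paths_snoc[of "[]", simplified])
      next
        case False
        then have qU: "q \<in> upstream_paths \<G> (s e) {bar e} (s (f n))" using q rf unfolding upstream_paths_snoc by simp
        have "last q \<in> A" using upstream_arcs_last[OF qU] by (simp add: A_def)
        then have "f n \<noteq> last q" "last q \<in> edges \<G>" using Suc upstream_arcs_edges by (auto simp: D_def A_def)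
        then have "bar (f n) \<noteq> bar (last q)" using fedge[of n] by (metis graph_simps(6))
        then show ?thesis
          using upstream_arcs_step[of "last q" "s e" "{bar e}" "bar (f n)"] \<open>last q \<in> A\<close> upstream_paths_last[OF qU] b by (simp add: A_def)
      qed
      \<comment> \<open>The edges \<open>bar (f n)\<close>, \<open>bar (f (n - 1))\<close>, ... form
        a chain that begins in the closed set \<open>D\<close>; for \<open>m\<close> beyond
        \<open>n\<close> the index stays 0.\<close>
      then have "bar (f (n - m)) \<in> D" for m
      proof (induction m)
        case (Suc m)
        then show ?case
          using follows_bar[OF f[of "n - Suc m"]] closed unfolding closed_arcs_def
          by (cases "m < n") (auto simp: Suc_diff_Suc)
      qed (simp add: D_def)
      from this[of n] have "bar (f 0) \<in> D" by simp
      then show False using noA[of "bar (f 0)"] f0 fedge[of 0] ne by (auto simp: D_def)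
    qed
  qed
  then show ?thesis using closed f by (intro exI[of _ D] exI[of _ f]) (auto simp: D_def)
qed

text \<open>If \<open>N\<close> is closed but its complement still contains an infinite chain, then no edge of \<open>N\<close>
  can be reversed inside \<open>N\<close>: otherwise all edges at some vertex would lie in \<open>N\<close>, and a chain
  from that vertex avoiding \<open>N\<close> could not start.\<close>

lemma closed_no_reversal:
  assumes N: "closed_arcs N" and f: "\<And>n. follows (f n) (f (Suc n))" "\<And>n. f n \<notin> N" and c: "c \<in> N"
  shows "bar c \<notin> N"
proof
  assume bc: "bar c \<in> N"
  have ce: "c \<in> edges \<G>" using c N by (auto simp: closed_arcs_def)
  have "g \<in> N" if "g \<in> edges \<G>" "r g = s c" for g
    using that follows_intro[OF ce, of g] bc c N by (cases "g = bar c") (auto simp: closed_arcs_def)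
  moreover obtain f' where "\<And>n. follows (f' n) (f' (Suc n))" "\<And>n. f' n \<notin> N" "r (f' 0) = s c"
    using avoiding_chain[of N f "s c"] N f graph_simps(2)[OF ce] by blast
  ultimately show False by (metis follows_def)
qed

section \<open>From closed sets of edges to treelike edges and cycles\<close>

lemma closed_surj:
  assumes N: "closed_arcs N" and norev: "\<And>c. c \<in> N \<Longrightarrow> bar c \<notin> N" and c: "c \<in> N"
  shows "emb_surj \<G> (bar c)"
proof (rule ccontr)
  assume "\<not> emb_surj \<G> (bar c)"
  moreover have "c \<in> edges \<G>" using c N by (auto simp: closed_arcs_def)
  ultimately have "follows c (bar c)" by (simp add: follows_def)
  then show False using N c norev by (auto simp: closed_arcs_def)
qed

text \<open>If \<open>c\<close> and \<open>d\<close> are different edges with the same source, the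
  reversal of \<open>d\<close> follows \<open>c\<close>, so it would lie in \<open>N\<close>
  together with \<open>d\<close>.\<close>

lemma closed_inj_src:
  assumes N: "closed_arcs N" and norev: "\<And>c. c \<in> N \<Longrightarrow> bar c \<notin> N"
  shows "inj_on s N"
proof (rule inj_onI, rule ccontr)
  fix c d assume cd: "c \<in> N" "d \<in> N" "s c = s d" "c \<noteq> d"
  then have e: "c \<in> edges \<G>" "d \<in> edges \<G>" using N by (auto simp: closed_arcs_def)
  then have "bar d \<noteq> bar c" using cd(4) by (metis graph_simps(6))
  then have "follows c (bar d)" using e cd(3) by (intro follows_intro) auto
  then show False using N cd norev by (auto simp: closed_arcs_def)
qed

text \<open>Excluding \<open>bar c\<close> as first edge makes the path a continuation of
  \<open>c\<close> without backtracking, hence a chain inside \<open>N\<close>.\<close>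

lemma upstream_in_closed:
  assumes N: "closed_arcs N" and c: "c \<in> N" and F: "bar c \<in> F" and p: "p \<in> upstream_paths \<G> (s c) F y"
  shows "set p \<subseteq> N"
  using p
proof (induction p arbitrary: y rule: rev_induct)
  case (snoc g q)
  have "\<exists>d\<in>N. g \<noteq> bar d \<and> r g = s d \<and> g \<in> edges \<G> \<and> set q \<subseteq> N"
  proof (cases "q = []")
    case True
    then show ?thesis using snoc.prems c F unfolding upstream_paths_snoc by auto
  next
    case False
    then have q: "q \<in> upstream_paths \<G> (s c) F (r g)" "g \<noteq> bar (last q)" "g \<in> edges \<G>"
      using snoc.prems unfolding upstream_paths_snoc by auto
    then show ?thesis using snoc.IH[OF q(1)] upstream_paths_last[OF q(1)] last_in_set[OF False] by auto
  qed
  then show ?case using N follows_intro by (fastforce simp: closed_arcs_def)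
qed simp

text \<open>Injectivity of sources and surjectivity at reversals hold on all of \<open>N\<close>, so
  only the absence of closed upstream paths is left to the individual cases.\<close>

lemma closed_treelike:
  assumes N: "closed_arcs N" and norev: "\<And>c. c \<in> N \<Longrightarrow> bar c \<notin> N" and c: "c \<in> N" and F: "bar c \<in> F"
    and acyc: "upstream_paths \<G> (s c) F (s c) = {}"
  shows "treelike_at (s c) F"
proof -
  have v: "s c \<in> verts \<G>" using c N by (auto simp: closed_arcs_def)
  have sub: "upstream_arcs (s c) F \<subseteq> N"
    using upstream_in_closed[OF N c F] by (fastforce simp: upstream_arcs_def)
  then have "inj_on s (upstream_arcs (s c) F)"
    using closed_inj_src[OF N norev] inj_on_subset by blast
  from upstream_tree[OF v this acyc] show ?thesis
    using sub closed_surj[OF N norev] by (auto simp: treelike_at_def)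
qed

text \<open>Following the cycle from one of its edges stays in \<open>N\<close>. A closed upstream
  path would be forced, from its last edge backwards, to run along the cycle, and so would start
  with an excluded edge.\<close>

lemma nonminimal_cycle:
  assumes N: "closed_arcs N" and norev: "\<And>c. c \<in> N \<Longrightarrow> bar c \<notin> N"
    and cyc: "minimal_cycle \<G> \<eta>" and e: "e \<in> N" "e \<in> set \<eta>"
  shows "set \<eta> \<subseteq> N" "treelike_cycle \<G> \<eta>"
proof -
  define L where "L = length \<eta>"
  have L: "0 < L" using minimal_cycle_nth(1)[OF cyc] by (simp add: L_def)
  have edge: "\<eta> ! i \<in> edges \<G>" if "i < L" for i using minimal_cycle_nth(2)[OF cyc] that by (simp add: L_def)
  have step: "s (\<eta> ! i) = r (\<eta> ! (Suc i mod L))" if "i < L" for i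
    using minimal_cycle_nth(3)[OF cyc] that by (simp add: L_def)
  have red: "\<eta> ! (Suc i mod L) \<noteq> bar (\<eta> ! i)" if "i < L" for i
    using minimal_cycle_nth(4)[OF cyc] that by (simp add: L_def)
  have inj: "i = j" if "i < L" "j < L" "r (\<eta> ! i) = r (\<eta> ! j)" for i j
    using minimal_cycle_nth(5)[OF cyc] that by (simp add: L_def)
  have mem: "c \<in> set \<eta> \<longleftrightarrow> (\<exists>i<L. c = \<eta> ! i)" for c by (auto simp: in_set_conv_nth L_def)
  obtain i where i: "i < L" "e = \<eta> ! i" using e mem by blast
  have around: "\<eta> ! ((i + n) mod L) \<in> N" for n
  proof (induction n)
    case 0
    then show ?case using i e by simp
  next
    case (Suc n)
    define k where "k = (i + n) mod L"
    have k: "k < L" "Suc k mod L < L" using L by (simp_all add: k_def)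
    have "follows (\<eta> ! k) (\<eta> ! (Suc k mod L))"
      using step[OF k(1)] red[OF k(1)] edge k by (intro follows_intro) auto
    then have "\<eta> ! (Suc k mod L) \<in> N" using Suc N by (auto simp: k_def closed_arcs_def)
    then show ?case by (simp add: k_def mod_Suc_eq)
  qed
  have inN: "\<eta> ! k \<in> N" if "k < L" for k
    using around[of "L - i + k"] i that by simp
  then show sub: "set \<eta> \<subseteq> N" by (auto simp: mem)
  show "treelike_cycle \<G> \<eta>"
    unfolding treelike_cycle_iff
  proof (intro allI impI)
    fix j assume "j < length \<eta>"
    then have j: "j < L" by (simp add: L_def)
    let ?F = "{\<eta> ! (Suc j mod length \<eta>), bar (\<eta> ! j)}"
    show "treelike_at (s (\<eta> ! j)) ?F"
    proof (rule closed_treelike[OF N norev inN[OF j]])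
      \<comment> \<open>Read backwards, the path cannot leave the cycle: its edge before
        \<open>\<eta> ! k\<close> has the same source as the cyclic predecessor
        \<open>\<eta> ! k'\<close>, and sources are injective on \<open>N\<close>.\<close>
      have stays: "set p \<subseteq> set \<eta>" if "p \<in> upstream_paths \<G> (s (\<eta> ! j)) ?F y" "last p \<in> set \<eta>" for p y
        using that
      proof (induction p arbitrary: y rule: rev_induct)
        case (snoc c q)
        show ?case
        proof (cases "q = []")
          case False
          obtain k where k: "k < L" "c = \<eta> ! k" using snoc.prems(2) mem by auto
          define k' where "k' = (k + (L - 1)) mod L"
          have k': "k' < L" "Suc k' mod L = k" using L k by (simp_all add: k'_def mod_Suc_eq)
          have q: "q \<in> upstream_paths \<G> (s (\<eta> ! j)) ?F (r c)"
            using snoc.prems(1) False unfolding upstream_paths_snoc by simp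
          have "last q \<in> N"
            using upstream_in_closed[OF N inN[OF j] _ q] False by auto
          moreover have "s (last q) = s (\<eta> ! k')"
            using upstream_paths_last[OF q] step[OF k'(1)] k k' by simp
          ultimately have "last q = \<eta> ! k'"
            using closed_inj_src[OF N norev] inN[OF k'(1)] by (auto dest: inj_onD)
          then have "last q \<in> set \<eta>" using k' mem by blast
          then show ?thesis using snoc.IH[OF q] snoc.prems(2) by simp
        qed (use snoc.prems in simp)
      qed simp
      show "upstream_paths \<G> (s (\<eta> ! j)) ?F (s (\<eta> ! j)) = {}"
      proof (rule ccontr)
        assume "upstream_paths \<G> (s (\<eta> ! j)) ?F (s (\<eta> ! j)) \<noteq> {}"
        then obtain p where p: "p \<in> upstream_paths \<G> (s (\<eta> ! j)) ?F (s (\<eta> ! j))" by blast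
        have "set p \<subseteq> N" by (rule upstream_in_closed[OF N inN[OF j] _ p]) simp
        moreover have pne: "p \<noteq> []" "hd p \<notin> ?F" "gpath \<G> (s (\<eta> ! j)) p (s (\<eta> ! j))"
          using p by (auto simp: upstream_paths_def rpaths_def)
        ultimately have "last p \<in> N" by auto
        then have "last p = \<eta> ! j"
          using closed_inj_src[OF N norev] inN[OF j] upstream_paths_last[OF p] by (auto dest: inj_onD)
        then have "last p \<in> set \<eta>" using j mem by blast
        then have "hd p \<in> set \<eta>" using stays[OF p] pne by auto
        then obtain k where k: "k < L" "hd p = \<eta> ! k" using mem by blast
        have "r (hd p) = s (\<eta> ! j)" using pne by (cases p) auto
        \<comment> \<open>The first edge lies on the cycle and has range
          \<open>s (\<eta> ! j)\<close>, so it is the next edge of the cycle, which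
          \<open>?F\<close> excludes.\<close>
        then have "k = Suc j mod L" using inj[of k "Suc j mod L"] k step[OF j] L by simp
        then show False using pne k by (simp add: L_def)
      qed
    qed simp_all
  qed
qed

text \<open>A closed upstream path at \<open>s e\<close> ends in \<open>e\<close> by injectivity of
  sources. Without its last edge it joins \<open>s e\<close> to \<open>r e\<close> inside
  \<open>N\<close>; after loop erasure it closes up with \<open>e\<close> to a minimal cycle,
  reduced because \<open>N\<close> contains no edge together with its reversal.\<close>

lemma nonminimal_bridge:
  assumes N: "closed_arcs N" and norev: "\<And>c. c \<in> N \<Longrightarrow> bar c \<notin> N" and e: "e \<in> N"
    and nocyc: "\<And>\<eta>. minimal_cycle \<G> \<eta> \<Longrightarrow> e \<notin> set \<eta>"
  shows "treelike_edge \<G> e"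
proof -
  have ee: "e \<in> edges \<G>" using e N by (auto simp: closed_arcs_def)
  have ne: "s e \<noteq> r e" using minimal_cycle_loop[OF ee] nocyc by force
  have "treelike_at (s e) {bar e}"
  proof (rule closed_treelike[OF N norev e])
    show "upstream_paths \<G> (s e) {bar e} (s e) = {}"
    proof (rule ccontr)
      assume "upstream_paths \<G> (s e) {bar e} (s e) \<noteq> {}"
      then obtain p where p: "p \<in> upstream_paths \<G> (s e) {bar e} (s e)" by blast
      have pN: "set p \<subseteq> N" by (rule upstream_in_closed[OF N e _ p]) simp
      have pne: "p \<noteq> []" and path: "gpath \<G> (s e) p (s e)" using p by (auto simp: upstream_paths_def rpaths_def)
      have "last p = e"
        using inj_onD[OF closed_inj_src[OF N norev] upstream_paths_last[OF p]] e pN last_in_set[OF pne] by blast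
      then have "p = butlast p @ [e]" using pne by (metis append_butlast_last_id)
      then have "gpath \<G> (s e) (butlast p) (r e)" using path by (metis gpath_snoc)
      moreover have "set (butlast p) \<subseteq> N" using pN by (meson in_set_butlastD subset_iff)
      ultimately obtain q where q: "gpath \<G> (s e) q (r e)" "set q \<subseteq> N" "distinct (map r q @ [r e])"
        using simple_path by blast
      have "successively (\<lambda>c d. d \<noteq> bar c) (e # q)"
        unfolding successively_conv_nth
      proof (intro allI impI)
        fix i assume "Suc i < length (e # q)"
        then have "(e # q) ! i \<in> N" "(e # q) ! Suc i \<in> N" using q(2) e by (auto simp: nth_Cons split: nat.split)
        then show "(e # q) ! Suc i \<noteq> bar ((e # q) ! i)" using norev by metis
      qed
      then have "e # q \<in> rpaths \<G> (r e) (r e)" using q ee by (simp add: rpaths_def reduced_path_iff)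
      then have "minimal_cycle \<G> (e # q)" using q(3) by (auto simp: minimal_cycle_def)
      then show False using nocyc by force
    qed
  qed simp_all
  then show ?thesis using ne by (simp add: treelike_edge_iff)
qed

text \<open>Any edge of the closed set serves as \<open>e\<close>: a minimal cycle through it gives
  (b), or (a) if its length is one, and without such a cycle (c) holds.\<close>

lemma not_minimal_iff_treelike:
  assumes ns: "nonsingular_gog \<G>" and v: "v \<in> verts \<G>"
  shows "\<not> minimal_action (pi1 \<G> v) (boundary_topology \<G> S v) (boundary_action \<G> S v) \<longleftrightarrow>
    (\<exists>e\<in>edges \<G>. emb_surj \<G> (opp \<G> e) \<and>
      (rng \<G> e = src \<G> e \<and> treelike_edge \<G> e \<or>
       (\<exists>\<eta>. minimal_cycle \<G> \<eta> \<and> length \<eta> > 1 \<and> e \<in> set \<eta> \<and>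
          (\<forall>f\<in>set \<eta>. emb_surj \<G> (opp \<G> f)) \<and> treelike_cycle \<G> \<eta>) \<or>
       (\<not> (\<exists>\<eta>. minimal_cycle \<G> \<eta> \<and> e \<in> set \<eta>) \<and> treelike_edge \<G> e \<and>
          (\<exists>\<xi>\<in>boundary \<G> S (rng \<G> e). \<not> lies_on e \<xi>))))"
    (is "?l \<longleftrightarrow> (\<exists>e\<in>edges \<G>. ?P e)")
proof
  assume ?l
  then obtain D f where D: "closed_arcs D" "D \<noteq> {}" and f: "\<And>n. follows (f n) (f (Suc n))" "\<And>n. f n \<notin> D"
    unfolding not_minimal_iff[OF assms] by blast
  then have norev: "\<And>c. c \<in> D \<Longrightarrow> bar c \<notin> D" using closed_no_reversal[of D f] by blast
  have surj: "emb_surj \<G> (bar c)" if "c \<in> D" for c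
    using closed_surj[OF D(1)] norev that by blast
  obtain e where e: "e \<in> D" using D(2) by blast
  have ee: "e \<in> edges \<G>" using e D(1) by (auto simp: closed_arcs_def)
  have "?P e"
  proof (cases "\<exists>\<eta>. minimal_cycle \<G> \<eta> \<and> e \<in> set \<eta>")
    case True
    then obtain \<eta> where cyc: "minimal_cycle \<G> \<eta>" and e\<eta>: "e \<in> set \<eta>" by blast
    have sub: "set \<eta> \<subseteq> D" and tree: "treelike_cycle \<G> \<eta>"
      using nonminimal_cycle[OF D(1) norev cyc e e\<eta>] by blast+
    show ?thesis
    proof (cases "length \<eta> > 1")
      case True
      then have "\<exists>\<eta>. minimal_cycle \<G> \<eta> \<and> length \<eta> > 1 \<and> e \<in> set \<eta> \<and>
          (\<forall>f\<in>set \<eta>. emb_surj \<G> (opp \<G> f)) \<and> treelike_cycle \<G> \<eta>"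
        using cyc e\<eta> sub tree surj by blast
      then show ?thesis using surj[OF e] by blast
    next
      case False
      moreover have "\<eta> \<noteq> []" using e\<eta> by auto
      ultimately have "\<eta> = [e]" using e\<eta> by (cases \<eta>; cases "tl \<eta>") auto
      then have "s e = r e" using minimal_cycle_nth(3)[OF cyc, of 0] by simp
      then show ?thesis using treelike_loop tree surj[OF e] \<open>\<eta> = [e]\<close> by simp
    qed
  next
    case False
    then have tree: "treelike_edge \<G> e" using nonminimal_bridge[OF D(1) norev e] by blast
    \<comment> \<open>The avoiding chain, moved to start at \<open>r e\<close>, provides the
      boundary point required in (c); it misses \<open>e\<close> because \<open>e\<close> is in
      \<open>D\<close>.\<close>
    obtain f' where f': "\<And>n. follows (f' n) (f' (Suc n))" "\<And>n. f' n \<notin> D" "r (f' 0) = r e"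
      using avoiding_chain[of D f "r e"] D(1) f graph_simps(1)[OF ee] by blast
    obtain \<xi> where \<xi>: "\<xi> \<in> boundary \<G> S (r e)" "\<And>n. snd (\<xi> n) = f' n"
      using chain_lift[of f', OF f'(1)] unfolding f'(3) by blast
    have "\<not> lies_on e \<xi>" using \<xi>(2) f'(2) e by (metis lies_on_def)
    then show ?thesis using False tree \<xi>(1) surj[OF e] by blast
  qed
  then show "\<exists>e\<in>edges \<G>. ?P e" using ee by blast
next
  assume "\<exists>e\<in>edges \<G>. ?P e"
  then obtain e where e: "e \<in> edges \<G>" and P: "?P e" by blast
  have "\<exists>D f. closed_arcs D \<and> D \<noteq> {} \<and> (\<forall>n. follows (f n) (f (Suc n))) \<and> (\<forall>n. f n \<notin> D)"
  proof -
    consider "r e = s e" "treelike_edge \<G> e"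
      | \<eta> where "minimal_cycle \<G> \<eta>" "\<forall>f\<in>set \<eta>. emb_surj \<G> (bar f)" "treelike_cycle \<G> \<eta>"
      | \<xi> where "\<not> (\<exists>\<eta>. minimal_cycle \<G> \<eta> \<and> e \<in> set \<eta>)" "treelike_edge \<G> e"
        "\<xi> \<in> boundary \<G> S (r e)" "\<not> lies_on e \<xi>"
      using P by blast
    then show ?thesis
    proof cases
      case 1
      then show ?thesis
        using cycle_witness[OF minimal_cycle_loop[OF e]] treelike_loop[of e] P by simp
    next
      case 2
      then show ?thesis using cycle_witness by blast
    next
      case 3
      then show ?thesis using bridge_witness[OF e] P by blast
    qed
  qed
  then show ?l unfolding not_minimal_iff[OF assms] .
qed

end

theorem theorem5p9:
  fixes \<G> :: "('v, 'e, 'g, 'h) gog"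
    and S :: "'e \<Rightarrow> 'g set"
    and v :: 'v
  assumes "graph_of_groups \<G>"
    and "locally_finite_gog \<G>"
    and "nonsingular_gog \<G>"
    and "countable_groups_gog \<G>"
    and "\<And>e. e \<in> edges \<G> \<Longrightarrow> is_transversal \<G> e (S e)"
    and "edges \<G> \<noteq> {}"
    and "v \<in> verts \<G>"
  shows "\<not> minimal_action (pi1 \<G> v) (boundary_topology \<G> S v) (boundary_action \<G> S v) \<longleftrightarrow>
    (\<exists>e\<in>edges \<G>. emb_surj \<G> (opp \<G> e) \<and>
      (rng \<G> e = src \<G> e \<and> treelike_edge \<G> e \<or>
       (\<exists>\<eta>. minimal_cycle \<G> \<eta> \<and> length \<eta> > 1 \<and> e \<in> set \<eta> \<and>
          (\<forall>f\<in>set \<eta>. emb_surj \<G> (opp \<G> f)) \<and> treelike_cycle \<G> \<eta>) \<or>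
       (\<not> (\<exists>\<eta>. minimal_cycle \<G> \<eta> \<and> e \<in> set \<eta>) \<and> treelike_edge \<G> e \<and>
          (\<exists>\<xi>\<in>boundary \<G> S (rng \<G> e). \<not> lies_on e \<xi>))))"
proof -
  interpret gog_transversals \<G> S
    using assms(1,5) by (simp add: gog_transversals_def gog_transversals_axioms_def)
  show ?thesis by (rule not_minimal_iff_treelike[OF assms(3,7)])
qed

end
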